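(* Let $X \geq 1$ be an integer and let $k \geq 180$ be an even integer. If $r = \dim(S_k)$, then $$\mathcal{P}_k(X) \geq \frac{1}{2^{r-1}}.$$
   Context: $S_k$ is the complex vector space of cusp forms of weight $k$ for $\mathrm{SL}_2(\mathbb{Z})$, $q = e^{2\pi i z}$, and $f_1,\dots,f_r$ is the basis of normalized Hecke eigenforms (Fourier expansion $q+O(q^2)$) of $S_k$. For integers $X \geq 1$ and $k \geq 12$ even, define $$\mathcal{S}_{k,X} := \{ f = c_1 f_1 + \dots + c_r f_r : -X \leq c_j \leq X,\ c_j \in \mathbb{Z} \},$$ $$\mathcal{S}_{k,X}^{\mathrm{RH}} := \{ f \in \mathcal{S}_{k,X} : r_f(z) \text{ satisfies the Riemann hypothesis} \}, \qquad \mathcal{P}_k(X) := \frac{|\mathcal{S}_{k,X}^{\mathrm{RH}}|}{|\mathcal{S}_{k,X}|}.$$ For $f \in S_k$ with Fourier expansion $f(z)=\sum_{n\ge1} a_n q^n$, the Eichler integral is $\mathcal{E}_f(z) := \int_z^{i\infty} f(\tau)(\tau - z)^{k-2}\, d\tau$ (for $\mathrm{Im}\, z>0$), and the period polynomial of $f$ is $$r_f(z) := \mathcal{E}_f(z) - z^{k-2}\mathcal{E}_f(-1/z) = -\frac{(k-2)!}{(2\pi i)^{k-1}} \sum_{n=0}^{k-2} \frac{(2\pi i z)^n}{n!} L(f, k-n-1),$$ a polynomial of degree at most $k-2$, where $L(f,s)$ is the analytic continuation of $\sum_{n \geq 1} a_n n^{-s}$. We say that $r_f(z)$ satisfies the Riemann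 hypothesis (equivalently, is unimodular) if all of its complex zeros lie on the unit circle $|z| = 1$. *)

theory Defs
  imports
    "HOL-Complex_Analysis.Complex_Analysis"
    "HOL-Computational_Algebra.Polynomial"
    "HOL-Library.Function_Algebras"
begin

text \<open>
  Forms on the upper half-plane are functions \<open>complex \<Rightarrow> complex\<close> that are required to vanish
  off it, so that equality of forms is equality of functions and the cusp forms are
  a subspace of the complex vector space of all functions \<open>complex \<Rightarrow> complex\<close>.
\<close>

definition fscale :: "complex \<Rightarrow> (complex \<Rightarrow> complex) \<Rightarrow> complex \<Rightarrow> complex" where
  "fscale c f = (\<lambda>z. c * f z)"

global_interpretation cfun: vector_space fscale
  by standard (auto simp: fscale_def fun_eq_iff algebra_simps)

definition has_q_expansion :: "(complex \<Rightarrow> complex) \<Rightarrow> (nat \<Rightarrow> complex) \<Rightarrow> bool" where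
  "has_q_expansion f a \<longleftrightarrow>
     (\<forall>z. Im z > 0 \<longrightarrow> (\<lambda>n. a n * exp (2 * of_real pi * \<i> * z) ^ n) sums f z)"

definition cusp_forms :: "nat \<Rightarrow> (complex \<Rightarrow> complex) set" where
  "cusp_forms k = {f.
     f holomorphic_on {z. Im z > 0} \<and>
     (\<forall>z. \<not> Im z > 0 \<longrightarrow> f z = 0) \<and>
     (\<forall>a b c d :: int. a * d - b * c = 1 \<longrightarrow>
        (\<forall>z. Im z > 0 \<longrightarrow>
          f ((of_int a * z + of_int b) / (of_int c * z + of_int d)) =
            (of_int c * z + of_int d) ^ k * f z)) \<and>
     (\<exists>a. has_q_expansion f a \<and> a 0 = 0)}"

lemma subspace_cusp_forms: "cfun.subspace (cusp_forms k)"
proof (rule cfun.subspaceI)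
  have "has_q_expansion 0 (\<lambda>_. 0)"
    by (simp add: has_q_expansion_def)
  then have "\<exists>a. has_q_expansion 0 a \<and> a 0 = 0"
    by (intro exI conjI) auto
  then show "0 \<in> cusp_forms k"
    by (simp add: cusp_forms_def zero_fun_def)
next
  fix f g assume f: "f \<in> cusp_forms k" and g: "g \<in> cusp_forms k"
  from f g obtain a b where "has_q_expansion f a" "a 0 = 0" "has_q_expansion g b" "b 0 = 0"
    unfolding cusp_forms_def by blast
  then have "has_q_expansion (f + g) (\<lambda>n. a n + b n) \<and> a 0 + b 0 = 0"
    by (auto simp: has_q_expansion_def distrib_right intro!: sums_add)
  then have "\<exists>a. has_q_expansion (f + g) a \<and> a 0 = 0"
    by (rule exI[where x = "\<lambda>n. a n + b n"])
  moreover have "(f + g) holomorphic_on {z. Im z > 0}"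
    using f g by (auto simp: cusp_forms_def plus_fun_def intro!: holomorphic_intros)
  ultimately show "f + g \<in> cusp_forms k"
    using f g by (simp add: cusp_forms_def distrib_left)
next
  fix c f assume f: "f \<in> cusp_forms k"
  from f obtain a where "has_q_expansion f a" "a 0 = 0"
    unfolding cusp_forms_def by blast
  then have "has_q_expansion (fscale c f) (\<lambda>n. c * a n) \<and> c * a 0 = 0"
    by (auto simp: has_q_expansion_def fscale_def mult.assoc intro!: sums_mult)
  then have "\<exists>a. has_q_expansion (fscale c f) a \<and> a 0 = 0"
    by (rule exI[where x = "\<lambda>n. c * a n"])
  moreover have "fscale c f holomorphic_on {z. Im z > 0}"
    using f by (auto simp: cusp_forms_def fscale_def intro!: holomorphic_intros)
  ultimately show "fscale c f \<in> cusp_forms k"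
    using f by (simp add: cusp_forms_def) (simp add: fscale_def)
qed

text \<open>
  \<open>(T\<^sub>n f)(z) = n\<^sup>k\<^sup>-\<^sup>1 \<Sum> d\<^sup>-\<^sup>k f((a z + b)/d)\<close>, summed over \<open>a d = n\<close>, \<open>0 \<le> b < d\<close>.
\<close>

definition hecke :: "nat \<Rightarrow> nat \<Rightarrow> (complex \<Rightarrow> complex) \<Rightarrow> complex \<Rightarrow> complex" where
  "hecke k n f = (\<lambda>z. of_nat n ^ (k - 1) *
     (\<Sum>d | d dvd n. \<Sum>b<d. f ((of_nat (n div d) * z + of_nat b) / of_nat d) / of_nat d ^ k))"

definition hecke_eigenform :: "nat \<Rightarrow> (complex \<Rightarrow> complex) \<Rightarrow> bool" where
  "hecke_eigenform k f \<longleftrightarrow>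
     f \<in> cusp_forms k \<and> f \<noteq> 0 \<and> (\<forall>n\<ge>1. \<exists>c. hecke k n f = fscale c f)"

text \<open>
  The normalized eigenforms \<open>f\<^sub>1, \<dots>, f\<^sub>r\<close> enter as a set: the Hecke eigenbasis of \<open>S\<^sub>k\<close>
  consists of all normalized eigenforms, and nothing below depends on their order.
\<close>

definition normalized_eigenforms :: "nat \<Rightarrow> (complex \<Rightarrow> complex) set" where
  "normalized_eigenforms k = {f.
     hecke_eigenform k f \<and> (\<exists>a. has_q_expansion f a \<and> a 0 = 0 \<and> a 1 = 1)}"

text \<open>The integral from \<open>z\<close> to \<open>i\<infinity>\<close> is taken along the vertical ray \<open>\<tau> = z + i t\<close>.\<close>

definition eichler_integral :: "nat \<Rightarrow> (complex \<Rightarrow> complex) \<Rightarrow> complex \<Rightarrow> complex" where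
  "eichler_integral k f z =
     (LBINT t:{0<..}. f (z + \<i> * of_real t) * (\<i> * of_real t) ^ (k - 2) * \<i>)"

text \<open>
  The Eichler integral lives on the upper half-plane only; the period polynomial is the
  polynomial that agrees there with \<open>E\<^sub>f(z) - z\<^sup>k\<^sup>-\<^sup>2 E\<^sub>f(-1/z)\<close>.
  It is unique because a polynomial is determined by its values on an infinite set.
\<close>

definition period_poly :: "nat \<Rightarrow> (complex \<Rightarrow> complex) \<Rightarrow> complex poly" where
  "period_poly k f = (THE p. \<forall>z. Im z > 0 \<longrightarrow>
     poly p z = eichler_integral k f z - z ^ (k - 2) * eichler_integral k f (- 1 / z))"

text \<open>In particular the zero polynomial is not unimodular.\<close>

definition unimodular :: "complex poly \<Rightarrow> bool" where
  "unimodular p \<longleftrightarrow> (\<forall>z. poly p z = 0 \<longrightarrow> norm z = 1)"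

definition box_forms :: "nat \<Rightarrow> int \<Rightarrow> (complex \<Rightarrow> complex) set" where
  "box_forms k X = {\<Sum>g\<in>normalized_eigenforms k. fscale (of_int (c g)) g | c.
     \<forall>g\<in>normalized_eigenforms k. - X \<le> c g \<and> c g \<le> X}"

definition box_forms_RH :: "nat \<Rightarrow> int \<Rightarrow> (complex \<Rightarrow> complex) set" where
  "box_forms_RH k X = {f \<in> box_forms k X. unimodular (period_poly k f)}"

definition RH_proportion :: "nat \<Rightarrow> int \<Rightarrow> real" where
  "RH_proportion k X = real (card (box_forms_RH k X)) / real (card (box_forms k X))"

end

theory Submission imports Defs "HOL-Computational_Algebra.Fundamental_Theorem_Algebra" begin

text \<open>
  If the coefficients \<open>c\<^sub>j\<close> are nonnegative and not all zero, then \<open>f = \<Sum> c\<^sub>j f\<^sub>j\<close> has real Fourier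
  coefficients with \<open>\<bar>a\<^sub>n\<bar> \<le> a\<^sub>1 n\<^bsup>k/2+1\<^esup>\<close>: the Hecke eigenvalues are real, and a sup-norm
  argument gives this bound for each of them (Deligne's theorem is not needed). In the
  variable \<open>w = iz\<close> the period polynomial is self-reciprocal with real coefficients,
  and for \<open>k \<ge> 180\<close> its lower half is so close to a multiple of \<open>exp (2\<pi>w)\<close> that it does not vanish on the
  closed unit disc; this forces all zeros onto the unit circle. The same holds if all \<open>c\<^sub>j \<le> 0\<close>.
  With \<open>N \<le> r\<close> eigenforms there are \<open>2 ((X + 1)\<^sup>N - 1)\<close> such coefficient vectors among \<open>(2X + 1)\<^sup>N\<close>,
  which is a proportion of at least \<open>2\<^bsup>1-r\<^esup>\<close> once \<open>r \<ge> 2\<close>; two independent cusp forms are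
  exhibited with Eisenstein series.
\<close>

section \<open>Integer matrices acting on the upper half-plane\<close>

text \<open>The bound 180 has two independent origins. The coefficient bound n^(h+1), with h = k/2,
  costs a factor (2h+2)^4 in the error estimate, which a power of 1/2 growing with h has to beat.
  For the dimension, a cusp form u of weight 80 gives u E and u^2 E', where E' has weight k - 160 >=
  20, large enough for an explicit estimate to show that its value at the cusp is nonzero. The
  inequality r >= 2 is essential: the zero form never qualifies, so with a single eigenform at most
  2X of the 2X + 1 forms do, and for r = 1 the claimed bound would be 1. Reality of the eigenvalues
  enters through reflection in the unit circle: for real coefficients the lower half of the
  polynomial and its reversal have equal modulus there, so a zero-free lower half controls the whole
  polynomial. The sign condition on the c_j makes a_1 the sum of all |c_j|, so the first Fourier
  term cannot be lost to cancellation while the others are bounded by the triangle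
  inequality.\<close>

type_synonym imat = "int \<times> int \<times> int \<times> int"

fun mdet :: "imat \<Rightarrow> int" where
  "mdet (a, b, c, d) = a * d - b * c"

fun mact :: "imat \<Rightarrow> complex \<Rightarrow> complex" where
  "mact (a, b, c, d) z = (of_int a * z + of_int b) / (of_int c * z + of_int d)"

fun mj :: "imat \<Rightarrow> complex \<Rightarrow> complex" where
  "mj (a, b, c, d) z = of_int c * z + of_int d"

fun mmul :: "imat \<Rightarrow> imat \<Rightarrow> imat" where
  "mmul (a, b, c, d) (a', b', c', d') =
     (a * a' + b * c', a * b' + b * d', c * a' + d * c', c * b' + d * d')"

fun madj :: "imat \<Rightarrow> imat" where
  "madj (a, b, c, d) = (d, - b, - c, a)"

definition SL2Z :: "imat set" where "SL2Z = {g. mdet g = 1}"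

definition hecke_reps :: "nat \<Rightarrow> imat set" where
  "hecke_reps n = (\<lambda>(d, b). (int (n div d), int b, 0, int d)) ` (SIGMA d:{d. d dvd n}. {..<d})"

text \<open>A common normalization carries the factor det^(k-1). It is left out here: on matrices of
  determinant n it is constant and is the prefactor in \<open>hecke_eq_slash\<close>.\<close>

definition slash :: "nat \<Rightarrow> (complex \<Rightarrow> complex) \<Rightarrow> imat \<Rightarrow> complex \<Rightarrow> complex" where
  "slash k f g z = f (mact g z) / mj g z ^ k"

lemma mmul_assoc: "mmul (mmul x y) w = mmul x (mmul y w)"
  by (cases x; cases y; cases w) (simp add: algebra_simps)

lemma mdet_mmul [simp]: "mdet (mmul x y) = mdet x * mdet y"
  by (cases x; cases y) (simp add: algebra_simps)

lemma mdet_madj [simp]: "mdet (madj x) = mdet x"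
  by (cases x) (simp add: algebra_simps)

lemma madj_madj [simp]: "madj (madj x) = x"
  by (cases x) simp

lemma madj_mmul_self: "mmul (madj x) x = (mdet x, 0, 0, mdet x)"
  by (cases x) (simp add: algebra_simps)

lemma mmul_madj_self: "mmul x (madj x) = (mdet x, 0, 0, mdet x)"
  by (cases x) (simp add: algebra_simps)

lemma mmul_one [simp]: "mmul (1, 0, 0, 1) x = x" "mmul x (1, 0, 0, 1) = x"
  by (cases x; simp)+

lemma mj_nonzero:
  assumes "Im z > 0" "mdet g \<noteq> 0"
  shows "mj g z \<noteq> 0"
proof (cases g)
  case (fields a b c d)
  show ?thesis
  proof
    assume 0: "mj g z = 0"
    then have "Im (mj g z) = 0" "Re (mj g z) = 0" by auto
    then have "c = 0" "d = 0" using assms fields by auto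
    then show False using assms fields by simp
  qed
qed

lemma Im_mact:
  assumes "Im z > 0" "mdet g \<noteq> 0"
  shows "Im (mact g z) = of_int (mdet g) * Im z / (cmod (mj g z))\<^sup>2"
proof (cases g)
  case (fields a b c d)
  have "Im (mact g z) = Im ((of_int a * z + of_int b) * cnj (mj g z)) / (cmod (mj g z))\<^sup>2"
    using fields by (simp add: Im_divide cmod_power2)
  also have "Im ((of_int a * z + of_int b) * cnj (mj g z)) = of_int (mdet g) * Im z"
    using fields by (simp add: algebra_simps)
  finally show ?thesis .
qed

lemma Im_mact_pos:
  assumes "Im z > 0" "mdet g > 0"
  shows "Im (mact g z) > 0"
  using Im_mact[of z g] mj_nonzero[of z g] assms by simp

lemma mj_mmul:
  assumes "Im z > 0" "mdet h \<noteq> 0"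
  shows "mj (mmul g h) z = mj g (mact h z) * mj h z"
  using mj_nonzero[OF assms] by (cases g; cases h) (simp add: field_simps)

lemma mact_mmul:
  assumes "Im z > 0" "mdet h \<noteq> 0"
  shows "mact (mmul g h) z = mact g (mact h z)"
proof (cases g; cases h)
  fix a b c d a' b' c' d' assume g: "g = (a, b, c, d)" and h: "h = (a', b', c', d')"
  define p q where "p = of_int a' * z + of_int b'" and "q = of_int c' * z + of_int d'"
  have q: "q \<noteq> 0" using mj_nonzero[OF assms] h by (simp add: q_def)
  have "mact g (mact h z) = (of_int a * (p / q) + of_int b) / (of_int c * (p / q) + of_int d)"
    by (simp add: g h p_def q_def)
  also have "\<dots> = ((of_int a * p + of_int b * q) / q) / ((of_int c * p + of_int d * q) / q)"
    using q by (simp add: field_simps)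
  also have "\<dots> = (of_int a * p + of_int b * q) / (of_int c * p + of_int d * q)"
    using q by simp
  also have "\<dots> = mact (mmul g h) z"
    by (simp add: g h p_def q_def algebra_simps)
  finally show ?thesis by simp
qed

lemma slash_mmul:
  assumes "Im z > 0" "mdet h \<noteq> 0"
  shows "slash k f (mmul g h) z = slash k f g (mact h z) / mj h z ^ k"
  using assms by (simp add: slash_def mact_mmul mj_mmul power_mult_distrib)

lemma SL2Z_mmul: "g \<in> SL2Z \<Longrightarrow> h \<in> SL2Z \<Longrightarrow> mmul g h \<in> SL2Z"
  by (simp add: SL2Z_def)

lemma SL2Z_madj: "g \<in> SL2Z \<Longrightarrow> madj g \<in> SL2Z"
  by (simp add: SL2Z_def)

lemma cusp_forms_mact:
  assumes "f \<in> cusp_forms k" "g \<in> SL2Z" "Im z > 0"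
  shows "f (mact g z) = mj g z ^ k * f z"
  using assms by (cases g) (auto simp: cusp_forms_def SL2Z_def)

lemma slash_SL2Z:
  assumes "f \<in> cusp_forms k" "g \<in> SL2Z" "Im z > 0"
  shows "slash k f g z = f z"
  using assms mj_nonzero[of z g] by (simp add: slash_def cusp_forms_mact SL2Z_def)

lemma slash_SL2Z_mmul:
  assumes "f \<in> cusp_forms k" "g \<in> SL2Z" "Im z > 0" "mdet h > 0"
  shows "slash k f (mmul g h) z = slash k f h z"
  using assms slash_SL2Z[of f k g "mact h z"] Im_mact_pos[of z h]
  by (simp add: slash_mmul) (simp add: slash_def)

section \<open>Coset representatives for the matrices of determinant n\<close>

lemma finite_hecke_reps [simp]: "n > 0 \<Longrightarrow> finite (hecke_reps n)"
  unfolding hecke_reps_def by (intro finite_imageI finite_SigmaI) auto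

lemma inj_on_hecke_reps:
  "inj_on (\<lambda>(d, b). (int (n div d), int b, 0, int d)) (SIGMA d:{d. d dvd n}. {..<d})"
  by (auto simp: inj_on_def)

lemma hecke_reps_iff:
  assumes "n > 0"
  shows "(a, b, c, d) \<in> hecke_reps n \<longleftrightarrow> c = 0 \<and> a > 0 \<and> d > 0 \<and> a * d = int n \<and> 0 \<le> b \<and> b < d"
proof
  assume "(a, b, c, d) \<in> hecke_reps n"
  then obtain d' b' where *: "d' dvd n" "b' < d'" "a = int (n div d')" "b = int b'" "c = 0" "d = int d'"
    by (auto simp: hecke_reps_def)
  have "n div d' * d' = n" using * by simp
  then show "c = 0 \<and> a > 0 \<and> d > 0 \<and> a * d = int n \<and> 0 \<le> b \<and> b < d"
    using * assms by (auto simp flip: of_nat_mult intro: Nat.gr0I)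
next
  assume *: "c = 0 \<and> a > 0 \<and> d > 0 \<and> a * d = int n \<and> 0 \<le> b \<and> b < d"
  have "nat a * nat d = n" using * by (metis nat_int nat_mult_distrib less_imp_le)
  then have "nat d dvd n" "n div nat d = nat a" using * by auto
  then show "(a, b, c, d) \<in> hecke_reps n"
    unfolding hecke_reps_def using *
    by (intro image_eqI[where x = "(nat d, nat b)"]) auto
qed

lemma mdet_hecke_reps: "n > 0 \<Longrightarrow> g \<in> hecke_reps n \<Longrightarrow> mdet g = int n"
  by (cases g) (auto simp: hecke_reps_iff)

lemma hecke_eq_slash:
  "hecke k n f z = of_nat n ^ (k - 1) * (\<Sum>g\<in>hecke_reps n. slash k f g z)" if "n > 0"
proof -
  have "(\<Sum>g\<in>hecke_reps n. slash k f g z) =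
      (\<Sum>(d, b)\<in>(SIGMA d:{d. d dvd n}. {..<d}). slash k f (int (n div d), int b, 0, int d) z)"
    unfolding hecke_reps_def
    by (subst sum.reindex[OF inj_on_hecke_reps]) (simp add: case_prod_unfold)
  also have "\<dots> = (\<Sum>d | d dvd n. \<Sum>b<d. slash k f (int (n div d), int b, 0, int d) z)"
    using that by (subst sum.Sigma) auto
  finally show ?thesis by (simp add: hecke_def slash_def)
qed

text \<open>Hermite normal form under left multiplication: Bezout coefficients of the first column
  clear the lower left entry, and a translation then reduces the upper right entry modulo
  \<open>d0\<close>.\<close>

lemma hecke_rep_exists:
  assumes "n > 0" "mdet x = int n"
  obtains g h where "g \<in> SL2Z" "h \<in> hecke_reps n" "x = mmul g h"
proof -
  obtain a b c d where x: "x = (a, b, c, d)" by (cases x)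
  have det: "a * d - b * c = int n" using assms x by simp
  define e where "e = gcd a c"
  have e: "e > 0" using det assms(1) unfolding e_def by (auto intro!: gcd_pos_int[THEN iffD2])
  obtain a' c' where ac: "a = e * a'" "c = e * c'"
    unfolding e_def by (metis dvdE gcd_dvd1 gcd_dvd2)
  obtain s t where st: "s * a + t * c = e" unfolding e_def by (metis bezout_int)
  have st': "s * a' + t * c' = 1"
  proof -
    have "e * (s * a' + t * c') = e * 1" using st ac by (simp add: algebra_simps)
    then show ?thesis using e by (metis mult_left_cancel less_irrefl)
  qed
  define d0 where "d0 = a' * d - c' * b"
  define b0 where "b0 = s * b + t * d"
  have ed: "e * d0 = int n" using det ac by (simp add: d0_def algebra_simps)
  then have d0: "d0 > 0" using e assms(1) by (metis of_nat_0_less_iff zero_less_mult_pos)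
  have x_eq: "x = mmul (a', - t, c', s) (e, b0, 0, d0)"
  proof -
    have "a' * b0 - t * d0 = (s * a' + t * c') * b" "c' * b0 + s * d0 = (s * a' + t * c') * d"
      by (simp_all add: b0_def d0_def algebra_simps)
    then have "a' * b0 + - t * d0 = b" "c' * b0 + s * d0 = d" by (simp_all add: st')
    then show ?thesis using x ac by (simp add: mult.commute)
  qed
  define q where "q = b0 div d0"
  have "mmul (a', - t, c', s) (e, b0, 0, d0) =
      mmul (mmul (a', - t, c', s) (1, q, 0, 1)) (e, b0 mod d0, 0, d0)"
  proof -
    have "b0 = q * d0 + b0 mod d0" by (simp add: q_def)
    then have "(e, b0, 0, d0) = mmul (1, q, 0, 1) (e, b0 mod d0, 0, d0)" by simp
    then show ?thesis by (simp only: mmul_assoc)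
  qed
  moreover have "mmul (a', - t, c', s) (1, q, 0, 1) \<in> SL2Z"
    using st' by (simp add: SL2Z_def algebra_simps)
  moreover have "(e, b0 mod d0, 0, d0) \<in> hecke_reps n"
    using assms(1) e d0 ed by (simp add: hecke_reps_iff)
  ultimately show ?thesis using x_eq that by metis
qed

text \<open>The quotient \<open>u\<close> of the two unimodular factors is forced to be upper
  triangular with diagonal (1, 1), hence a translation by \<open>q\<close>; two residues in [0, d)
  that differ by \<open>q * d\<close> are equal.\<close>

lemma hecke_rep_unique:
  assumes "n > 0" "g \<in> SL2Z" "g' \<in> SL2Z" "h \<in> hecke_reps n" "h' \<in> hecke_reps n"
    and eq: "mmul g h = mmul g' h'"
  shows "g = g' \<and> h = h'"
proof -
  define u where "u = mmul (madj g') g"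
  have u: "mmul u h = h'"
  proof -
    have "mmul u h = mmul (madj g') (mmul g' h')" by (simp add: u_def mmul_assoc eq)
    also have "\<dots> = mmul (1, 0, 0, 1) h'"
      using assms(3) by (simp add: mmul_assoc[symmetric] madj_mmul_self SL2Z_def)
    finally show ?thesis by simp
  qed
  have g: "g = mmul g' u"
    using assms(3) by (simp add: u_def mmul_assoc[symmetric] mmul_madj_self SL2Z_def)
  have det: "mdet u = 1" using assms(2,3) by (simp add: u_def SL2Z_def)
  obtain p q r s where u': "u = (p, q, r, s)" by (cases u)
  obtain a b c d where h: "h = (a, b, c, d)" by (cases h)
  obtain a' b' c' d' where h': "h' = (a', b', c', d')" by (cases h')
  have H: "c = 0" "a > 0" "d > 0" "0 \<le> b" "b < d" using assms(1,4) h by (auto simp: hecke_reps_iff)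
  have H': "c' = 0" "a' > 0" "d' > 0" "0 \<le> b'" "b' < d'"
    using assms(1,5) h' by (auto simp: hecke_reps_iff)
  have eqs: "p * a = a'" "r * a = 0" "p * b + q * d = b'" "r * b + s * d = d'"
    using u u' h h' H H' by auto
  have r: "r = 0" using eqs H by simp
  have ps: "p * s = 1" using det u' r by simp
  have "p > 0" using eqs(1) H H' by (metis zero_less_mult_pos2)
  then have p: "p = 1" "s = 1" using ps by (auto simp: zmult_eq_1_iff)
  have d: "d = d'" using eqs r p by simp
  have "b + q * d = b'" using eqs p by simp
  then have "q * d < 1 * d" "(-1) * d < q * d" using H H' d by linarith+
  then have "q < 1" "-1 < q" using H(3) by (metis mult_less_cancel_right_pos)+
  then have "q = 0" by simp
  then have "u = (1, 0, 0, 1)" using u' p r by simp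
  then show ?thesis using u g by simp
qed

text \<open>Right multiplication by \<open>g\<close> permutes the left cosets of SL2Z. On
  representatives this permutation is \<open>\<sigma>\<close>, and the unimodular factors
  \<open>u\<close> are absorbed by the modularity of f.\<close>

lemma sum_hecke_reps_mmul:
  assumes f: "f \<in> cusp_forms k" and n: "n > 0" and g: "g \<in> SL2Z" and z: "Im z > 0"
  shows "(\<Sum>h\<in>hecke_reps n. slash k f (mmul h g) z) = (\<Sum>h\<in>hecke_reps n. slash k f h z)"
proof -
  have "\<exists>u h'. u \<in> SL2Z \<and> h' \<in> hecke_reps n \<and> mmul h g = mmul u h'" if "h \<in> hecke_reps n" for h
    using hecke_rep_exists[OF n, of "mmul h g"] mdet_hecke_reps[OF n that] g
    by (metis SL2Z_def mdet_mmul mem_Collect_eq mult.right_neutral)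
  then obtain u \<sigma> where us: "\<And>h. h \<in> hecke_reps n \<Longrightarrow> u h \<in> SL2Z"
      "\<And>h. h \<in> hecke_reps n \<Longrightarrow> \<sigma> h \<in> hecke_reps n"
      "\<And>h. h \<in> hecke_reps n \<Longrightarrow> mmul h g = mmul (u h) (\<sigma> h)"
    by metis
  have inj: "inj_on \<sigma> (hecke_reps n)"
  proof
    fix h h' assume h: "h \<in> hecke_reps n" "h' \<in> hecke_reps n" "\<sigma> h = \<sigma> h'"
    \<comment> \<open>The right-hand side depends on x only through \<open>\<sigma> x\<close>, so
      equal values of \<open>\<sigma>\<close> give two factorizations of one matrix.\<close>
    have *: "mmul (madj (u x)) x = mmul (\<sigma> x) (madj g)" if "x \<in> hecke_reps n" for x
    proof -
      have "mmul (madj (u x)) x = mmul (madj (u x)) (mmul (mmul x g) (madj g))"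
        using g by (simp add: mmul_assoc mmul_madj_self SL2Z_def)
      also have "\<dots> = mmul (\<sigma> x) (madj g)"
        using us(1)[OF that] us(3)[OF that] mmul_assoc[of "madj (u x)" "u x" "mmul (\<sigma> x) (madj g)"]
        by (simp add: mmul_assoc madj_mmul_self SL2Z_def)
      finally show ?thesis .
    qed
    have "mmul (madj (u h)) h = mmul (madj (u h')) h'" using *[OF h(1)] *[OF h(2)] h(3) by simp
    then show "h = h'"
      using hecke_rep_unique[OF n SL2Z_madj SL2Z_madj h(1,2)] us(1) h(1,2) by blast
  qed
  then have bij: "bij_betw \<sigma> (hecke_reps n) (hecke_reps n)"
    unfolding bij_betw_def using us(2) n by (intro conjI endo_inj_surj finite_hecke_reps image_subsetI)
  have "(\<Sum>h\<in>hecke_reps n. slash k f (mmul h g) z) = (\<Sum>h\<in>hecke_reps n. slash k f (\<sigma> h) z)"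
    using us mdet_hecke_reps[OF n] n
    by (intro sum.cong refl) (simp add: slash_SL2Z_mmul[OF f _ z])
  also have "\<dots> = (\<Sum>h\<in>hecke_reps n. slash k f h z)"
    using bij by (rule sum.reindex_bij_betw)
  finally show ?thesis .
qed

lemma hecke_mact:
  assumes f: "f \<in> cusp_forms k" and n: "n > 0" and g: "g \<in> SL2Z" and z: "Im z > 0"
  shows "hecke k n f (mact g z) = mj g z ^ k * hecke k n f z"
proof -
  have *: "slash k f h (mact g z) = mj g z ^ k * slash k f (mmul h g) z" for h
    using slash_mmul[OF z, of g k f h] mj_nonzero[OF z, of g] g by (simp add: SL2Z_def)
  show ?thesis
    by (simp add: hecke_eq_slash[OF n] * sum_hecke_reps_mmul[OF f n g z] flip: sum_distrib_left)
qed

section \<open>Reduction of the upper half-plane modulo SL2(Z)\<close>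

lemma finite_lattice_ball:
  assumes "Im z > 0"
  shows "finite {(c :: int, d :: int). cmod (of_int c * z + of_int d) \<le> R}" (is "finite ?A")
proof -
  define C where "C = \<lceil>R / Im z\<rceil>"
  define D where "D = \<lceil>R + of_int C * \<bar>Re z\<bar>\<rceil>"
  have "?A \<subseteq> {-C..C} \<times> {-D..D}"
  proof
    fix p assume p: "p \<in> ?A"
    obtain c d where cd: "p = (c, d)" by (cases p)
    have 1: "cmod (of_int c * z + of_int d) \<le> R" using p cd by simp
    have "\<bar>of_int c\<bar> * Im z \<le> R"
      using abs_Im_le_cmod[of "of_int c * z + of_int d"] 1 assms by (simp add: abs_mult)
    then have "\<bar>of_int c\<bar> \<le> R / Im z" using assms by (simp add: field_simps)
    then have c: "\<bar>c\<bar> \<le> C" unfolding C_def by linarith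
    have "\<bar>of_int c * Re z + of_int d\<bar> \<le> R"
      using abs_Re_le_cmod[of "of_int c * z + of_int d"] 1 by simp
    then have "\<bar>of_int d\<bar> \<le> R + \<bar>of_int c\<bar> * \<bar>Re z\<bar>" unfolding abs_mult[symmetric] by linarith
    also have "\<dots> \<le> R + of_int C * \<bar>Re z\<bar>"
      using c by (intro add_left_mono mult_right_mono) (auto simp flip: of_int_abs)
    finally have "\<bar>d\<bar> \<le> D" unfolding D_def by linarith
    with c show "p \<in> {-C..C} \<times> {-D..D}" using cd by auto
  qed
  then show ?thesis by (rule finite_subset) auto
qed

lemma lattice_min_exists:
  assumes "Im z > 0"
  obtains c d :: int where "(c, d) \<noteq> (0, 0)"
    "\<And>c' d' :: int. (c', d') \<noteq> (0, 0) \<Longrightarrow>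
       cmod (of_int c * z + of_int d) \<le> cmod (of_int c' * z + of_int d')"
proof -
  define N :: "int \<times> int \<Rightarrow> real" where "N = (\<lambda>(c, d). cmod (of_int c * z + of_int d))"
  define A where "A = {p. p \<noteq> (0, 0) \<and> N p \<le> 1}"
  have fin: "finite A"
    by (rule finite_subset[OF _ finite_lattice_ball[OF assms, of 1]]) (auto simp: A_def N_def)
  have ne: "(0, 1) \<in> A" by (simp add: A_def N_def)
  obtain p where p: "p \<in> A" "\<And>q. q \<in> A \<Longrightarrow> N p \<le> N q"
    using arg_min_if_finite(1)[OF fin, of N] arg_min_least[OF fin, of _ N] ne by blast
  have "N p \<le> N q" if "q \<noteq> (0, 0)" for q
    using p that unfolding A_def by (cases "N q \<le> 1") auto
  note Np = this
  obtain c d where cd: "p = (c, d)" by (cases p)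
  show ?thesis
  proof (rule that)
    show "(c, d) \<noteq> (0, 0)" using p(1) cd by (simp add: A_def)
    show "cmod (of_int c * z + of_int d) \<le> cmod (of_int c' * z + of_int d')"
      if "(c', d') \<noteq> (0, 0)" for c' d' :: int
      using Np[OF that] by (simp add: N_def cd)
  qed
qed

lemma mact_translate: "mact (mmul (1, q, 0, 1) g) z = mact g z + of_int q"
  if "Im z > 0" "mdet g \<noteq> 0"
  using that by (simp add: mact_mmul)

text \<open>A bottom row that minimizes |c z + d| maximizes the height, and a translation then
  adjusts the real part. The top row is a competitor in the minimization, so the image point has
  modulus at least 1 and its height satisfies y^2 >= 3/4, which is rounded down to y >= 1/2.\<close>

lemma SL2Z_reduction:
  assumes z: "Im z > 0"
  obtains g where "g \<in> SL2Z" "\<bar>Re (mact g z)\<bar> \<le> 1/2" "Im (mact g z) \<ge> 1/2"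
proof -
  obtain c d :: int where cd: "(c, d) \<noteq> (0, 0)"
    and min: "\<And>c' d' :: int. (c', d') \<noteq> (0, 0) \<Longrightarrow>
       cmod (of_int c * z + of_int d) \<le> cmod (of_int c' * z + of_int d')"
    using lattice_min_exists[OF z] by metis
  \<comment> \<open>A coprime row is wanted, since Bezout completes it to a unimodular matrix;
    division by the gcd can only shorten the vector.\<close>
  define e where "e = gcd c d"
  have e: "e > 0" using cd by (auto simp: e_def)
  obtain c1 d1 where cd1: "c = e * c1" "d = e * d1"
    unfolding e_def by (metis dvdE gcd_dvd1 gcd_dvd2)
  have ne1: "(c1, d1) \<noteq> (0, 0)" using cd cd1 by auto
  have min1: "cmod (of_int c1 * z + of_int d1) \<le> cmod (of_int c' * z + of_int d')"
    if "(c', d') \<noteq> (0, 0)" for c' d' :: int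
  proof -
    have "cmod (of_int c * z + of_int d) = of_int e * cmod (of_int c1 * z + of_int d1)"
      using e cd1 by (simp add: norm_mult mult.assoc flip: distrib_left)
    moreover have "1 * cmod (of_int c1 * z + of_int d1) \<le> of_int e * cmod (of_int c1 * z + of_int d1)"
      using e by (intro mult_right_mono) auto
    ultimately show ?thesis using min[OF that] by linarith
  qed
  obtain s t where "s * c + t * d = e" unfolding e_def by (metis bezout_int)
  then have "e * (s * c1 + t * d1) = e * 1" using cd1 by (simp add: algebra_simps)
  then have st: "s * c1 + t * d1 = 1" using e by (metis mult_left_cancel less_irrefl)
  define g0 :: imat where "g0 = (t, - s, c1, d1)"
  have g0: "g0 \<in> SL2Z" using st by (simp add: g0_def SL2Z_def algebra_simps)
  define q where "q = - round (Re (mact g0 z))"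
  define g where "g = mmul (1, q, 0, 1) g0"
  have g: "g \<in> SL2Z" using g0 by (simp add: g_def SL2Z_def)
  have mact_g: "mact g z = mact g0 z + of_int q"
    unfolding g_def using g0 z by (intro mact_translate) (auto simp: SL2Z_def)
  have Re: "\<bar>Re (mact g z)\<bar> \<le> 1/2"
    unfolding mact_g q_def using of_int_round_abs_le[of "Re (mact g0 z)"] by (simp add: abs_minus_commute)
  have mjg: "mj g z = of_int c1 * z + of_int d1" by (simp add: g_def g0_def)
  have mj0: "mj g z \<noteq> 0" using g z by (intro mj_nonzero) (auto simp: SL2Z_def)
  obtain a b c' d' where gs: "g = (a, b, c', d')" by (cases g)
  have "(a, b) \<noteq> (0, 0)" using g gs by (auto simp: SL2Z_def)
  then have "cmod (mj g z) \<le> cmod (of_int a * z + of_int b)"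
    unfolding mjg by (rule min1)
  then have "1 \<le> cmod (mact g z)" using gs mj0 by (simp add: norm_divide field_simps)
  then have "1 \<le> (Re (mact g z))\<^sup>2 + (Im (mact g z))\<^sup>2"
    unfolding cmod_power2[symmetric] by (simp add: one_le_power)
  moreover have "(Re (mact g z))\<^sup>2 \<le> (1/2)\<^sup>2"
    using Re by (metis abs_ge_zero power2_abs power_mono)
  ultimately have "(1/2)\<^sup>2 \<le> (Im (mact g z))\<^sup>2" by (simp add: power2_eq_square)
  moreover have "Im (mact g z) > 0" using g z by (intro Im_mact_pos) (auto simp: SL2Z_def)
  ultimately have "Im (mact g z) \<ge> 1/2" by (meson less_imp_le power2_le_imp_le)
  with Re g that show ?thesis by blast
qed

section \<open>Growth and Fourier coefficients of cusp forms\<close>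

lemma norm_exp_2pi: "cmod (exp (2 * of_real pi * \<i> * z)) = exp (- 2 * pi * Im z)"
  by simp

lemma exp_2pi_surj:
  assumes "q \<noteq> 0" "cmod q < 1"
  obtains z where "Im z > 0" "exp (2 * of_real pi * \<i> * z) = q" "Im z = - ln (cmod q) / (2 * pi)"
proof
  let ?z = "Ln q / (2 * of_real pi * \<i>)"
  show "exp (2 * of_real pi * \<i> * ?z) = q" using assms by simp
  show Im: "Im ?z = - ln (cmod q) / (2 * pi)"
    using assms by (simp add: Im_divide power2_eq_square field_simps)
  show "Im ?z > 0" using assms unfolding Im by (simp add: divide_neg_pos)
qed

text \<open>The origin is excluded because q = exp (2 pi i z) never vanishes. Once the earlier
  coefficients of the difference are known to be 0, the next one is the limit at 0 of the series
  divided by a power of q.\<close>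

lemma powser_unique_punctured:
  fixes a b :: "nat \<Rightarrow> complex"
  assumes a: "\<And>q. q \<noteq> 0 \<Longrightarrow> norm q < 1 \<Longrightarrow> (\<lambda>n. a n * q ^ n) sums F q"
    and b: "\<And>q. q \<noteq> 0 \<Longrightarrow> norm q < 1 \<Longrightarrow> (\<lambda>n. b n * q ^ n) sums F q"
  shows "a = b"
proof
  fix n
  define c where "c n = a n - b n" for n
  have c: "(\<lambda>n. c n * q ^ n) sums 0" if "q \<noteq> 0" "norm q < 1" for q
    using sums_diff[OF a[OF that] b[OF that]] by (simp add: c_def algebra_simps)
  have "c n = 0"
  proof (induction n rule: less_induct)
    case (less n)
    have "(\<lambda>i. c (i + n) * q ^ i) sums 0" if "q \<noteq> 0" "norm q < 1" for q
    proof -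
      have "(\<lambda>i. c (i + n) * q ^ (i + n)) sums (0 - (\<Sum>i<n. c i * q ^ i))"
        using sums_split_initial_segment[OF c[OF that], of n] by simp
      then have "(\<lambda>i. c (i + n) * q ^ (i + n)) sums 0" using less by simp
      from sums_divide[OF this, of "q ^ n"] show ?thesis using that by (simp add: power_add)
    qed
    then have "((\<lambda>_. 0) \<longlongrightarrow> c (0 + n)) (at (0::complex))"
      by (intro powser_limit_0_strong[where s = 1]) auto
    then show ?case by (metis add_0 LIM_const_eq at_neq_bot tendsto_unique tendsto_const)
  qed
  then show "a n = b n" by (simp add: c_def)
qed

lemma q_expansion_unique:
  assumes "has_q_expansion f a" "has_q_expansion f b"
  shows "a = b"
proof (rule powser_unique_punctured[where F = "\<lambda>q. \<Sum>n. a n * q ^ n"])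
  fix q :: complex assume q: "q \<noteq> 0" "norm q < 1"
  obtain z where z: "Im z > 0" "exp (2 * of_real pi * \<i> * z) = q"
    using exp_2pi_surj[OF q] by metis
  have 1: "(\<lambda>n. a n * q ^ n) sums f z" "(\<lambda>n. b n * q ^ n) sums f z"
    using assms z by (auto simp: has_q_expansion_def)
  then show "(\<lambda>n. a n * q ^ n) sums (\<Sum>n. a n * q ^ n)" "(\<lambda>n. b n * q ^ n) sums (\<Sum>n. a n * q ^ n)"
    by (simp_all add: sums_iff)
qed

lemma q_expansion_eq_imp_eq:
  assumes "has_q_expansion f a" "has_q_expansion g a" "f \<in> cusp_forms k" "g \<in> cusp_forms k"
  shows "f = g"
proof
  fix z show "f z = g z"
  proof (cases "Im z > 0")
    case True
    then show ?thesis using assms(1,2) sums_unique2 unfolding has_q_expansion_def by blast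
  qed (use assms(3,4) in \<open>auto simp: cusp_forms_def\<close>)
qed

lemma q_expansion_summable:
  assumes "has_q_expansion f a" "0 \<le> r" "r < 1"
  shows "summable (\<lambda>n. norm (a n) * r ^ n)"
proof -
  define s where "s = complex_of_real ((r + 1) / 2)"
  have "norm s = (r + 1) / 2" using assms unfolding s_def norm_of_real by simp
  then have s: "s \<noteq> 0" "norm s < 1" "r < norm s" using assms by auto
  obtain z where z: "Im z > 0" "exp (2 * of_real pi * \<i> * z) = s" using exp_2pi_surj[OF s(1,2)] by metis
  have "summable (\<lambda>n. a n * s ^ n)"
    using assms(1) z by (auto simp: has_q_expansion_def sums_iff)
  then have "summable (\<lambda>n. norm (a n * of_real r ^ n))"
    by (rule powser_insidea) (use assms s in auto)
  then show ?thesis using assms by (simp add: norm_mult norm_power)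
qed

definition qcoeff :: "(complex \<Rightarrow> complex) \<Rightarrow> nat \<Rightarrow> complex" where
  "qcoeff f = (SOME a. has_q_expansion f a)"

lemma qcoeff_eq: "has_q_expansion f a \<Longrightarrow> qcoeff f = a"
  unfolding qcoeff_def by (metis q_expansion_unique someI_ex)

lemma cusp_form_q_expansion:
  assumes "f \<in> cusp_forms k"
  shows "has_q_expansion f (qcoeff f)" "qcoeff f 0 = 0"
proof -
  obtain a where a: "has_q_expansion f a" "a 0 = 0" using assms by (auto simp: cusp_forms_def)
  then show "has_q_expansion f (qcoeff f)" "qcoeff f 0 = 0" by (simp_all add: qcoeff_eq)
qed

lemma qcoeff_add:
  assumes "f \<in> cusp_forms k" "g \<in> cusp_forms k"
  shows "qcoeff (f + g) n = qcoeff f n + qcoeff g n"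
proof -
  have "has_q_expansion (f + g) (\<lambda>n. qcoeff f n + qcoeff g n)"
    using assms[THEN cusp_form_q_expansion(1)]
    by (auto simp: has_q_expansion_def distrib_right intro!: sums_add)
  then show ?thesis by (simp add: qcoeff_eq)
qed

lemma qcoeff_fscale:
  assumes "f \<in> cusp_forms k"
  shows "qcoeff (fscale c f) n = c * qcoeff f n"
proof -
  have "has_q_expansion (fscale c f) (\<lambda>n. c * qcoeff f n)"
    using assms[THEN cusp_form_q_expansion(1)]
    by (auto simp: has_q_expansion_def fscale_def mult.assoc intro!: sums_mult)
  then show ?thesis by (simp add: qcoeff_eq)
qed

lemma cusp_form_eqI:
  assumes "f \<in> cusp_forms k" "g \<in> cusp_forms k" "\<And>n. qcoeff f n = qcoeff g n"
  shows "f = g"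
proof -
  have "qcoeff f = qcoeff g" using assms(3) by auto
  then show ?thesis
    using q_expansion_eq_imp_eq[of f "qcoeff f" g k] assms cusp_form_q_expansion by metis
qed

text \<open>Since the constant term vanishes, a factor q can be taken out; the remaining series is
  dominated on the half-plane by its absolute values at the radius belonging to height
  \<open>\<eta>\<close>.\<close>

lemma cusp_form_decay:
  assumes f: "f \<in> cusp_forms k" and "\<eta> > 0"
  obtains C where "C \<ge> 0" "\<And>z. Im z \<ge> \<eta> \<Longrightarrow> cmod (f z) \<le> C * exp (- 2 * pi * Im z)"
proof -
  define a where "a = qcoeff f"
  define r where "r = exp (- 2 * pi * \<eta>)"
  have r: "0 < r" "r < 1" using assms by (auto simp: r_def)
  have qe: "has_q_expansion f a" and a0: "a 0 = 0" using cusp_form_q_expansion[OF f] by (auto simp: a_def)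
  have "summable (\<lambda>n. norm (a (Suc n)) * r ^ Suc n / r)"
    using q_expansion_summable[OF qe, of r] r
    by (intro summable_divide iffD2[OF summable_Suc_iff[of "\<lambda>n. norm (a n) * r ^ n"]]) auto
  then have sm: "summable (\<lambda>n. norm (a (Suc n)) * r ^ n)" using r by simp
  define C where "C = (\<Sum>n. norm (a (Suc n)) * r ^ n)"
  have "C \<ge> 0" unfolding C_def using r by (intro suminf_nonneg sm) auto
  moreover have "cmod (f z) \<le> C * exp (- 2 * pi * Im z)" if z: "Im z \<ge> \<eta>" for z
  proof -
    define q where "q = exp (2 * of_real pi * \<i> * z)"
    have nq: "norm q = exp (- 2 * pi * Im z)" by (simp add: q_def)
    have qr: "norm q \<le> r" unfolding nq r_def using z by simp
    have "(\<lambda>n. a n * q ^ n) sums f z" using qe z assms(2) by (auto simp: has_q_expansion_def q_def)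
    then have s1: "(\<lambda>n. a (Suc n) * q ^ Suc n) sums f z"
      using sums_Suc_iff[of "\<lambda>n. a n * q ^ n" "f z"] a0 by simp
    have le: "norm (a (Suc n) * q ^ Suc n) \<le> norm q * (norm (a (Suc n)) * r ^ n)" for n
    proof -
      have "norm (a (Suc n) * q ^ Suc n) = norm q * (norm (a (Suc n)) * norm q ^ n)"
        by (simp add: norm_mult norm_power)
      also have "\<dots> \<le> norm q * (norm (a (Suc n)) * r ^ n)"
        using qr by (intro mult_left_mono power_mono) auto
      finally show ?thesis .
    qed
    have "norm (f z) \<le> (\<Sum>n. norm q * (norm (a (Suc n)) * r ^ n))"
      unfolding sums_unique[OF s1] using le by (intro norm_suminf_le summable_mult sm) auto
    also have "\<dots> = norm q * C" unfolding C_def using sm by (rule suminf_mult)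
    finally show ?thesis by (simp add: nq mult.commute)
  qed
  ultimately show ?thesis using that by blast
qed

lemma power_le_fact_exp:
  fixes x :: real
  assumes "x \<ge> 0"
  shows "x ^ n \<le> fact n * exp x"
proof -
  have "x ^ n / fact n = (\<Sum>i\<in>{n}. x ^ i /\<^sub>R fact i)" by (simp add: field_simps)
  also have "\<dots> \<le> (\<Sum>i. x ^ i /\<^sub>R fact i)"
    using assms by (intro sum_le_suminf summable_exp_generic) auto
  also have "\<dots> = exp x" by (simp add: exp_def)
  finally show ?thesis by (simp add: field_simps)
qed

lemma cusp_form_height_mact:
  assumes f: "f \<in> cusp_forms (2 * h)" and g: "g \<in> SL2Z" and z: "Im z > 0"
  shows "cmod (f (mact g z)) * Im (mact g z) ^ h = cmod (f z) * Im z ^ h"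
proof -
  have "mj g z \<noteq> 0" using g z by (intro mj_nonzero) (auto simp: SL2Z_def)
  then have "Im (mact g z) * (cmod (mj g z))\<^sup>2 = Im z"
    using Im_mact[OF z, of g] g by (simp add: SL2Z_def)
  then have "(Im (mact g z) * (cmod (mj g z))\<^sup>2) ^ h = Im z ^ h" by simp
  then show ?thesis
    using cusp_forms_mact[OF f g z] by (simp add: norm_mult norm_power power_mult power_mult_distrib power2_eq_square mult_ac)
qed

text \<open>The function |f| y^h is invariant under SL2Z, so it suffices to bound it at heights >=
  1/2, where exponential decay beats y^h.\<close>

lemma cusp_form_height_bounded:
  assumes f: "f \<in> cusp_forms (2 * h)"
  obtains M where "M \<ge> 0" "\<And>z. Im z > 0 \<Longrightarrow> cmod (f z) * Im z ^ h \<le> M"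
proof -
  obtain C where C: "C \<ge> 0" "\<And>z. Im z \<ge> 1/2 \<Longrightarrow> cmod (f z) \<le> C * exp (- 2 * pi * Im z)"
    using cusp_form_decay[OF f, of "1/2"] by auto
  have "cmod (f z) * Im z ^ h \<le> C * fact h" if z: "Im z > 0" for z
  proof -
    obtain g where g: "g \<in> SL2Z" "Im (mact g z) \<ge> 1/2" using SL2Z_reduction[OF z] by metis
    let ?y = "Im (mact g z)"
    have "cmod (f z) * Im z ^ h = cmod (f (mact g z)) * ?y ^ h"
      using cusp_form_height_mact[OF f g(1) z] by simp
    also have "\<dots> \<le> (C * exp (- 2 * pi * ?y)) * (fact h * exp ?y)"
      using g C by (intro mult_mono power_le_fact_exp) auto
    also have "\<dots> = C * fact h * exp ((1 - 2 * pi) * ?y)"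
      by (simp add: algebra_simps flip: exp_add)
    also have "\<dots> \<le> C * fact h * 1"
      using g C(1) pi_gt3 by (intro mult_left_mono) (auto simp: mult_le_0_iff)
    finally show ?thesis by simp
  qed
  moreover have "C * fact h \<ge> 0" using C(1) by simp
  ultimately show ?thesis using that by blast
qed

text \<open>Hecke's estimate by Cauchy's inequality on the circle |q| = exp (-2 pi y). The height y
  stays free, because \<open>cusp_form_eq_0_of_coeffs\<close> uses half the height of the point
  under consideration.\<close>

lemma qcoeff_bound:
  assumes f: "f \<in> cusp_forms (2 * h)"
    and M: "\<And>z. Im z > 0 \<Longrightarrow> cmod (f z) * Im z ^ h \<le> M" and y: "y > 0"
  shows "cmod (qcoeff f n) \<le> M / y ^ h * exp (2 * pi * y) ^ n"
proof -
  define a where "a = qcoeff f"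
  define F where "F q = (\<Sum>n. a n * q ^ n)" for q
  have qe: "has_q_expansion f a" using cusp_form_q_expansion[OF f] by (auto simp: a_def)
  have F: "(\<lambda>n. a n * q ^ n) sums F q" if "norm q < 1" for q
  proof -
    have "summable (\<lambda>n. norm (a n * q ^ n))"
      using q_expansion_summable[OF qe, of "norm q"] that by (simp add: norm_mult norm_power)
    then show ?thesis unfolding F_def by (rule summable_sums[OF summable_norm_cancel])
  qed
  then have hol: "F holomorphic_on ball 0 1"
    by (intro power_series_holomorphic[where a = a]) auto
  have "(\<lambda>n. (deriv ^^ n) F 0 / fact n) = a"
  proof (rule powser_unique_punctured)
    fix q :: complex assume q: "q \<noteq> 0" "norm q < 1"
    show "(\<lambda>n. (deriv ^^ n) F 0 / fact n * q ^ n) sums F q"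
      using holomorphic_power_series[OF hol, of q] q by simp
    show "(\<lambda>n. a n * q ^ n) sums F q" using F q by simp
  qed
  then have deriv_eq: "a n = (deriv ^^ n) F 0 / fact n" by (rule fun_cong[symmetric])
  define r where "r = exp (- 2 * pi * y)"
  have r: "0 < r" "r < 1" using y by (auto simp: r_def)
  have "norm ((deriv ^^ n) F 0) \<le> fact n * (M / y ^ h) / r ^ n"
  proof (rule Cauchy_inequality)
    show "F holomorphic_on ball 0 r" "continuous_on (cball 0 r) F"
      using hol r by (auto intro: holomorphic_on_subset holomorphic_on_imp_continuous_on
          continuous_on_subset[of "ball 0 1"])
    fix x :: complex assume "norm (0 - x) = r"
    then have x: "norm x = r" by simp
    then have x': "x \<noteq> 0" "norm x < 1" using r by auto
    obtain z where z: "Im z > 0" "exp (2 * of_real pi * \<i> * z) = x" "Im z = - ln (cmod x) / (2 * pi)"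
      using exp_2pi_surj[OF x'] by metis
    have "Im z = y" using z(3) x by (simp add: r_def)
    moreover have "F x = f z"
      using F[OF x'(2)] qe z unfolding has_q_expansion_def by (metis sums_unique2)
    ultimately show "norm (F x) \<le> M / y ^ h" using M[of z] y by (simp add: field_simps)
  qed (use r in auto)
  then have "cmod (a n) \<le> M / y ^ h / r ^ n" by (simp add: deriv_eq norm_divide field_simps)
  also have "\<dots> = M / y ^ h * exp (2 * pi * y) ^ n"
    by (simp add: r_def exp_minus field_simps)
  finally show ?thesis by (simp add: a_def)
qed

text \<open>A quantitative maximum principle replaces the valence formula: near the maximum of
  \<open>\<bar>f\<bar> y\<^sup>h\<close> the tail of the Fourier expansion is too small.\<close>

lemma cusp_form_eq_0_of_coeffs:
  assumes f: "f \<in> cusp_forms (2 * h)" and 0: "\<And>n. n \<le> h + 1 \<Longrightarrow> qcoeff f n = 0"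
  shows "f = 0"
proof (rule ccontr)
  assume "f \<noteq> 0"
  define S where "S = {cmod (f z) * Im z ^ h | z. Im z > 0}"
  obtain M0 where M0: "\<And>z. Im z > 0 \<Longrightarrow> cmod (f z) * Im z ^ h \<le> M0"
    using cusp_form_height_bounded[OF f] by metis
  have bdd: "bdd_above S" unfolding S_def by (rule bdd_aboveI[of _ M0]) (use M0 in auto)
  define M where "M = Sup S"
  have M: "cmod (f z) * Im z ^ h \<le> M" if "Im z > 0" for z
    unfolding M_def by (rule cSup_upper[OF _ bdd]) (use that in \<open>auto simp: S_def\<close>)
  obtain w where w: "f w \<noteq> 0" using \<open>f \<noteq> 0\<close> by (auto simp: fun_eq_iff)
  then have "Im w > 0" using f by (auto simp: cusp_forms_def)
  then have "M > 0" using M[of w] w by (smt (verit) zero_less_mult_iff zero_less_norm_iff zero_less_power)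
  have "S \<noteq> {}" using \<open>Im w > 0\<close> by (auto simp: S_def)
  then obtain s where "s \<in> S" "M / 2 < s"
    using less_cSup_iff[of S "M / 2"] bdd \<open>M > 0\<close> unfolding M_def by auto
  then obtain z1 where z1: "Im z1 > 0" "M / 2 < cmod (f z1) * Im z1 ^ h" by (auto simp: S_def)
  obtain g where g: "g \<in> SL2Z" "Im (mact g z1) \<ge> 1/2" using SL2Z_reduction[OF z1(1)] by metis
  define z where "z = mact g z1"
  define y where "y = Im z"
  have y: "y \<ge> 1/2" using g by (simp add: y_def z_def)
  have big: "M / 2 < cmod (f z) * y ^ h"
    using cusp_form_height_mact[OF f g(1) z1(1)] z1 by (simp add: z_def y_def)
  define q where "q = exp (2 * of_real pi * \<i> * z)"
  have nq: "norm q = exp (- 2 * pi * y)" by (simp add: q_def y_def)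
  define m where "m = h + 2"
  have "(\<lambda>n. qcoeff f n * q ^ n) sums f z"
    using cusp_form_q_expansion[OF f] y by (auto simp: has_q_expansion_def q_def y_def)
  then have "(\<lambda>n. qcoeff f (n + m) * q ^ (n + m)) sums (f z - (\<Sum>i<m. qcoeff f i * q ^ i))"
    by (rule sums_split_initial_segment)
  moreover have "(\<Sum>i<m. qcoeff f i * q ^ i) = 0"
    by (rule sum.neutral) (use 0 in \<open>auto simp: m_def\<close>)
  ultimately have fz: "(\<lambda>n. qcoeff f (n + m) * q ^ (n + m)) sums f z" by simp
  \<comment> \<open>Bounding the coefficients at height y/2 leaves exp (- pi y n) <= 2^-n in the
    n-th term of the series at height y. The tail from m = h + 2 on sums to K * 2^(1-m), and the
    factor 2^h hidden in K cancels, so exactly half of M is left.\<close>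
  define K where "K = M / (y / 2) ^ h"
  have K: "K \<ge> 0" using \<open>M > 0\<close> y by (simp add: K_def)
  have e: "exp (- pi * y) \<le> 1 / 2"
  proof -
    have "1 \<le> pi * y" using y pi_gt3 mult_mono[of 2 pi "1/2" y] by simp
    then have "exp (1::real) \<le> exp (pi * y)" by simp
    moreover have "(2::real) \<le> exp 1" using exp_ge_add_one_self[of 1] by simp
    ultimately have "2 \<le> exp (pi * y)" by linarith
    then show ?thesis by (simp add: exp_minus field_simps)
  qed
  have le: "norm (qcoeff f (n + m) * q ^ (n + m)) \<le> K * (1/2) ^ m * (1 / 2) ^ n" for n
  proof -
    have "norm (qcoeff f (n + m) * q ^ (n + m)) =
        cmod (qcoeff f (n + m)) * exp (- 2 * pi * y) ^ (n + m)"
      by (simp add: norm_mult norm_power nq)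
    also have "\<dots> \<le> (K * exp (2 * pi * (y / 2)) ^ (n + m)) * exp (- 2 * pi * y) ^ (n + m)"
      unfolding K_def using y M by (intro mult_right_mono qcoeff_bound[OF f]) auto
    also have "\<dots> = K * (exp (2 * pi * (y / 2)) * exp (- 2 * pi * y)) ^ (n + m)"
      by (simp only: power_mult_distrib mult.assoc)
    also have "exp (2 * pi * (y / 2)) * exp (- 2 * pi * y) = exp (- pi * y)"
      by (simp add: algebra_simps flip: exp_add)
    also have "K * exp (- pi * y) ^ (n + m) \<le> K * (1 / 2) ^ (n + m)"
      using e K by (intro mult_left_mono power_mono) auto
    finally show ?thesis by (simp add: power_add mult_ac)
  qed
  have "norm (f z) \<le> (\<Sum>n. K * (1/2) ^ m * (1 / 2) ^ n)"
    unfolding sums_unique[OF fz] using le by (intro norm_suminf_le summable_mult summable_geometric) auto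
  also have "\<dots> = K * (1/2) ^ m * 2"
    by (subst suminf_mult) (auto simp: suminf_geometric summable_geometric)
  also have "\<dots> = M / 2 / y ^ h"
    using y by (simp add: K_def m_def power_divide field_simps)
  finally have "cmod (f z) * y ^ h \<le> M / 2" using y by (simp add: field_simps)
  with big show False by simp
qed

section \<open>Finite dimension of the spaces of cusp forms\<close>

text \<open>Induction on the number m of functionals: the kernel of the last one is separated by the
  others, and a single vector outside the kernel completes a spanning set.\<close>

lemma finite_span_of_functionals:
  fixes \<phi> :: "nat \<Rightarrow> (complex \<Rightarrow> complex) \<Rightarrow> complex"
  assumes "cfun.subspace V"
    and "\<And>n u v. u \<in> V \<Longrightarrow> v \<in> V \<Longrightarrow> \<phi> n (u + v) = \<phi> n u + \<phi> n v"
    and "\<And>n c v. v \<in> V \<Longrightarrow> \<phi> n (fscale c v) = c * \<phi> n v"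
    and "\<And>v. v \<in> V \<Longrightarrow> (\<And>n. n < m \<Longrightarrow> \<phi> n v = 0) \<Longrightarrow> v = 0"
  shows "\<exists>B. finite B \<and> V \<subseteq> cfun.span B"
  using assms
proof (induction m arbitrary: V)
  case 0
  then have "V \<subseteq> {0}" by blast
  then have "V \<subseteq> cfun.span {}" by simp
  then show ?case by blast
next
  case (Suc m)
  note sub = Suc.prems(1) and add = Suc.prems(2) and scale = Suc.prems(3)
  define V' where "V' = {v \<in> V. \<phi> m v = 0}"
  have sub': "cfun.subspace V'"
  proof (rule cfun.subspaceI)
    have "0 \<in> V" using sub by (rule cfun.subspace_0)
    moreover have "fscale 0 0 = 0" by (simp add: fscale_def fun_eq_iff)
    ultimately show "0 \<in> V'" using scale[of 0 m 0] by (simp add: V'_def fscale_def zero_fun_def)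
  qed (auto simp: V'_def add scale cfun.subspace_add[OF sub] cfun.subspace_scale[OF sub])
  have V'V: "v \<in> V" if "v \<in> V'" for v using that by (simp add: V'_def)
  have "\<exists>B. finite B \<and> V' \<subseteq> cfun.span B"
  proof (rule Suc.IH[OF sub'])
    fix v assume v: "v \<in> V'" "\<And>n. n < m \<Longrightarrow> \<phi> n v = 0"
    show "v = 0"
    proof (rule Suc.prems(4))
      show "v \<in> V" using v by (simp add: V'_def)
      show "\<phi> n v = 0" if "n < Suc m" for n
        using that v by (cases "n = m") (auto simp: V'_def)
    qed
  qed (blast intro: add scale V'V)+
  then obtain B where B: "finite B" "V' \<subseteq> cfun.span B" by blast
  show ?case
  proof (cases "V' = V")
    case False
    then obtain v where v: "v \<in> V" "\<phi> m v \<noteq> 0" by (auto simp: V'_def)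
    have "V \<subseteq> cfun.span (insert v B)"
    proof
      fix u assume u: "u \<in> V"
      define c where "c = \<phi> m u / \<phi> m v"
      have cv: "fscale (- c) v \<in> V" using cfun.subspace_scale[OF sub v(1)] .
      have "\<phi> m (u + fscale (- c) v) = \<phi> m u + (- c) * \<phi> m v"
        using add[OF u cv, of m] scale[OF v(1), of m "- c"] by metis
      also have "\<dots> = 0" using v by (simp add: c_def)
      finally have w: "u + fscale (- c) v \<in> V'"
        using cfun.subspace_add[OF sub u cv] unfolding V'_def by blast
      have "(u + fscale (- c) v) + fscale c v = u" by (simp add: fscale_def fun_eq_iff)
      moreover have "u + fscale (- c) v \<in> cfun.span (insert v B)"
        using w B(2) cfun.span_mono[of B "insert v B"] by blast
      ultimately show "u \<in> cfun.span (insert v B)"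
        by (metis cfun.span_add cfun.span_scale cfun.span_base insertI1)
    qed
    then show ?thesis using B(1) by blast
  qed (use B in blast)
qed

lemma cusp_forms_finite_span: "\<exists>B. finite B \<and> cusp_forms (2 * h) \<subseteq> cfun.span B"
proof (rule finite_span_of_functionals[where \<phi> = "\<lambda>n f. qcoeff f n" and m = "h + 2"])
  fix v assume "v \<in> cusp_forms (2 * h)" "\<And>n. n < h + 2 \<Longrightarrow> qcoeff v n = 0"
  then show "v = 0" by (intro cusp_form_eq_0_of_coeffs[of v h]) auto
qed (auto simp: subspace_cusp_forms qcoeff_add qcoeff_fscale)

text \<open>A finite spanning set is what makes \<open>cfun.dim\<close> an upper bound: it is the
  cardinality of a basis, and \<open>card\<close> is 0 on infinite sets.\<close>

lemma independent_card_le_dim_cusp_forms: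
  assumes "cfun.independent S" "S \<subseteq> cusp_forms (2 * h)"
  shows "finite S \<and> card S \<le> cfun.dim (cusp_forms (2 * h))"
proof -
  obtain B where B: "S \<subseteq> B" "B \<subseteq> cusp_forms (2 * h)" "cfun.independent B" "cusp_forms (2 * h) \<subseteq> cfun.span B"
    using cfun.maximal_independent_subset_extend[OF assms(2,1)] by metis
  obtain A where A: "finite A" "cusp_forms (2 * h) \<subseteq> cfun.span A" using cusp_forms_finite_span by blast
  have "finite B" using cfun.independent_span_bound[OF A(1) B(3)] A(2) B(2) by blast
  then show ?thesis
    using B cfun.basis_card_eq_dim[OF B(2,4,3)] by (metis card_mono finite_subset)
qed

section \<open>Hecke operators\<close>

lemma hecke_add: "hecke k n (f + g) = hecke k n f + hecke k n g"
  by (auto simp: hecke_def fun_eq_iff sum.distrib add_divide_distrib distrib_left)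

lemma hecke_fscale: "hecke k n (fscale c f) = fscale c (hecke k n f)"
  by (auto simp: hecke_def fun_eq_iff fscale_def sum_distrib_left mult_ac)

lemma hecke_zero: "hecke k n 0 = 0"
  by (auto simp: hecke_def fun_eq_iff)

lemma hecke_sum: "hecke k n (\<Sum>i\<in>A. fscale (c i) (g i)) = (\<Sum>i\<in>A. fscale (c i) (hecke k n (g i)))"
  by (induction A rule: infinite_finite_induct)
     (simp_all only: sum.infinite sum.empty sum.insert hecke_zero hecke_add hecke_fscale not_False_eq_True)

text \<open>The classical formula for the m-th coefficient of T_n f, a sum over common divisors e of
  n and m with argument n m / e^2. For m = 0 all divisors of n contribute.\<close>

definition hecke_coeff :: "nat \<Rightarrow> nat \<Rightarrow> (nat \<Rightarrow> complex) \<Rightarrow> nat \<Rightarrow> complex" where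
  "hecke_coeff k n a m =
     (\<Sum>e | e dvd n \<and> e dvd m. of_nat e ^ (k - 1) * a ((n div e) * (m div e)))"

lemma sum_root_of_unity_powers:
  assumes "d > 0"
  shows "(\<Sum>b<d. exp (2 * of_real pi * \<i> * of_nat l / of_nat d) ^ b) =
           (if d dvd l then of_nat d else (0::complex))"
proof -
  define \<zeta> where "\<zeta> = exp (2 * of_real pi * \<i> * of_nat l / of_nat d :: complex)"
  have 1: "\<zeta> = 1 \<longleftrightarrow> d dvd l"
    unfolding \<zeta>_def using complex_root_unity_eq_1[of d l] assms by simp
  have "\<zeta> ^ d = exp (2 * of_real pi * \<i> * of_nat l)"
    unfolding \<zeta>_def using assms by (simp add: mult.commute flip: exp_of_nat_mult)
  also have "\<dots> = 1" using complex_root_unity_eq_1[of 1 l] by simp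
  finally have "\<zeta> ^ d = 1" .
  then show ?thesis using 1 by (cases "\<zeta> = 1") (auto simp: sum_gp_strict simp flip: \<zeta>_def)
qed

text \<open>Summing over b filters the expansion: the d-th roots of unity cancel unless d divides
  the index l. The surviving indices l = d j reappear as powers e j of q.\<close>

lemma hecke_row_q_expansion:
  assumes qe: "has_q_expansion f a" and d: "d > 0" and e: "e > 0" and z: "Im z > 0"
  shows "(\<lambda>m. (if e dvd m then of_nat d * a (d * (m div e)) else 0) * exp (2 * of_real pi * \<i> * z) ^ m)
           sums (\<Sum>b<d. f ((of_nat e * z + of_nat b) / of_nat d))"
proof -
  define w where "w = exp (2 * of_real pi * \<i> * z)"
  define u where "u = exp (2 * of_real pi * \<i> * (of_nat e * z / of_nat d))"
  define \<zeta> where "\<zeta> l = exp (2 * of_real pi * \<i> * of_nat l / of_nat d :: complex)" for l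
  have ud: "u ^ d = w ^ e"
    unfolding u_def w_def using d by (simp add: mult_ac flip: exp_of_nat_mult)
  have "(\<lambda>l. a l * exp (2 * of_real pi * \<i> * ((of_nat e * z + of_nat b) / of_nat d)) ^ l)
      sums f ((of_nat e * z + of_nat b) / of_nat d)" for b
  proof -
    have "Im ((of_nat e * z + of_nat b) / of_nat d) > 0"
      using d e z by (simp add: Im_divide power2_eq_square)
    then show ?thesis using qe unfolding has_q_expansion_def by blast
  qed
  moreover have "a l * exp (2 * of_real pi * \<i> * ((of_nat e * z + of_nat b) / of_nat d)) ^ l =
      a l * u ^ l * \<zeta> l ^ b" for b l
  proof -
    have "of_nat l * (2 * of_real pi * \<i> * ((of_nat e * z + of_nat b) / of_nat d)) =
        of_nat l * (2 * of_real pi * \<i> * (of_nat e * z / of_nat d)) +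
        of_nat b * (2 * of_real pi * \<i> * of_nat l / of_nat d)"
      using d by (simp add: field_simps)
    then show ?thesis unfolding u_def \<zeta>_def by (simp add: exp_add flip: exp_of_nat_mult)
  qed
  ultimately have "(\<lambda>l. a l * u ^ l * \<zeta> l ^ b) sums f ((of_nat e * z + of_nat b) / of_nat d)" for b
    by (simp only:)
  then have "(\<lambda>l. \<Sum>b<d. a l * u ^ l * \<zeta> l ^ b) sums (\<Sum>b<d. f ((of_nat e * z + of_nat b) / of_nat d))"
    by (intro sums_sum)
  then have s1: "(\<lambda>l. a l * u ^ l * (if d dvd l then of_nat d else 0)) sums (\<Sum>b<d. f ((of_nat e * z + of_nat b) / of_nat d))"
    using sum_root_of_unity_powers[OF d] unfolding \<zeta>_def by (simp add: sum_distrib_left[symmetric])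
  have "(\<lambda>j. a (d * j) * u ^ (d * j) * of_nat d) sums (\<Sum>b<d. f ((of_nat e * z + of_nat b) / of_nat d))"
  proof -
    have "(\<lambda>j. a (d * j) * u ^ (d * j) * (if d dvd d * j then of_nat d else 0)) sums c \<longleftrightarrow>
        (\<lambda>l. a l * u ^ l * (if d dvd l then of_nat d else 0)) sums c" for c
      by (rule sums_mono_reindex) (use d in \<open>auto simp: strict_mono_def elim: dvdE\<close>)
    then show ?thesis using s1 by simp
  qed
  moreover have "u ^ (d * j) = w ^ (e * j)" for j by (simp only: power_mult ud)
  ultimately have "(\<lambda>j. of_nat d * a (d * j) * w ^ (e * j)) sums (\<Sum>b<d. f ((of_nat e * z + of_nat b) / of_nat d))"
    by (simp add: mult_ac)
  moreover have "(\<lambda>j. (if e dvd e * j then of_nat d * a (d * (e * j div e)) else 0) * w ^ (e * j)) sums c \<longleftrightarrow>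
      (\<lambda>m. (if e dvd m then of_nat d * a (d * (m div e)) else 0) * w ^ m) sums c" for c
    by (rule sums_mono_reindex) (use e in \<open>auto simp: strict_mono_def elim: dvdE\<close>)
  ultimately show ?thesis using e unfolding w_def[symmetric] by simp
qed

lemma hecke_q_expansion:
  assumes qe: "has_q_expansion f a" and n: "n > 0" and k: "k > 0"
  shows "has_q_expansion (hecke k n f) (hecke_coeff k n a)"
  unfolding has_q_expansion_def
proof (intro allI impI)
  fix z :: complex assume z: "Im z > 0"
  define w where "w = exp (2 * of_real pi * \<i> * z)"
  define T where "T e m = (if e dvd m then of_nat e ^ (k - 1) * a ((n div e) * (m div e)) else 0)" for e m
  have row: "(\<lambda>m. T (n div d) m * w ^ m) sums
      (of_nat n ^ (k - 1) * (\<Sum>b<d. f ((of_nat (n div d) * z + of_nat b) / of_nat d) / of_nat d ^ k))"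
    if "d dvd n" for d
  proof -
    define e where "e = n div d"
    have ed: "n = e * d" "d > 0" "e > 0" "n div e = d" using that n by (auto simp: e_def elim!: dvdE)
    have c: "of_nat n ^ (k - 1) / of_nat d ^ k * of_nat d = (of_nat e ^ (k - 1) :: complex)"
      using ed(2) k unfolding ed(1) by (cases k) (auto simp: power_mult_distrib)
    have "(\<lambda>m. of_nat n ^ (k - 1) / of_nat d ^ k *
        ((if e dvd m then of_nat d * a (d * (m div e)) else 0) * w ^ m)) sums
        (of_nat n ^ (k - 1) / of_nat d ^ k * (\<Sum>b<d. f ((of_nat e * z + of_nat b) / of_nat d)))"
      unfolding w_def by (intro sums_mult hecke_row_q_expansion qe ed z)
    moreover have "of_nat n ^ (k - 1) / of_nat d ^ k *
        ((if e dvd m then of_nat d * a (d * (m div e)) else 0) * w ^ m) = T e m * w ^ m" for m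
      unfolding T_def ed(4) c[symmetric] by simp
    moreover have "of_nat n ^ (k - 1) / of_nat d ^ k * (\<Sum>b<d. f ((of_nat e * z + of_nat b) / of_nat d)) =
        of_nat n ^ (k - 1) * (\<Sum>b<d. f ((of_nat e * z + of_nat b) / of_nat d) / of_nat d ^ k)"
      by (simp flip: sum_divide_distrib)
    ultimately show ?thesis unfolding e_def[symmetric] by (simp only:)
  qed
  have "(\<lambda>m. \<Sum>d | d dvd n. T (n div d) m * w ^ m) sums (hecke k n f z)"
    unfolding hecke_def sum_distrib_left[of _ _ "{d. d dvd n}"] using row by (intro sums_sum) auto
  moreover have "(\<Sum>d | d dvd n. T (n div d) m * w ^ m) = hecke_coeff k n a m * w ^ m" for m
  proof -
    have "(\<Sum>d | d dvd n. T (n div d) m) = (\<Sum>e | e dvd n. T e m)"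
      by (rule sum.reindex_bij_witness[of _ "\<lambda>d. n div d" "\<lambda>d. n div d"]) (use n in \<open>auto elim!: dvdE\<close>)
    also have "\<dots> = hecke_coeff k n a m"
      unfolding hecke_coeff_def T_def using n
      by (intro sum.mono_neutral_cong_right) auto
    finally show ?thesis by (simp flip: sum_distrib_right)
  qed
  ultimately show "(\<lambda>m. hecke_coeff k n a m * exp (2 * of_real pi * \<i> * z) ^ m) sums hecke k n f z"
    by (simp add: w_def)
qed

lemma hecke_holomorphic:
  assumes f: "f holomorphic_on {z. Im z > 0}" and n: "n > 0"
  shows "hecke k n f holomorphic_on {z. Im z > 0}"
proof -
  have "(\<lambda>z. f ((of_nat (n div d) * z + of_nat b) / of_nat d)) holomorphic_on {z. Im z > 0}"
    if "d dvd n" for d b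
  proof -
    have d: "d > 0" "n div d > 0" using that n by (auto elim!: dvdE)
    have "f \<circ> (\<lambda>z. (of_nat (n div d) * z + of_nat b) / of_nat d) holomorphic_on {z. Im z > 0}"
      using d by (intro holomorphic_on_compose_gen[OF _ f] holomorphic_intros)
        (auto simp: Im_divide power2_eq_square)
    then show ?thesis by (simp add: o_def)
  qed
  moreover have "d > 0" if "d dvd n" for d using that n by (auto elim!: dvdE)
  ultimately show ?thesis
    unfolding hecke_def by (intro holomorphic_intros) auto
qed

lemma hecke_cusp_form:
  assumes f: "f \<in> cusp_forms k" and n: "n > 0" and k: "k > 0"
  shows "hecke k n f \<in> cusp_forms k"
proof -
  have "hecke k n f ((of_int a * z + of_int b) / (of_int c * z + of_int d)) = (of_int c * z + of_int d) ^ k * hecke k n f z"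
    if "a * d - b * c = 1" "Im z > 0" for a b c d :: int and z
    using hecke_mact[OF f n _ that(2), of "(a, b, c, d)"] that(1) by (simp add: SL2Z_def)
  moreover have "hecke k n f z = 0" if "\<not> Im z > 0" for z
  proof -
    have "f ((of_nat (n div d) * z + of_nat b) / of_nat d) = 0" if "d dvd n" for d b
    proof -
      have "n div d * Im z \<le> 0" using \<open>\<not> Im z > 0\<close> by (simp add: mult_nonneg_nonpos)
      then have "\<not> Im ((of_nat (n div d) * z + of_nat b) / of_nat d) > 0"
        by (simp add: Im_divide power2_eq_square divide_nonpos_nonneg not_less)
      then show ?thesis using f by (auto simp: cusp_forms_def)
    qed
    then show ?thesis by (simp add: hecke_def)
  qed
  moreover have "hecke k n f holomorphic_on {z. Im z > 0}"
    using f n by (intro hecke_holomorphic) (auto simp: cusp_forms_def)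
  moreover have "has_q_expansion (hecke k n f) (hecke_coeff k n (qcoeff f))"
    using hecke_q_expansion[OF cusp_form_q_expansion(1)[OF f] n k] .
  moreover have "hecke_coeff k n (qcoeff f) 0 = 0"
    using cusp_form_q_expansion(2)[OF f] by (simp add: hecke_coeff_def)
  ultimately show ?thesis unfolding cusp_forms_def by blast
qed

lemma qcoeff_hecke:
  assumes "f \<in> cusp_forms k" "n > 0" "k > 0"
  shows "qcoeff (hecke k n f) m = hecke_coeff k n (qcoeff f) m"
  using hecke_q_expansion[OF cusp_form_q_expansion(1)[OF assms(1)] assms(2,3)] by (simp add: qcoeff_eq)

lemma hecke_coeff_prime:
  assumes "prime p"
  shows "hecke_coeff k p a m = a (p * m) + (if p dvd m then of_nat p ^ (k - 1) * a (m div p) else 0)"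
proof -
  have "{e. e dvd p \<and> e dvd m} = (if p dvd m then {1, p} else {1})"
    using assms by (auto simp: prime_nat_iff)
  moreover have "p \<noteq> 1" "p > 0" using assms by (auto simp: prime_gt_0_nat)
  ultimately show ?thesis by (simp add: hecke_coeff_def)
qed

lemma hecke_coeff_1: "hecke_coeff k n a (Suc 0) = a n"
proof -
  have "{e. e dvd n \<and> e dvd Suc 0} = {1}" by auto
  then show ?thesis by (simp add: hecke_coeff_def)
qed

text \<open>Both sides are sums over divisors with a common part over \<open>A\<close>. On the left
  remain \<open>B\<close>, the divisors of n and p m that do not divide m, and \<open>C\<close>,
  from the second term of T_p. On the right remain those e in \<open>A\<close> for which p divides
  (n/e)(m/e), which are \<open>C \<union> D\<close>. Finally e in \<open>B\<close> must be divisible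
  by p, and e = p e' matches \<open>B\<close> with \<open>D\<close>.\<close>

lemma hecke_coeff_commute:
  assumes p: "prime p" and n: "n > 0" and m: "m > 0"
  shows "hecke_coeff k p (hecke_coeff k n a) m = hecke_coeff k n (hecke_coeff k p a) m"
proof -
  define s where "s = k - 1"
  have p0: "p > 0" using p by (rule prime_gt_0_nat)
  define A where "A = {e. e dvd n \<and> e dvd m}"
  define B where "B = {e. e dvd n \<and> e dvd p * m \<and> \<not> e dvd m}"
  define C where "C = {e. e dvd n \<and> e dvd m \<and> p * e dvd m}"
  define D where "D = {e. e dvd m \<and> p * e dvd n \<and> \<not> p * e dvd m}"
  have fin: "finite A" "finite B" "finite C" "finite D"
    using n unfolding A_def B_def C_def D_def
    by (auto intro: finite_subset[of _ "{e. e dvd n}"] dvd_mult_right)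
  have L1: "hecke_coeff k n a (p * m) =
      (\<Sum>e\<in>A. of_nat e ^ s * a (p * ((n div e) * (m div e)))) + (\<Sum>e\<in>B. of_nat e ^ s * a ((n div e) * (p * m div e)))"
  proof -
    have "{e. e dvd n \<and> e dvd p * m} = A \<union> B" by (auto simp: A_def B_def)
    then have "hecke_coeff k n a (p * m) = (\<Sum>e\<in>A \<union> B. of_nat e ^ s * a ((n div e) * (p * m div e)))"
      by (simp add: hecke_coeff_def s_def)
    also have "\<dots> = (\<Sum>e\<in>A. of_nat e ^ s * a ((n div e) * (p * m div e))) + (\<Sum>e\<in>B. of_nat e ^ s * a ((n div e) * (p * m div e)))"
      using fin by (intro sum.union_disjoint) (auto simp: A_def B_def)
    also have "(\<Sum>e\<in>A. of_nat e ^ s * a ((n div e) * (p * m div e))) = (\<Sum>e\<in>A. of_nat e ^ s * a (p * ((n div e) * (m div e))))"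
      using n by (intro sum.cong refl) (auto simp: A_def mult_ac elim!: dvdE)
    finally show ?thesis .
  qed
  have L2: "(if p dvd m then of_nat p ^ s * hecke_coeff k n a (m div p) else 0) =
      (\<Sum>e\<in>C. of_nat (p * e) ^ s * a ((n div e) * (m div e) div p))"
  proof (cases "p dvd m")
    case True
    then obtain m' where m': "m = p * m'" by (elim dvdE)
    have "{e. e dvd n \<and> e dvd m'} = C" using p0 by (auto simp: C_def m')
    then have "of_nat p ^ s * hecke_coeff k n a (m div p) = (\<Sum>e\<in>C. of_nat p ^ s * (of_nat e ^ s * a ((n div e) * (m' div e))))"
      using p0 by (simp add: hecke_coeff_def s_def m' sum_distrib_left)
    also have "\<dots> = (\<Sum>e\<in>C. of_nat (p * e) ^ s * a ((n div e) * (m div e) div p))"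
    proof (intro sum.cong refl)
      fix e assume "e \<in> C"
      then have "e dvd m'" using p0 by (auto simp: C_def m')
      then have "(n div e) * (m div e) div p = (n div e) * (m' div e)"
        using p0 by (auto simp: m' mult_ac elim!: dvdE)
      then show "of_nat p ^ s * (of_nat e ^ s * a ((n div e) * (m' div e))) = of_nat (p * e) ^ s * a ((n div e) * (m div e) div p)"
        by (simp add: power_mult_distrib)
    qed
    finally show ?thesis using True by simp
  next
    case False
    then have "C = {}" by (auto simp: C_def dest: dvd_mult_left)
    then show ?thesis using False by simp
  qed
  have BD: "(\<Sum>e\<in>B. of_nat e ^ s * a ((n div e) * (p * m div e))) =
      (\<Sum>e\<in>D. of_nat (p * e) ^ s * a ((n div e) * (m div e) div p))"
  proof (rule sum.reindex_bij_witness[of _ "\<lambda>e. p * e" "\<lambda>e. e div p"])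
    fix e assume e: "e \<in> B"
    have "p dvd e"
    proof (rule ccontr)
      assume "\<not> p dvd e"
      then have "coprime e p" using p by (metis coprime_commute prime_imp_coprime)
      then show False using e by (auto simp: B_def coprime_dvd_mult_right_iff)
    qed
    then obtain e' where e': "e = p * e'" by (elim dvdE)
    have 1: "e' dvd m" "p * e' dvd n" "\<not> p * e' dvd m" using e p0 by (auto simp: B_def e')
    show "p * (e div p) = e" "e div p \<in> D" using 1 p0 by (auto simp: e' D_def)
    obtain n' where n': "n = p * e' * n'" using 1 by (elim dvdE)
    have "e' > 0" using m 1 by (auto intro!: Nat.gr0I)
    then have "(n div e') * (m div e') div p = (n div e) * (p * m div e)"
      using p0 1(1) by (auto simp: n' e' mult_ac elim!: dvdE)
    then show "of_nat (p * (e div p)) ^ s * a ((n div (e div p)) * (m div (e div p)) div p) = of_nat e ^ s * a ((n div e) * (p * m div e))"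
      using p0 by (simp add: e')
  qed (use p0 in \<open>auto simp: B_def D_def\<close>)
  have CD: "{e \<in> A. p dvd (n div e) * (m div e)} = C \<union> D"
  proof (intro equalityI subsetI)
    fix e assume "e \<in> {e \<in> A. p dvd (n div e) * (m div e)}"
    then have e: "e dvd n" "e dvd m" "p dvd n div e \<or> p dvd m div e"
      using p by (auto simp: A_def prime_dvd_mult_iff)
    then have "p * e dvd n \<or> p * e dvd m" by (metis dvd_div_iff_mult dvd_0_left_iff m n not_gr0)
    then show "e \<in> C \<union> D" using e by (auto simp: C_def D_def)
  next
    fix e assume "e \<in> C \<union> D"
    then have e: "e dvd n" "e dvd m" "p * e dvd n \<or> p * e dvd m"
      by (auto simp: C_def D_def dest: dvd_mult_right)
    have "e > 0" using m e(2) by (auto intro!: Nat.gr0I)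
    then have "p dvd n div e \<or> p dvd m div e" using e by (auto elim!: dvdE simp: mult_ac)
    then show "e \<in> {e \<in> A. p dvd (n div e) * (m div e)}" using e by (auto simp: A_def)
  qed
  have "hecke_coeff k n (hecke_coeff k p a) m =
      (\<Sum>e\<in>A. of_nat e ^ s * a (p * ((n div e) * (m div e)))) +
      (\<Sum>e\<in>A. if p dvd (n div e) * (m div e) then of_nat (p * e) ^ s * a ((n div e) * (m div e) div p) else 0)"
    unfolding hecke_coeff_def[of k n] hecke_coeff_prime[OF p] A_def[symmetric] s_def[symmetric] sum.distrib[symmetric]
    by (intro sum.cong refl) (simp add: algebra_simps power_mult_distrib)
  also have "(\<Sum>e\<in>A. if p dvd (n div e) * (m div e) then of_nat (p * e) ^ s * a ((n div e) * (m div e) div p) else 0) =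
      (\<Sum>e\<in>C \<union> D. of_nat (p * e) ^ s * a ((n div e) * (m div e) div p))"
    unfolding CD[symmetric] using fin(1) by (intro sum.inter_filter[symmetric])
  also have "\<dots> = (\<Sum>e\<in>C. of_nat (p * e) ^ s * a ((n div e) * (m div e) div p)) +
      (\<Sum>e\<in>D. of_nat (p * e) ^ s * a ((n div e) * (m div e) div p))"
    using fin by (intro sum.union_disjoint) (auto simp: C_def D_def)
  finally show ?thesis
    unfolding hecke_coeff_prime[OF p, of k "hecke_coeff k n a" m] s_def[symmetric] L1 L2 BD
    by (simp only: ac_simps)
qed

lemma hecke_commute:
  assumes f: "f \<in> cusp_forms k" and p: "prime p" and n: "n > 0" and k: "k > 0"
  shows "hecke k p (hecke k n f) = hecke k n (hecke k p f)"
proof (rule cusp_form_eqI)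
  have p0: "p > 0" using p by (rule prime_gt_0_nat)
  note cusp = hecke_cusp_form[OF f n k] hecke_cusp_form[OF f p0 k]
  show c1: "hecke k p (hecke k n f) \<in> cusp_forms k" and c2: "hecke k n (hecke k p f) \<in> cusp_forms k"
    using cusp by (auto intro: hecke_cusp_form p0 n k)
  fix m
  have "qcoeff (hecke k n f) = hecke_coeff k n (qcoeff f)" "qcoeff (hecke k p f) = hecke_coeff k p (qcoeff f)"
    using qcoeff_hecke f n p0 k by auto
  then show "qcoeff (hecke k p (hecke k n f)) m = qcoeff (hecke k n (hecke k p f)) m"
    using qcoeff_hecke[OF cusp(1) p0 k] qcoeff_hecke[OF cusp(2) n k] hecke_coeff_commute[OF p n]
      cusp_form_q_expansion(2)[OF c1] cusp_form_q_expansion(2)[OF c2]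
    by (cases "m = 0") auto
qed


section \<open>Simultaneous eigenvectors of commuting operators\<close>

lemma sum_fun_apply: "(\<Sum>i\<in>A. g i) z = (\<Sum>i\<in>A. g i z)"
  for g :: "'i \<Rightarrow> complex \<Rightarrow> complex"
  by (induction A rule: infinite_finite_induct) simp_all

lemma subspace_eq_of_dim_le:
  assumes "finite B" "W \<subseteq> cfun.span B" "cfun.subspace E" "E \<subseteq> W" "cfun.dim W \<le> cfun.dim E"
  shows "W \<subseteq> E"
proof -
  obtain BE where BE: "BE \<subseteq> E" "cfun.independent BE" "E \<subseteq> cfun.span BE"
    using cfun.maximal_independent_subset[of E] by metis
  obtain BW where BW: "BE \<subseteq> BW" "BW \<subseteq> W" "cfun.independent BW" "W \<subseteq> cfun.span BW"
    using cfun.maximal_independent_subset_extend[of BE W] BE assms(4) by (metis order_trans)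
  have "finite BW" using cfun.independent_span_bound[OF assms(1) BW(3)] BW(2) assms(2) by blast
  moreover have "card BW = cfun.dim W" "card BE = cfun.dim E"
    using cfun.basis_card_eq_dim BW BE by blast+
  ultimately have "BE = BW" using BW(1) assms(5) by (metis card_seteq)
  then have "W \<subseteq> cfun.span BE" using BW(4) by simp
  also have "\<dots> \<subseteq> E" using BE(1) assms(3) by (rule cfun.span_minimal)
  finally show ?thesis .
qed

text \<open>Among the nonzero polynomials p with p(T) w = 0 one of least degree is taken. If l is a
  root and p = (X - l) q, then q(T) w is nonzero by minimality and T acts on it as l. Degrees are
  capped at \<open>N\<close>, so that \<open>ev\<close> is one fixed finite sum.\<close>

lemma eigenvector_exists:
  assumes B: "finite B" "W \<subseteq> cfun.span B" and W: "cfun.subspace W" and w: "w \<in> W" "w \<noteq> 0"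
    and TW: "\<And>v. v \<in> W \<Longrightarrow> T v \<in> W"
    and add: "\<And>u v. T (u + v) = T u + T v" and scale: "\<And>c u. T (fscale c u) = fscale c (T u)"
  obtains v c where "v \<in> W" "v \<noteq> 0" "T v = fscale c v"
proof -
  define N where "N = card B"
  define x where "x i = (T ^^ i) w" for i
  have xW: "x i \<in> W" for i by (induction i) (use w TW in \<open>auto simp: x_def\<close>)
  have xS: "x (Suc i) = T (x i)" for i by (simp add: x_def)
  have T0: "T 0 = 0" using scale[of 0 0] by (simp only: cfun.scale_zero_left)
  have Tsum: "T (\<Sum>i\<in>A. fscale (c i) (g i)) = (\<Sum>i\<in>A. fscale (c i) (T (g i)))"
    for A :: "nat set" and c g
    by (induction A rule: infinite_finite_induct)
       (simp_all only: sum.infinite sum.empty sum.insert T0 add scale not_False_eq_True)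
  define ev where "ev p = (\<Sum>i\<le>N. fscale (coeff p i) (x i))" for p :: "complex poly"
  have evW: "ev p \<in> W" for p
    unfolding ev_def by (intro cfun.subspace_sum[OF W] cfun.subspace_scale[OF W] xW)
  define Q where "Q p \<longleftrightarrow> p \<noteq> 0 \<and> degree p \<le> N \<and> ev p = 0" for p
  have "\<exists>p. Q p"
  \<comment> \<open>A linear dependence speaks about a set of vectors; if two iterates coincide,
    this set is smaller, and the relation X^j - X^i is written down directly.\<close>
  proof (cases "inj_on x {..N}")
    case True
    have "cfun.dependent (x ` {..N})"
    proof (rule ccontr)
      assume "cfun.independent (x ` {..N})"
      then have "card (x ` {..N}) \<le> card B"
        using cfun.independent_span_bound[OF B(1), of "x ` {..N}"] B(2) xW by blast
      then show False using True by (simp add: card_image N_def)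
    qed
    then obtain u where u: "\<exists>v\<in>x ` {..N}. u v \<noteq> 0" "(\<Sum>v\<in>x ` {..N}. fscale (u v) v) = 0"
      using cfun.dependent_finite[of "x ` {..N}"] by auto
    define p where "p = (\<Sum>i\<le>N. monom (u (x i)) i)"
    have cp: "coeff p i = (if i \<le> N then u (x i) else 0)" for i
      unfolding p_def by (simp add: coeff_sum)
    have "ev p = (\<Sum>i\<le>N. fscale (u (x i)) (x i))"
      unfolding ev_def by (intro sum.cong refl) (simp add: cp)
    also have "\<dots> = (\<Sum>v\<in>x ` {..N}. fscale (u v) v)"
      using sum.reindex[OF True, of "\<lambda>v. fscale (u v) v"] by (simp only: o_def)
    finally have "ev p = 0" using u(2) by (simp only:)
    moreover have "p \<noteq> 0" using u(1) cp by (auto simp: poly_eq_iff)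
    moreover have "degree p \<le> N" by (intro degree_le) (simp add: cp)
    ultimately show ?thesis unfolding Q_def by blast
  next
    case False
    then obtain i j where ij: "i \<noteq> j" "i \<le> N" "j \<le> N" "x i = x j" by (auto simp: inj_on_def)
    define p where "p = monom 1 j - monom (1 :: complex) i"
    have "ev p z = 0" for z
    proof -
      have "ev p z = (\<Sum>l\<le>N. (if l = j then x l z else 0) - (if l = i then x l z else 0))"
        unfolding ev_def sum_fun_apply fscale_def p_def
        by (intro sum.cong refl) (auto simp: coeff_monom)
      also have "\<dots> = x j z - x i z" using ij by (simp add: sum_subtractf)
      finally show ?thesis using ij by simp
    qed
    then have "ev p = 0" by (simp add: fun_eq_iff)
    moreover have "coeff p i \<noteq> 0" using ij by (simp add: p_def coeff_monom)
    then have "p \<noteq> 0" by auto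
    moreover have "degree p \<le> N" using ij unfolding p_def
      by (intro degree_diff_le) (auto intro: order_trans[OF degree_monom_le])
    ultimately show ?thesis unfolding Q_def by blast
  qed
  then obtain p where p: "Q p" and min: "\<And>q. Q q \<Longrightarrow> degree p \<le> degree q"
    using ex_has_least_nat[of Q _ degree] by blast
  have "degree p \<noteq> 0"
  proof
    assume "degree p = 0"
    then obtain c where c: "p = [:c:]" by (metis degree_eq_zeroE)
    have "ev p z = c * w z" for z
    proof -
      have "ev p z = (\<Sum>l\<le>N. if l = 0 then c * x l z else 0)"
        unfolding ev_def sum_fun_apply fscale_def c
        by (intro sum.cong refl) (auto simp: coeff_pCons split: nat.splits)
      then show ?thesis by (simp add: x_def)
    qed
    then show False using p c w(2) by (auto simp: Q_def fun_eq_iff)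
  qed
  then obtain l where "poly p l = 0"
    using fundamental_theorem_of_algebra[of p] constant_degree[of p] by auto
  then obtain q where q: "p = [:- l, 1:] * q" by (auto simp: poly_eq_0_iff_dvd elim: dvdE)
  have q0: "q \<noteq> 0" using p q by (auto simp: Q_def)
  have deg: "degree p = Suc (degree q)" using q0 unfolding q by (subst degree_mult_eq) auto
  then have qN: "degree q < N" using p by (auto simp: Q_def)
  have "ev q \<noteq> 0" using min[of q] deg q0 qN by (auto simp: Q_def)
  have evq: "ev q = (\<Sum>i<N. fscale (coeff q i) (x i))"
  proof -
    have "fscale (coeff q N) (x N) = 0" using qN by (simp add: coeff_eq_0)
    then show ?thesis unfolding ev_def by (simp only: lessThan_Suc_atMost[symmetric] sum.lessThan_Suc add_0_right)
  qed
  have "ev p z = T (ev q) z - l * ev q z" for z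
  proof -
    have cp: "coeff p i = (case i of 0 \<Rightarrow> 0 | Suc j \<Rightarrow> coeff q j) - l * coeff q i" for i
      unfolding q by (simp add: coeff_pCons)
    have "ev p z = (\<Sum>i\<le>N. (case i of 0 \<Rightarrow> 0 | Suc j \<Rightarrow> coeff q j) * x i z - l * (coeff q i * x i z))"
      unfolding ev_def sum_fun_apply fscale_def
      by (intro sum.cong refl) (simp only: cp left_diff_distrib mult.assoc)
    also have "\<dots> = (\<Sum>i\<le>N. (case i of 0 \<Rightarrow> 0 | Suc j \<Rightarrow> coeff q j) * x i z) - l * ev q z"
      by (simp only: sum_subtractf ev_def sum_fun_apply fscale_def sum_distrib_left)
    also have "(\<Sum>i\<le>N. (case i of 0 \<Rightarrow> 0 | Suc j \<Rightarrow> coeff q j) * x i z) = (\<Sum>i<N. coeff q i * x (Suc i) z)"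
      by (subst sum.atMost_shift) simp
    also have "\<dots> = T (ev q) z"
      unfolding evq Tsum xS[symmetric] by (simp add: sum_fun_apply fscale_def)
    finally show ?thesis .
  qed
  then have "T (ev q) = fscale l (ev q)"
    using p by (auto simp: Q_def fscale_def fun_eq_iff)
  with \<open>ev q \<noteq> 0\<close> evW that show ?thesis by blast
qed

text \<open>In a nonzero invariant subspace of least dimension, an eigenspace of any one operator is
  again invariant by commutativity, hence everything. So every nonzero vector of that subspace
  works, for infinitely many operators as well.\<close>

lemma common_eigenvector_exists:
  assumes B: "finite B" "V \<subseteq> cfun.span B" and V: "cfun.subspace V" and v: "v \<in> V" "v \<noteq> 0"
    and TV: "\<And>i v. i \<in> I \<Longrightarrow> v \<in> V \<Longrightarrow> T i v \<in> V"
    and add: "\<And>i u v. T i (u + v) = T i u + T i v" and scale: "\<And>i c u. T i (fscale c u) = fscale c (T i u)"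
    and comm: "\<And>i j v. i \<in> I \<Longrightarrow> j \<in> I \<Longrightarrow> v \<in> V \<Longrightarrow> T i (T j v) = T j (T i v)"
  obtains w where "w \<in> V" "w \<noteq> 0" "\<And>i. i \<in> I \<Longrightarrow> \<exists>c. T i w = fscale c w"
proof -
  define good where "good W \<longleftrightarrow> cfun.subspace W \<and> W \<subseteq> V \<and> (\<exists>w\<in>W. w \<noteq> 0) \<and> (\<forall>i\<in>I. \<forall>w\<in>W. T i w \<in> W)" for W
  have "good V" using V v TV unfolding good_def by blast
  then obtain W where W: "good W" and min: "\<And>W'. good W' \<Longrightarrow> cfun.dim W \<le> cfun.dim W'"
    using ex_has_least_nat[of good V cfun.dim] by blast
  have sub: "cfun.subspace W" and WV: "W \<subseteq> V" and TW: "\<And>i w. i \<in> I \<Longrightarrow> w \<in> W \<Longrightarrow> T i w \<in> W"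
    using W by (auto simp: good_def)
  obtain w where w: "w \<in> W" "w \<noteq> 0" using W by (auto simp: good_def)
  have WB: "W \<subseteq> cfun.span B" using WV B(2) by blast
  have "\<exists>c. T i w = fscale c w" if i: "i \<in> I" for i
  proof -
    obtain u c where u: "u \<in> W" "u \<noteq> 0" "T i u = fscale c u"
      using eigenvector_exists[OF B(1) WB sub w TW[OF i] add scale] by metis
    define E where "E = {u \<in> W. T i u = fscale c u}"
    have T0: "T i 0 = 0" using scale[of i 0 0] by (simp only: cfun.scale_zero_left)
    have subE: "cfun.subspace E"
    proof (rule cfun.subspaceI)
      show "0 \<in> E" using T0 cfun.subspace_0[OF sub] by (simp only: E_def mem_Collect_eq cfun.scale_zero_right)
    next
      fix x y assume "x \<in> E" "y \<in> E"
      then show "x + y \<in> E"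
        using cfun.subspace_add[OF sub] by (simp only: E_def mem_Collect_eq add cfun.scale_right_distrib)
    next
      fix d x assume "x \<in> E"
      then show "fscale d x \<in> E"
        using cfun.subspace_scale[OF sub]
        by (simp only: E_def mem_Collect_eq scale cfun.scale_left_commute)
    qed
    moreover have "E \<subseteq> V" "\<exists>u\<in>E. u \<noteq> 0" using WV u by (auto simp: E_def)
    moreover have "T j x \<in> E" if j: "j \<in> I" and x: "x \<in> E" for j x
    proof -
      have "T i (T j x) = T j (T i x)" using comm[OF i j] x WV by (auto simp: E_def)
      then show ?thesis using TW[OF j] x by (simp only: E_def mem_Collect_eq scale)
    qed
    ultimately have "good E" unfolding good_def by blast
    then have "W \<subseteq> E"
      using subspace_eq_of_dim_le[OF B(1) WB subE] min by (auto simp: E_def)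
    then show ?thesis using w by (auto simp: E_def)
  qed
  then show ?thesis using that w WV by blast
qed

section \<open>Multiplicity one and normalized eigenforms\<close>

text \<open>For m = p l the eigenvalue equation expresses a(p l) through a(l) and, if p divides l,
  a(l/p), both of smaller index; everything therefore goes back to a(1).\<close>

lemma hecke_prime_recurrence_zero:
  assumes a: "\<And>p m. prime p \<Longrightarrow> m > 0 \<Longrightarrow> hecke_coeff k p a m = c p * a m" and "a 1 = 0" "m > 0"
  shows "a m = 0"
  using \<open>m > 0\<close>
proof (induction m rule: less_induct)
  case (less m)
  show ?case
  proof (cases "m = 1")
    case False
    then obtain p where p: "prime p" "p dvd m" using prime_factor_nat by blast
    then obtain l where l: "m = p * l" by (elim dvdE)
    have "p > 1" using p(1) by (rule prime_gt_1_nat)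
    then have l0: "l > 0" "l < m" using less.prems by (auto simp: l)
    have "a (l div p) = 0" if "p dvd l"
      using that l0 by (intro less.IH le_less_trans[OF div_le_dividend l0(2)]) (auto elim!: dvdE)
    then show ?thesis using a[OF p(1) l0(1)] less.IH[OF l0(2,1)] p(1)
      by (auto simp: hecke_coeff_prime l split: if_splits)
  qed (use assms in simp)
qed

text \<open>Simultaneous eigenvectors are first found for the prime T_p only. A form with prescribed
  T_p eigenvalues is determined by its coefficient at 1. Applied to T_n g - a_1(T_n g) g, which has
  the same T_p eigenvalues as g and first coefficient 0, this makes g an eigenvector of every
  T_n.\<close>

lemma normalized_eigenform_exists:
  assumes V: "f \<in> cusp_forms (2 * h)" "f \<noteq> 0" and h: "h > 0"
  shows "normalized_eigenforms (2 * h) \<noteq> {}"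
proof -
  let ?k = "2 * h"
  have k: "?k > 0" using h by simp
  obtain B where B: "finite B" "cusp_forms ?k \<subseteq> cfun.span B" using cusp_forms_finite_span by blast
  obtain v where v: "v \<in> cusp_forms ?k" "v \<noteq> 0" "\<And>p. p \<in> {p. prime p} \<Longrightarrow> \<exists>c. hecke ?k p v = fscale c v"
    by (rule common_eigenvector_exists[OF B subspace_cusp_forms V, of "{p. prime p}" "hecke ?k"])
       (use k in \<open>auto intro: hecke_cusp_form hecke_commute hecke_add hecke_fscale prime_gt_0_nat\<close>)
  then obtain c where c: "\<And>p. prime p \<Longrightarrow> hecke ?k p v = fscale (c p) v" by (metis mem_Collect_eq)
  have zero: "u = 0" if u: "u \<in> cusp_forms ?k" "\<And>p. prime p \<Longrightarrow> hecke ?k p u = fscale (c p) u" "qcoeff u 1 = 0" for u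
  proof (rule cusp_form_eqI[OF u(1)])
    show "0 \<in> cusp_forms ?k" by (rule cfun.subspace_0[OF subspace_cusp_forms])
    have "hecke_coeff ?k p (qcoeff u) m = c p * qcoeff u m" if "prime p" for p m
      using qcoeff_hecke[OF u(1) prime_gt_0_nat[OF that] k, of m] u(2)[OF that] qcoeff_fscale[OF u(1), of "c p" m] by simp
    then have "qcoeff u m = 0" if "m > 0" for m
      using hecke_prime_recurrence_zero[of ?k "qcoeff u" c m] u(3) that by blast
    then have u0: "qcoeff u m = 0" for m using cusp_form_q_expansion(2)[OF u(1)] by (cases "m = 0") auto
    have "has_q_expansion 0 (\<lambda>_. 0)" by (simp add: has_q_expansion_def)
    then show "qcoeff u m = qcoeff 0 m" for m using qcoeff_eq[of 0 "\<lambda>_. 0"] u0 by simp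
  qed
  have v1: "qcoeff v 1 \<noteq> 0" using zero[OF v(1) c] v(2) by blast
  define g where "g = fscale (1 / qcoeff v 1) v"
  have g: "g \<in> cusp_forms ?k" unfolding g_def by (rule cfun.subspace_scale[OF subspace_cusp_forms v(1)])
  have g1: "qcoeff g 1 = 1" using v1 by (simp add: g_def qcoeff_fscale[OF v(1)])
  have Tg: "hecke ?k p g = fscale (c p) g" if "prime p" for p
    unfolding g_def hecke_fscale c[OF that] by (rule cfun.scale_left_commute)
  have "hecke ?k n g = fscale (qcoeff (hecke ?k n g) 1) g" if n: "n \<ge> 1" for n
  proof -
    define d where "d = qcoeff (hecke ?k n g) 1"
    have Tn: "hecke ?k n g \<in> cusp_forms ?k" using g n k by (intro hecke_cusp_form) auto
    have sc: "fscale (- d) g \<in> cusp_forms ?k" by (rule cfun.subspace_scale[OF subspace_cusp_forms g])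
    define u where "u = hecke ?k n g + fscale (- d) g"
    have "u \<in> cusp_forms ?k" unfolding u_def by (rule cfun.subspace_add[OF subspace_cusp_forms Tn sc])
    moreover have "hecke ?k p u = fscale (c p) u" if p: "prime p" for p
    proof -
      have "hecke ?k p (hecke ?k n g) = hecke ?k n (fscale (c p) g)"
        using hecke_commute[OF g p _ k, of n] n Tg[OF p] by simp
      then show ?thesis
        unfolding u_def hecke_add hecke_fscale Tg[OF p] cfun.scale_right_distrib
        by (simp only: cfun.scale_left_commute)
    qed
    moreover have "qcoeff u 1 = 0"
      unfolding u_def by (simp only: qcoeff_add[OF Tn sc] qcoeff_fscale[OF g] g1) (simp add: d_def)
    ultimately have "u = 0" by (rule zero)
    then have "hecke ?k n g z = d * g z" for z by (simp add: u_def fun_eq_iff fscale_def)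
    then show ?thesis unfolding d_def[symmetric] by (simp add: fscale_def fun_eq_iff)
  qed
  moreover have "g \<noteq> 0"
  proof
    assume "g = 0"
    then have "has_q_expansion g (\<lambda>_. 0)" by (simp add: has_q_expansion_def)
    then show False using g1 by (simp add: qcoeff_eq)
  qed
  ultimately have "g \<in> normalized_eigenforms ?k"
    using g g1 cusp_form_q_expansion[OF g] unfolding normalized_eigenforms_def hecke_eigenform_def by blast
  then show ?thesis by blast
qed

lemma normalized_eigenformD:
  assumes "f \<in> normalized_eigenforms k" "k > 0"
  shows "f \<in> cusp_forms k" "f \<noteq> 0" "qcoeff f 1 = 1"
    and "n \<ge> 1 \<Longrightarrow> hecke k n f = fscale (qcoeff f n) f"
proof -
  show f: "f \<in> cusp_forms k" "f \<noteq> 0" using assms by (auto simp: normalized_eigenforms_def hecke_eigenform_def)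
  show f1: "qcoeff f 1 = 1" using assms(1) qcoeff_eq by (auto simp: normalized_eigenforms_def)
  assume n: "n \<ge> 1"
  then obtain c where c: "hecke k n f = fscale c f"
    using assms by (auto simp: normalized_eigenforms_def hecke_eigenform_def)
  have "qcoeff (hecke k n f) 1 = qcoeff f n"
    using qcoeff_hecke[OF f(1), of n 1] n assms(2) by (simp add: hecke_coeff_1)
  then have "c = qcoeff f n" using c qcoeff_fscale[OF f(1), of c 1] f1 by simp
  then show "hecke k n f = fscale (qcoeff f n) f" using c by simp
qed

text \<open>Distinct normalized eigenforms differ in some coefficient a_n, which is the T_n
  eigenvalue. Applying T_n minus the eigenvalue of g to a relation removes g and multiplies the
  coefficient of f by a nonzero number.\<close>

lemma normalized_eigenforms_relation:
  assumes k: "k > 0" and "finite F" "F \<subseteq> normalized_eigenforms k" "(\<Sum>f\<in>F. fscale (c f) f) = 0" "f \<in> F"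
  shows "c f = 0"
  using assms(2-)
proof (induction F arbitrary: c f rule: finite_induct)
  case (insert g F)
  have gN: "g \<in> normalized_eigenforms k" and FN: "F \<subseteq> normalized_eigenforms k" using insert.prems by auto
  have sum0: "c g * g z + (\<Sum>f\<in>F. c f * f z) = 0" for z
  proof -
    have "(\<Sum>f\<in>insert g F. fscale (c f) f) z = 0" using insert.prems by simp
    then show ?thesis using insert.hyps unfolding sum_fun_apply by (simp add: fscale_def)
  qed
  have cF: "c f = 0" if f: "f \<in> F" for f
  proof -
    have "f \<noteq> g" using f insert.hyps by auto
    then obtain n where n: "qcoeff f n \<noteq> qcoeff g n"
      using cusp_form_eqI normalized_eigenformD(1)[OF _ k] f FN gN by (metis subsetD)
    have n1: "n \<ge> 1"
      using n cusp_form_q_expansion(2) normalized_eigenformD(1)[OF _ k] f FN gN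
      by (metis One_nat_def Suc_leI not_gr_zero subsetD)
    have "hecke k n (\<Sum>f\<in>insert g F. fscale (c f) f) z = 0" for z
      using hecke_zero[of k n] insert.prems(2) by (metis zero_fun_apply)
    then have "(\<Sum>f\<in>insert g F. c f * hecke k n f z) = 0" for z
      unfolding hecke_sum sum_fun_apply by (simp add: fscale_def)
    moreover have "(\<Sum>f\<in>insert g F. c f * hecke k n f z) = (\<Sum>f\<in>insert g F. c f * (qcoeff f n * f z))" for z
    proof (intro sum.cong refl)
      fix f assume "f \<in> insert g F"
      then have "hecke k n f = fscale (qcoeff f n) f"
        using normalized_eigenformD(4)[OF _ k n1] FN gN by blast
      then show "c f * hecke k n f z = c f * (qcoeff f n * f z)" by (simp add: fscale_def)
    qed
    ultimately have 1: "c g * (qcoeff g n * g z) + (\<Sum>f\<in>F. c f * (qcoeff f n * f z)) = 0" for z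
      using insert.hyps by simp
    have "(\<Sum>f\<in>F. c f * (qcoeff f n - qcoeff g n) * f z) = 0" for z
    proof -
      have "(\<Sum>f\<in>F. c f * (qcoeff f n - qcoeff g n) * f z) =
          (\<Sum>f\<in>F. c f * (qcoeff f n * f z)) - qcoeff g n * (\<Sum>f\<in>F. c f * f z)"
        by (simp add: sum_distrib_left algebra_simps flip: sum_subtractf)
      also have "\<dots> = (\<Sum>f\<in>F. c f * (qcoeff f n * f z)) + qcoeff g n * (c g * g z)"
        using sum0[of z] by (simp add: add_eq_0_iff)
      also have "\<dots> = 0" using 1[of z] by (simp add: algebra_simps)
      finally show ?thesis .
    qed
    then have "(\<Sum>f\<in>F. fscale (c f * (qcoeff f n - qcoeff g n)) f) = 0"
      by (simp add: fun_eq_iff sum_fun_apply fscale_def)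
    then have "c f * (qcoeff f n - qcoeff g n) = 0" 
      using insert.IH[OF FN, of "\<lambda>f. c f * (qcoeff f n - qcoeff g n)" f] f by simp
    then show ?thesis using n by simp
  qed
  have "c g = 0"
  proof -
    have "c g * g z = 0" for z using sum0[of z] cF by simp
    then show ?thesis using normalized_eigenformD(2)[OF gN k] by (auto simp: fun_eq_iff)
  qed
  then show ?case using cF insert.prems by auto
qed simp

lemma normalized_eigenforms_independent: "k > 0 \<Longrightarrow> cfun.independent (normalized_eigenforms k)"
  unfolding cfun.dependent_explicit using normalized_eigenforms_relation by blast

text \<open>T_n f(z) is a sum of values of f at points of height n/d^2 times that of z, so each
  summand, after scaling by y^h, is at most M / n^h for M = sup |f| y^h. There are sigma(n) <= n^2
  summands and the prefactor is n^(2h-1), which gives |a_n| M <= n^(h+1) M after passing to the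
  supremum.\<close>

lemma normalized_eigenform_qcoeff_bound:
  assumes f: "f \<in> normalized_eigenforms (2 * h)" and h: "h > 0" and n: "n \<ge> 1"
  shows "cmod (qcoeff f n) \<le> real n ^ (h + 1)"
proof -
  let ?k = "2 * h"
  have k: "?k > 0" using h by simp
  note fD = normalized_eigenformD[OF f k]
  define l where "l = qcoeff f n"
  define S where "S = {cmod (f z) * Im z ^ h | z. Im z > 0}"
  obtain M0 where M0: "\<And>z. Im z > 0 \<Longrightarrow> cmod (f z) * Im z ^ h \<le> M0"
    using cusp_form_height_bounded[OF fD(1)] by metis
  have bdd: "bdd_above S" unfolding S_def by (rule bdd_aboveI[of _ M0]) (use M0 in auto)
  define M where "M = Sup S"
  have M: "cmod (f z) * Im z ^ h \<le> M" if "Im z > 0" for z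
    unfolding M_def by (rule cSup_upper[OF _ bdd]) (use that in \<open>auto simp: S_def\<close>)
  obtain w where w: "f w \<noteq> 0" using fD(2) by (auto simp: fun_eq_iff)
  then have w0: "Im w > 0" using fD(1) by (auto simp: cusp_forms_def)
  then have M_pos: "M > 0" using M[of w] w by (smt (verit) zero_less_mult_iff zero_less_norm_iff zero_less_power)
  have le: "cmod l * (cmod (f z) * Im z ^ h) \<le> real n ^ (h + 1) * M" if z: "Im z > 0" for z
  proof -
    have row: "cmod (f ((of_nat (n div d) * z + of_nat b) / of_nat d) / of_nat d ^ ?k) * Im z ^ h \<le> M / real n ^ h"
      if d: "d dvd n" for d b
    proof -
      define e where "e = n div d"
      have ed: "n = e * d" "d > 0" "e > 0" using d n by (auto simp: e_def elim!: dvdE)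
      let ?w = "(of_nat e * z + of_nat b) / of_nat d"
      have Im: "Im ?w = real e * Im z / real d"
        using ed by (simp add: Im_divide power2_eq_square)
      have "cmod (f ?w) * (real e * Im z / real d) ^ h \<le> M"
        using M[of ?w] ed z unfolding Im by simp
      then have "cmod (f ?w) * (real e * Im z / real d) ^ h / real n ^ h \<le> M / real n ^ h"
        by (intro divide_right_mono) auto
      moreover have "real d ^ (2 * h) = real d ^ h * real d ^ h" by (simp add: mult_2 power_add)
      ultimately show ?thesis
        using ed unfolding e_def[symmetric]
        by (simp add: norm_divide norm_power power_divide power_mult_distrib field_simps)
    qed
    have "cmod l * (cmod (f z) * Im z ^ h) = cmod (hecke ?k n f z) * Im z ^ h"
      using fD(4)[OF n] by (simp add: l_def fscale_def norm_mult)
    also have "cmod (hecke ?k n f z) \<le> real n ^ (?k - 1) *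
        (\<Sum>d | d dvd n. \<Sum>b<d. cmod (f ((of_nat (n div d) * z + of_nat b) / of_nat d) / of_nat d ^ ?k))"
      unfolding hecke_def norm_mult norm_power norm_of_nat
      by (intro mult_left_mono order_trans[OF norm_sum] sum_mono order_trans[OF norm_sum]) auto
    also have "\<dots> * Im z ^ h = real n ^ (?k - 1) *
        (\<Sum>d | d dvd n. \<Sum>b<d. cmod (f ((of_nat (n div d) * z + of_nat b) / of_nat d) / of_nat d ^ ?k) * Im z ^ h)"
      by (simp add: sum_distrib_right mult.assoc)
    also have "\<dots> \<le> real n ^ (?k - 1) * (\<Sum>d | d dvd n. \<Sum>b<d. M / real n ^ h)"
      using row by (intro mult_left_mono sum_mono) auto
    also have "(\<Sum>d | d dvd n. \<Sum>b<d. M / real n ^ h) = real (\<Sum>d | d dvd n. d) * (M / real n ^ h)"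
      by (simp add: sum_distrib_right sum_divide_distrib)
    also have "\<dots> \<le> real n ^ 2 * (M / real n ^ h)"
    proof (rule mult_right_mono)
      have "(\<Sum>d | d dvd n. d) \<le> (\<Sum>d\<in>{1..n}. d)"
        using n by (intro sum_mono2) (auto dest: dvd_imp_le intro!: Suc_leI Nat.gr0I)
      also have "\<dots> \<le> (\<Sum>d\<in>{1..n}. n)" by (intro sum_mono) auto
      finally have "(\<Sum>d | d dvd n. d) \<le> n ^ 2" by (simp add: power2_eq_square)
      then show "real (\<Sum>d | d dvd n. d) \<le> real n ^ 2" by (metis of_nat_le_iff of_nat_power)
    qed (use M_pos in auto)
    also have "real n ^ (?k - 1) * (real n ^ 2 * (M / real n ^ h)) = real n ^ (h + 1) * M"
    proof -
      have "?k - 1 + 2 = (h + 1) + h" using h by simp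
      then have "real n ^ (?k - 1) * real n ^ 2 = real n ^ (h + 1) * real n ^ h"
        by (metis power_add)
      then show ?thesis using n by (simp add: field_simps)
    qed
    finally show ?thesis using z by (simp add: mult_left_mono mult_right_mono)
  qed
  have l0: "cmod l = 0 \<or> cmod l > 0" by auto
  show ?thesis
  proof (cases "l = 0")
    case False
    then have "s \<le> real n ^ (h + 1) * M / cmod l" if "s \<in> S" for s
      using that le by (auto simp: S_def field_simps)
    then have "M \<le> real n ^ (h + 1) * M / cmod l"
      unfolding M_def using w0 by (intro cSup_least) (auto simp: S_def)
    then show ?thesis using M_pos False by (simp add: l_def field_simps)
  qed (simp add: l_def)
qed

section \<open>Eisenstein series and the existence of cusp forms\<close>

abbreviation uhp :: "complex set" where "uhp \<equiv> {z. Im z > 0}"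

abbreviation at_cusp :: "complex filter" where "at_cusp \<equiv> filtercomap Im at_top"

text \<open>Behaviour at the cusp is encoded as a limit for Im z tending to infinity, uniformly in
  Re z. Products and differences then follow from limit rules, and
  \<open>periodic_imp_q_expansion\<close> recovers the expansion when the limit is 0.\<close>

definition mform :: "nat \<Rightarrow> (complex \<Rightarrow> complex) \<Rightarrow> complex \<Rightarrow> bool" where
  "mform k f c \<longleftrightarrow> f holomorphic_on uhp \<and>
     (\<forall>g\<in>SL2Z. \<forall>z. Im z > 0 \<longrightarrow> f (mact g z) = mj g z ^ k * f z) \<and>
     (f \<longlongrightarrow> c) at_cusp"

lemma open_uhp: "open uhp" by (rule open_halfspace_Im_gt)

lemma connected_uhp: "connected uhp" by (intro convex_connected convex_halfspace_Im_gt)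

lemma at_cusp_neq_bot: "at_cusp \<noteq> bot"
proof -
  have "surj Im" by (metis complex.sel(2) surjI)
  then show ?thesis by (auto simp: filtercomap_neq_bot_surj)
qed

lemma mform_mult:
  assumes "mform k f c" "mform l g d"
  shows "mform (k + l) (\<lambda>z. f z * g z) (c * d)"
  using assms unfolding mform_def
  by (auto intro!: holomorphic_intros tendsto_mult simp: power_add)

lemma mform_diff:
  assumes "mform k f c" "mform k g d"
  shows "mform k (\<lambda>z. f z - g z) (c - d)"
  using assms unfolding mform_def
  by (auto intro!: holomorphic_intros tendsto_diff simp: algebra_simps)

lemma mform_cmult:
  assumes "mform k f c"
  shows "mform k (\<lambda>z. a * f z) (a * c)"
  using assms unfolding mform_def
  by (auto intro!: holomorphic_intros tendsto_mult)

section \<open>Fourier expansions of periodic functions\<close>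

lemma periodic_shift:
  fixes f :: "complex \<Rightarrow> complex"
  assumes "\<And>z. Im z > 0 \<Longrightarrow> f (z + 1) = f z" "Im z > 0"
  shows "f (z + of_int n) = f z"
proof -
  have 1: "f (z + of_nat m) = f z" if "Im z > 0" for m z
    using that assms(1)[of "z + of_nat _"] by (induction m) (auto simp: add.assoc[symmetric] add.commute[of 1])
  show ?thesis
  proof (cases "n \<ge> 0")
    case True
    then show ?thesis using 1[OF assms(2), of "nat n"] by simp
  next
    case False
    then show ?thesis using 1[of "z + of_int n" "nat (- n)"] assms(2) by simp
  qed
qed

text \<open>f descends to a function F of q on the punctured disc. The limit at the cusp makes F
  continuous at 0, so the singularity is removable and the Taylor series of F is the
  expansion.\<close>

lemma periodic_imp_q_expansion:
  fixes f :: "complex \<Rightarrow> complex"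
  assumes hol: "f holomorphic_on uhp" and per: "\<And>z. Im z > 0 \<Longrightarrow> f (z + 1) = f z"
    and lim: "(f \<longlongrightarrow> 0) at_cusp"
  shows "\<exists>a. has_q_expansion f a \<and> a 0 = 0"
proof -
  define F where "F q = (if q = 0 then 0 else f (Ln q / (2 * of_real pi * \<i>)))" for q
  have F_exp: "F (exp (2 * of_real pi * \<i> * z)) = f z" if z: "Im z > 0" for z
  proof -
    let ?q = "exp (2 * of_real pi * \<i> * z)"
    have "exp (Ln ?q) = exp (2 * of_real pi * \<i> * z)" by simp
    then obtain n :: int where "Ln ?q = 2 * of_real pi * \<i> * z + of_real (of_int (2 * n) * pi) * \<i>"
      unfolding exp_eq by blast
    then have n: "Ln ?q = 2 * of_real pi * \<i> * z + of_int (2 * n) * of_real pi * \<i>" by simp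
    have "Ln ?q / (2 * of_real pi * \<i>) = z + of_int n" unfolding n by (simp add: field_simps)
    then show ?thesis using periodic_shift[of f z n] per z by (simp add: F_def)
  qed
  have Im_Ln: "Im (Ln q / (2 * of_real pi * \<i>)) = - ln (cmod q) / (2 * pi)" if "q \<noteq> 0" for q
    using that by (simp add: Im_divide power2_eq_square field_simps)
  have open1: "open (ball 0 1 - \<real>\<^sub>\<le>\<^sub>0 :: complex set)" "open (ball 0 1 - \<real>\<^sub>\<ge>\<^sub>0 :: complex set)"
    by (intro open_Diff open_ball closed_nonpos_Reals_complex closed_nonneg_Reals_complex)+
  have hol1: "F holomorphic_on ball 0 1 - \<real>\<^sub>\<le>\<^sub>0"
  proof -
    have "f \<circ> (\<lambda>q. Ln q / (2 * of_real pi * \<i>)) holomorphic_on ball 0 1 - \<real>\<^sub>\<le>\<^sub>0"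
    proof (rule holomorphic_on_compose_gen[OF _ hol])
      show "(\<lambda>q. Ln q / (2 * of_real pi * \<i>)) ` (ball 0 1 - \<real>\<^sub>\<le>\<^sub>0) \<subseteq> uhp"
      proof (intro image_subsetI CollectI)
        fix q :: complex assume q: "q \<in> ball 0 1 - \<real>\<^sub>\<le>\<^sub>0"
        then have "q \<noteq> 0" "cmod q < 1" by auto
        then show "Im (Ln q / (2 * of_real pi * \<i>)) > 0" unfolding Im_Ln[OF \<open>q \<noteq> 0\<close>] by (simp add: divide_neg_pos)
      qed
    qed (auto intro!: holomorphic_intros)
    then show ?thesis by (rule holomorphic_transform) (auto simp: F_def)
  qed
  \<comment> \<open>\<open>Ln\<close> jumps across the negative reals. There the branch
    \<open>Ln (- q) + pi i\<close> is used; by periodicity it defines the same F, and the two slit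
    discs cover the punctured disc.\<close>
  have hol2: "F holomorphic_on ball 0 1 - \<real>\<^sub>\<ge>\<^sub>0"
  proof -
    let ?L = "\<lambda>q. (Ln (- q) + of_real pi * \<i>) / (2 * of_real pi * \<i>)"
    have pos: "Im (?L q) > 0" and exp: "exp (2 * of_real pi * \<i> * ?L q) = q"
      if "q \<in> ball 0 1 - \<real>\<^sub>\<ge>\<^sub>0" for q
    proof -
      have q: "q \<noteq> 0" "cmod q < 1" using that by auto
      have "Im (?L q) = - ln (cmod q) / (2 * pi)"
        using q by (simp add: Im_divide power2_eq_square field_simps)
      then show "Im (?L q) > 0" using q by (simp add: divide_neg_pos)
      have "exp (2 * of_real pi * \<i> * ?L q) = exp (Ln (- q) + of_real pi * \<i>)" by simp
      also have "\<dots> = exp (Ln (- q)) * exp (\<i> * of_real pi)" by (simp only: exp_add mult.commute)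
      also have "\<dots> = q" using q by simp
      finally show "exp (2 * of_real pi * \<i> * ?L q) = q" .
    qed
    have "f \<circ> ?L holomorphic_on ball 0 1 - \<real>\<^sub>\<ge>\<^sub>0"
    proof (rule holomorphic_on_compose_gen[OF _ hol])
      show "?L ` (ball 0 1 - \<real>\<^sub>\<ge>\<^sub>0) \<subseteq> uhp" using pos by blast
      have "- q \<notin> \<real>\<^sub>\<le>\<^sub>0" if "q \<in> ball 0 1 - \<real>\<^sub>\<ge>\<^sub>0" for q :: complex
        using that by (auto simp: complex_nonpos_Reals_iff complex_nonneg_Reals_iff)
      then show "?L holomorphic_on ball 0 1 - \<real>\<^sub>\<ge>\<^sub>0" by (auto intro!: holomorphic_intros)
    qed
    moreover have "(f \<circ> ?L) q = F q" if "q \<in> ball 0 1 - \<real>\<^sub>\<ge>\<^sub>0" for q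
      using F_exp[OF pos[OF that]] unfolding exp[OF that] by simp
    ultimately show ?thesis by (rule holomorphic_transform)
  qed
  have hol': "F holomorphic_on ball 0 1 - {0}"
  proof -
    have "ball 0 1 - {0} = (ball 0 1 - \<real>\<^sub>\<le>\<^sub>0) \<union> (ball 0 1 - \<real>\<^sub>\<ge>\<^sub>0 :: complex set)"
      by (auto simp: complex_nonpos_Reals_iff complex_nonneg_Reals_iff complex_eq_iff)
    then show ?thesis using holomorphic_on_Un[OF hol1 hol2 open1] by simp
  qed
  have F0: "(F \<longlongrightarrow> F 0) (at 0)"
  proof -
    have "filterlim (\<lambda>q :: complex. - ln (cmod q) / (2 * pi)) at_top (at 0)"
    proof -
      have "filterlim (\<lambda>x::real. - ln x / (2 * pi)) at_top (at_right 0)"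
      proof -
        have "filterlim (\<lambda>x::real. - ln x) at_top (at_right 0)"
          using ln_at_0 by (simp add: filterlim_uminus_at_bot)
        then have "filterlim (\<lambda>x::real. (1 / (2 * pi)) * (- ln x)) at_top (at_right 0)"
          by (intro filterlim_tendsto_pos_mult_at_top[OF tendsto_const]) auto
        then show ?thesis by simp
      qed
      moreover have "filterlim (\<lambda>q :: complex. cmod q) (at_right 0) (at 0)"
        unfolding filterlim_at using tendsto_norm_zero[OF tendsto_ident_at]
        by (auto simp: eventually_at_filter)
      ultimately show ?thesis by (rule filterlim_compose)
    qed
    then have "filterlim (\<lambda>q. Im (Ln q / (2 * of_real pi * \<i>))) at_top (at 0)"
      by (rule filterlim_mono_eventually[OF _ order_refl order_refl])
         (auto simp: eventually_at_filter Im_Ln)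
    then have "filterlim (\<lambda>q. Ln q / (2 * of_real pi * \<i>)) at_cusp (at 0)"
      by (simp add: filterlim_filtercomap_iff o_def)
    from filterlim_compose[OF lim this]
    have "((\<lambda>q. f (Ln q / (2 * of_real pi * \<i>))) \<longlongrightarrow> 0) (at 0)" .
    then have "(F \<longlongrightarrow> 0) (at 0)"
      by (rule Lim_transform_eventually) (auto simp: eventually_at_filter F_def)
    then show ?thesis by (simp add: F_def)
  qed
  have "continuous_on (ball 0 1) F"
    unfolding continuous_on_def
  proof
    fix q :: complex assume q: "q \<in> ball 0 1"
    show "(F \<longlongrightarrow> F q) (at q within ball 0 1)"
    proof (cases "q = 0")
      case True
      then show ?thesis using F0 by (auto intro: tendsto_within_subset)
    next
      case False
      have op: "open (ball 0 1 - {0 :: complex})" by (intro open_Diff) auto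
      have "\<forall>x\<in>ball 0 1 - {0}. isCont F x"
        using holomorphic_on_imp_continuous_on[OF hol'] continuous_on_eq_continuous_at[OF op, of F] by blast
      then have "isCont F q" using False q by blast
      then show ?thesis unfolding isCont_def by (rule tendsto_within_subset) auto
    qed
  qed
  then have holF: "F holomorphic_on ball 0 1"
    by (rule no_isolated_singularity[OF _ hol']) auto
  define a where "a n = (deriv ^^ n) F 0 / fact n" for n
  have "has_q_expansion f a"
    unfolding has_q_expansion_def
  proof (intro allI impI)
    fix z assume z: "Im z > 0"
    have "cmod (exp (2 * of_real pi * \<i> * z)) < 1" using z by (simp add: norm_exp_2pi)
    then show "(\<lambda>n. a n * exp (2 * of_real pi * \<i> * z) ^ n) sums f z"
      using holomorphic_power_series[OF holF, of "exp (2 * of_real pi * \<i> * z)"] F_exp[OF z]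
      by (simp add: a_def)
  qed
  moreover have "a 0 = 0" by (simp add: a_def F_def)
  ultimately show ?thesis by blast
qed

lemma mform_mact:
  assumes "mform k f c" "mdet g = 1" "Im z > 0"
  shows "f (mact g z) = mj g z ^ k * f z"
  using assms unfolding mform_def SL2Z_def by blast

lemma mform_periodic: "mform k f c \<Longrightarrow> Im z > 0 \<Longrightarrow> f (z + 1) = f z"
  using mform_mact[of k f c "(1, 1, 0, 1)" z] by simp

lemma mform_cusp_form:
  assumes "mform k f 0"
  shows "(\<lambda>z. if Im z > 0 then f z else 0) \<in> cusp_forms k" (is "?f \<in> _")
proof -
  have hol: "f holomorphic_on uhp" using assms by (simp add: mform_def)
  have "\<exists>a. has_q_expansion f a \<and> a 0 = 0"
    using periodic_imp_q_expansion[OF hol mform_periodic[OF assms]] assms by (auto simp: mform_def)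
  then have "\<exists>a. has_q_expansion ?f a \<and> a 0 = 0" by (simp add: has_q_expansion_def)
  moreover have "?f holomorphic_on uhp" using hol by (rule holomorphic_transform) auto
  moreover have "?f ((of_int a * z + of_int b) / (of_int c * z + of_int d)) = (of_int c * z + of_int d) ^ k * ?f z"
    if "a * d - b * c = 1" "Im z > 0" for a b c d :: int and z
    using mform_mact[OF assms, of "(a, b, c, d)" z] Im_mact_pos[of z "(a, b, c, d)"] that by simp
  ultimately show ?thesis unfolding cusp_forms_def by (auto simp del: split_paired_Ex)
qed

section \<open>Eisenstein series as absolutely convergent lattice sums\<close>

text \<open>A summable majorant in product form: its sum factors into two one-dimensional sums of at
  most 3 each, whence the explicit total 9 that the numerical estimates use.\<close>

definition lattice_weight :: "int \<times> int \<Rightarrow> real" where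
  "lattice_weight = (\<lambda>(c, d). inverse ((1 + \<bar>of_int c\<bar>)\<^sup>2) * inverse ((1 + \<bar>of_int d\<bar>)\<^sup>2))"

definition lattice_pts :: "(int \<times> int) set" where "lattice_pts = - {(0, 0)}"

lemma lattice_weight_nonneg: "lattice_weight p \<ge> 0"
  by (auto simp: lattice_weight_def split: prod.splits)

text \<open>The correction - 2 / (N + 1) makes the induction close by telescoping; at N = 0 there is
  equality.\<close>

lemma sum_inverse_squares_int: "(\<Sum>c\<in>{- int N..int N}. inverse ((1 + \<bar>real_of_int c\<bar>)\<^sup>2)) \<le> 3 - 2 / (real N + 1)"
proof (induction N)
  case (Suc N)
  have "{- int (Suc N)..int (Suc N)} = insert (int N + 1) (insert (- int N - 1) {- int N..int N})" by auto
  then have "(\<Sum>c\<in>{- int (Suc N)..int (Suc N)}. inverse ((1 + \<bar>real_of_int c\<bar>)\<^sup>2)) =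
      2 * inverse ((real N + 2)\<^sup>2) + (\<Sum>c\<in>{- int N..int N}. inverse ((1 + \<bar>real_of_int c\<bar>)\<^sup>2))"
    by simp
  also have "\<dots> \<le> 2 * inverse ((real N + 2)\<^sup>2) + (3 - 2 / (real N + 1))" using Suc by simp
  also have "\<dots> \<le> 3 - 2 / (real (Suc N) + 1)"
  proof -
    have "2 * inverse ((real N + 2)\<^sup>2) \<le> 2 / ((real N + 1) * (real N + 2))"
      using frac_le[of 2 2 "(real N + 1) * (real N + 2)" "(real N + 2)\<^sup>2"]
      by (simp add: power2_eq_square inverse_eq_divide)
    also have "\<dots> = 2 / (real N + 1) - 2 / (real (Suc N) + 1)" by (simp add: field_simps)
    finally show ?thesis by simp
  qed
  finally show ?case .
qed simp

lemma sum_lattice_weight_le: "finite F \<Longrightarrow> sum lattice_weight F \<le> 9"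
proof -
  assume F: "finite F"
  define N where "N = Max (insert 0 ((\<lambda>(c, d). nat \<bar>c\<bar> + nat \<bar>d\<bar>) ` F))"
  let ?I = "{- int N..int N}"
  have "F \<subseteq> ?I \<times> ?I"
  proof
    fix p assume p: "p \<in> F"
    obtain c d where cd: "p = (c, d)" by (cases p)
    have "nat \<bar>c\<bar> + nat \<bar>d\<bar> \<le> N"
      unfolding N_def using F p cd by (intro Max_ge) (auto intro!: image_eqI[where x = p])
    then show "p \<in> ?I \<times> ?I" using cd by auto
  qed
  then have "sum lattice_weight F \<le> sum lattice_weight (?I \<times> ?I)"
    by (intro sum_mono2) (auto simp: lattice_weight_nonneg)
  also have "\<dots> = (\<Sum>c\<in>?I. inverse ((1 + \<bar>real_of_int c\<bar>)\<^sup>2)) * (\<Sum>d\<in>?I. inverse ((1 + \<bar>real_of_int d\<bar>)\<^sup>2))"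
    by (simp add: lattice_weight_def sum_product sum.cartesian_product)
  also have "\<dots> \<le> 3 * 3"
  proof -
    have "(\<Sum>c\<in>?I. inverse ((1 + \<bar>real_of_int c\<bar>)\<^sup>2)) \<le> 3"
      using sum_inverse_squares_int[of N] by (rule order_trans) simp
    then show ?thesis by (intro mult_mono sum_nonneg) auto
  qed
  finally show ?thesis by simp
qed

lemma lattice_weight_summable: "lattice_weight summable_on A"
  by (rule nonneg_bdd_above_summable_on) (auto simp: lattice_weight_nonneg intro!: bdd_aboveI[of _ 9] sum_lattice_weight_le)

lemma infsum_lattice_weight_le: "infsum lattice_weight A \<le> 9"
  by (rule infsum_le_finite_sums[OF lattice_weight_summable]) (auto intro: sum_lattice_weight_le)

text \<open>At nonzero integer points 1, |c|, |d| and 2 |c d| are all at most c^2 + d^2, so (1 +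
  |c|)(1 + |d|) <= 3 (c^2 + d^2); the surplus exponent beyond 2 is dropped because this product is
  at least 1.\<close>

lemma lattice_weight_ge:
  assumes "(c, d) \<in> lattice_pts" "s \<ge> 2"
  shows "inverse ((real_of_int c)\<^sup>2 + (real_of_int d)\<^sup>2) ^ s \<le> 3 ^ s * lattice_weight (c, d)"
proof -
  define x y where "x = \<bar>real_of_int c\<bar>" and "y = \<bar>real_of_int d\<bar>"
  define Q where "Q = (1 + x) * (1 + y)"
  have *: "\<bar>real_of_int i\<bar> \<le> (real_of_int i)\<^sup>2" for i :: int
  proof -
    have "\<bar>i\<bar> * 1 \<le> \<bar>i\<bar> * \<bar>i\<bar>" if "i \<noteq> 0" using that by (intro mult_left_mono) auto
    then have "\<bar>i\<bar> \<le> i\<^sup>2" by (cases "i = 0") (auto simp: power2_eq_square)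
    then show ?thesis by (metis of_int_abs of_int_le_iff of_int_power)
  qed
  have xy: "x \<le> x\<^sup>2" "y \<le> y\<^sup>2" "0 \<le> x" "0 \<le> y" using *[of c] *[of d] by (auto simp: x_def y_def)
  have "c\<^sup>2 + d\<^sup>2 \<ge> 1"
    using assms(1) sum_power2_gt_zero_iff[of c d] by (auto simp: lattice_pts_def)
  then have "real_of_int (c\<^sup>2 + d\<^sup>2) \<ge> 1" by linarith
  then have 1: "x\<^sup>2 + y\<^sup>2 \<ge> 1" by (simp add: x_def y_def)
  have "2 * (x * y) \<le> x\<^sup>2 + y\<^sup>2" using sum_squares_bound[of x y] by simp
  then have Q3: "Q \<le> 3 * (x\<^sup>2 + y\<^sup>2)" using xy 1 by (simp add: Q_def algebra_simps)
  have Q1: "Q \<ge> 1" unfolding Q_def using xy mult_mono[of 1 "1 + x" 1 "1 + y"] by simp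
  have "inverse (x\<^sup>2 + y\<^sup>2) \<le> 3 * inverse Q"
    using Q3 Q1 1 by (simp add: field_simps)
  then have "inverse (x\<^sup>2 + y\<^sup>2) ^ s \<le> (3 * inverse Q) ^ s"
    using 1 by (intro power_mono) auto
  also have "\<dots> = 3 ^ s * inverse Q ^ s" by (simp add: power_mult_distrib)
  also have "\<dots> \<le> 3 ^ s * inverse Q ^ 2"
    using Q1 assms(2) by (intro mult_left_mono power_decreasing) (auto simp: field_simps)
  also have "inverse Q ^ 2 = lattice_weight (c, d)"
    by (simp add: Q_def x_def y_def lattice_weight_def power_mult_distrib flip: power_inverse)
  finally show ?thesis by (simp add: x_def y_def)
qed

text \<open>With z = x + i y, u = c and v = d, the cross term is controlled by v^2 / 2 <= (u x +
  v)^2 + (u x)^2. Multiplied by a small t with t R^2 <= \<eta>^2 / 2, its loss t x^2 u^2 is absorbed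
  by y^2 u^2.\<close>

lemma lattice_norm_ge:
  assumes "\<eta> > 0" "R \<ge> 0"
  obtains \<kappa> where "\<kappa> > 0"
    "\<And>z c d. \<bar>Re z\<bar> \<le> R \<Longrightarrow> Im z \<ge> \<eta> \<Longrightarrow>
       (cmod (of_int c * z + of_int d))\<^sup>2 \<ge> \<kappa> * ((real_of_int c)\<^sup>2 + (real_of_int d)\<^sup>2)"
proof -
  define t where "t = min 1 (\<eta>\<^sup>2 / (2 * (R\<^sup>2 + 1)))"
  have R: "R\<^sup>2 + 1 > 0" by (simp add: add_nonneg_pos)
  have t: "0 < t" "t \<le> 1" "t * R\<^sup>2 \<le> \<eta>\<^sup>2 / 2"
  proof -
    show "0 < t" "t \<le> 1" using assms R by (auto simp: t_def)
    have "t * R\<^sup>2 \<le> \<eta>\<^sup>2 / (2 * (R\<^sup>2 + 1)) * (R\<^sup>2 + 1)"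
      using R \<open>0 < t\<close> by (intro mult_mono) (auto simp: t_def)
    also have "\<dots> = \<eta>\<^sup>2 / 2" using R by (simp add: field_simps)
    finally show "t * R\<^sup>2 \<le> \<eta>\<^sup>2 / 2" .
  qed
  define \<kappa> where "\<kappa> = min (t / 2) (\<eta>\<^sup>2 / 2)"
  have "\<kappa> > 0" using t assms by (simp add: \<kappa>_def)
  moreover have "(cmod (of_int c * z + of_int d))\<^sup>2 \<ge> \<kappa> * ((real_of_int c)\<^sup>2 + (real_of_int d)\<^sup>2)"
    if z: "\<bar>Re z\<bar> \<le> R" "Im z \<ge> \<eta>" for z and c d :: int
  proof -
    define u v where "u = real_of_int c" and "v = real_of_int d"
    have x2: "(Re z)\<^sup>2 \<le> R\<^sup>2" using z(1) assms(2) by (metis abs_of_nonneg abs_le_square_iff)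
    have y2: "\<eta>\<^sup>2 \<le> (Im z)\<^sup>2" using z(2) assms(1) by (intro power_mono) auto
    have "\<kappa> * (u\<^sup>2 + v\<^sup>2) \<le> (\<eta>\<^sup>2 / 2) * u\<^sup>2 + (t / 2) * v\<^sup>2"
      unfolding distrib_left \<kappa>_def by (intro add_mono mult_right_mono) auto
    also have "\<dots> \<le> (\<eta>\<^sup>2 - t * R\<^sup>2) * u\<^sup>2 + (t / 2) * v\<^sup>2"
      using t(3) by (intro add_right_mono mult_right_mono) auto
    also have "\<dots> = \<eta>\<^sup>2 * u\<^sup>2 + t * (v\<^sup>2 / 2 - R\<^sup>2 * u\<^sup>2)" by (simp add: algebra_simps)
    also have "\<dots> \<le> (Im z)\<^sup>2 * u\<^sup>2 + t * (u * Re z + v)\<^sup>2"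
    proof (intro add_mono mult_right_mono mult_left_mono)
      have "v\<^sup>2 / 2 \<le> (u * Re z + v)\<^sup>2 + (u * Re z)\<^sup>2"
        using zero_le_power2[of "2 * (u * Re z) + v"] by (simp add: power2_eq_square algebra_simps)
      moreover have "(u * Re z)\<^sup>2 \<le> R\<^sup>2 * u\<^sup>2"
        using x2 mult_right_mono[of "(Re z)\<^sup>2" "R\<^sup>2" "u\<^sup>2"] by (simp add: power_mult_distrib mult.commute)
      ultimately show "v\<^sup>2 / 2 - R\<^sup>2 * u\<^sup>2 \<le> (u * Re z + v)\<^sup>2" by simp
    qed (use y2 t in auto)
    also have "\<dots> \<le> (Im z)\<^sup>2 * u\<^sup>2 + 1 * (u * Re z + v)\<^sup>2"
      using t by (intro add_left_mono mult_right_mono) auto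
    also have "\<dots> = (cmod (of_int c * z + of_int d))\<^sup>2"
      by (simp add: cmod_power2 u_def v_def power_mult_distrib mult.commute)
    finally show ?thesis by (simp add: u_def v_def)
  qed
  ultimately show ?thesis using that by blast
qed

definition eis_term :: "nat \<Rightarrow> complex \<Rightarrow> int \<times> int \<Rightarrow> complex" where
  "eis_term j z = (\<lambda>(c, d). inverse ((of_int c * z + of_int d) ^ j))"

definition eis :: "nat \<Rightarrow> complex \<Rightarrow> complex" where
  "eis j z = (\<Sum>\<^sub>\<infinity>p\<in>lattice_pts. eis_term j z p)"

text \<open>The row c = 0, that is 2 * zeta(j) for even j >= 2. Its terms do not involve z, so
  \<open>eis_term\<close> is evaluated at 0.\<close>

definition eis_const :: "nat \<Rightarrow> complex" where
  "eis_const j = (\<Sum>\<^sub>\<infinity>p\<in>{0} \<times> (- {0}). eis_term j 0 p)"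

lemma norm_eis_term: "norm (eis_term (2 * s) z (c, d)) = inverse ((cmod (of_int c * z + of_int d))\<^sup>2) ^ s"
  by (simp add: eis_term_def norm_inverse norm_power power_mult power_inverse)

lemma eis_term_bound:
  assumes \<eta>: "\<eta> > 0" and R: "R \<ge> 0" and s: "s \<ge> 2"
  obtains C where "C \<ge> 0"
    "\<And>z p. \<bar>Re z\<bar> \<le> R \<Longrightarrow> Im z \<ge> \<eta> \<Longrightarrow> p \<in> lattice_pts \<Longrightarrow> norm (eis_term (2 * s) z p) \<le> C * lattice_weight p"
proof -
  obtain \<kappa> where \<kappa>: "\<kappa> > 0" "\<And>z c d. \<bar>Re z\<bar> \<le> R \<Longrightarrow> Im z \<ge> \<eta> \<Longrightarrow>
       (cmod (of_int c * z + of_int d))\<^sup>2 \<ge> \<kappa> * ((real_of_int c)\<^sup>2 + (real_of_int d)\<^sup>2)"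
    using lattice_norm_ge[OF \<eta> R] by metis
  define C where "C = inverse \<kappa> ^ s * 3 ^ s"
  have "norm (eis_term (2 * s) z p) \<le> C * lattice_weight p"
    if z: "\<bar>Re z\<bar> \<le> R" "Im z \<ge> \<eta>" and p: "p \<in> lattice_pts" for z p
  proof -
    obtain c d where cd: "p = (c, d)" by (cases p)
    have pos: "(real_of_int c)\<^sup>2 + (real_of_int d)\<^sup>2 > 0"
      using p cd by (auto simp: lattice_pts_def sum_power2_gt_zero_iff)
    have "inverse ((cmod (of_int c * z + of_int d))\<^sup>2) \<le> inverse (\<kappa> * ((real_of_int c)\<^sup>2 + (real_of_int d)\<^sup>2))"
      using \<kappa>(1) \<kappa>(2)[OF z] pos by (intro le_imp_inverse_le) auto
    then have "norm (eis_term (2 * s) z p) \<le> inverse (\<kappa> * ((real_of_int c)\<^sup>2 + (real_of_int d)\<^sup>2)) ^ s"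
      unfolding cd norm_eis_term by (intro power_mono) auto
    also have "\<dots> = inverse \<kappa> ^ s * inverse ((real_of_int c)\<^sup>2 + (real_of_int d)\<^sup>2) ^ s"
      by (simp add: power_mult_distrib)
    also have "\<dots> \<le> inverse \<kappa> ^ s * (3 ^ s * lattice_weight (c, d))"
      using \<kappa>(1) lattice_weight_ge[of c d s] p cd s by (intro mult_left_mono) auto
    finally show ?thesis by (simp add: C_def cd mult.assoc)
  qed
  moreover have "C \<ge> 0" using \<kappa>(1) by (simp add: C_def)
  ultimately show ?thesis using that by blast
qed

lemma eis_term_abs_summable:
  assumes "Im z > 0" "s \<ge> 2" "A \<subseteq> lattice_pts"
  shows "(\<lambda>p. norm (eis_term (2 * s) z p)) summable_on A"
proof -
  obtain C where C: "C \<ge> 0"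
    "\<And>w p. \<bar>Re w\<bar> \<le> \<bar>Re z\<bar> \<Longrightarrow> Im w \<ge> Im z \<Longrightarrow> p \<in> lattice_pts \<Longrightarrow> norm (eis_term (2 * s) w p) \<le> C * lattice_weight p"
    using eis_term_bound[OF assms(1) _ assms(2), of "\<bar>Re z\<bar>"] by auto
  show ?thesis
    by (rule Infinite_Sum.abs_summable_on_comparison_test'[OF summable_on_cmult_right[OF lattice_weight_summable, of C]])
       (use C(2) assms(3) in auto)
qed

lemma eis_holomorphic:
  assumes s: "s \<ge> 2"
  shows "eis (2 * s) holomorphic_on uhp"
proof -
  have "eis (2 * s) field_differentiable at z" if z: "Im z > 0" for z
  proof -
    define r where "r = Im z / 2"
    have r: "r > 0" using z by (simp add: r_def)
    have cb: "Im w \<ge> r" "\<bar>Re w\<bar> \<le> \<bar>Re z\<bar> + r" if "w \<in> cball z r" for w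
    proof -
      have "cmod (w - z) \<le> r" using that by (simp add: dist_norm norm_minus_commute)
      then have "\<bar>Im (w - z)\<bar> \<le> r" "\<bar>Re (w - z)\<bar> \<le> r"
        using abs_Im_le_cmod[of "w - z"] abs_Re_le_cmod[of "w - z"] by linarith+
      then show "Im w \<ge> r" "\<bar>Re w\<bar> \<le> \<bar>Re z\<bar> + r" unfolding r_def minus_complex.sel by linarith+
    qed
    obtain C where C: "C \<ge> 0"
      "\<And>w p. \<bar>Re w\<bar> \<le> \<bar>Re z\<bar> + r \<Longrightarrow> Im w \<ge> r \<Longrightarrow> p \<in> lattice_pts \<Longrightarrow> norm (eis_term (2 * s) w p) \<le> C * lattice_weight p"
      using eis_term_bound[OF r _ s, of "\<bar>Re z\<bar> + r"] r by auto
    have unif: "uniform_limit (cball z r) (\<lambda>F w. \<Sum>p\<in>F. eis_term (2 * s) w p) (\<lambda>w. \<Sum>\<^sub>\<infinity>p\<in>lattice_pts. eis_term (2 * s) w p)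
        (finite_subsets_at_top lattice_pts)"
      by (rule Weierstrass_m_test_general[OF _ summable_on_cmult_right[OF lattice_weight_summable, of C]])
         (use C cb in auto)
    have nz: "of_int c * w + of_int d \<noteq> 0" if "(c, d) \<in> lattice_pts" "Im w > 0" for c d :: int and w
    proof
      assume "of_int c * w + of_int d = 0"
      then have "Im (of_int c * w + of_int d) = 0" "Re (of_int c * w + of_int d) = 0" by auto
      then show False using that by (auto simp: lattice_pts_def)
    qed
    have hol: "(\<lambda>w. \<Sum>p\<in>F. eis_term (2 * s) w p) holomorphic_on cball z r"
      if "F \<subseteq> lattice_pts" for F
    proof (intro holomorphic_on_sum)
      fix p assume p: "p \<in> F"
      obtain c d where cd: "p = (c, d)" by (cases p)
      have "of_int c * w + of_int d \<noteq> 0" if "w \<in> cball z r" for w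
        using nz[of c d w] p cd \<open>F \<subseteq> lattice_pts\<close> cb(1)[OF that] r by auto
      then show "(\<lambda>w. eis_term (2 * s) w p) holomorphic_on cball z r"
        unfolding cd eis_term_def prod.case by (intro holomorphic_intros) auto
    qed
    have ev: "\<forall>\<^sub>F F in finite_subsets_at_top lattice_pts.
        continuous_on (cball z r) (\<lambda>w. \<Sum>p\<in>F. eis_term (2 * s) w p) \<and>
        (\<lambda>w. \<Sum>p\<in>F. eis_term (2 * s) w p) holomorphic_on ball z r"
      using hol holomorphic_on_imp_continuous_on holomorphic_on_subset[OF _ ball_subset_cball]
      by (intro eventually_finite_subsets_at_top_weakI) blast
    have "(\<lambda>w. \<Sum>\<^sub>\<infinity>p\<in>lattice_pts. eis_term (2 * s) w p) holomorphic_on ball z r"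
      by (rule holomorphic_uniform_limit[OF ev unif]) auto
    then have "eis (2 * s) holomorphic_on ball z r" by (simp add: eis_def[abs_def])
    then show ?thesis using r by (auto intro: holomorphic_on_imp_differentiable_at[of _ "ball z r"])
  qed
  then show ?thesis by (auto simp: holomorphic_on_def intro: field_differentiable_at_within)
qed

text \<open>The row vectors (m, n) are permuted by right multiplication with g, the inverse
  permutation \<open>\<tau>\<close> being multiplication by the adjugate; the automorphy factor
  comes out of each term.\<close>

lemma eis_mact:
  assumes g: "g \<in> SL2Z" and z: "Im z > 0"
  shows "eis j (mact g z) = mj g z ^ j * eis j z"
proof -
  obtain a b c d where gs: "g = (a, b, c, d)" by (cases g)
  have det: "a * d - b * c = 1" using g gs by (simp add: SL2Z_def)
  have nz: "mj g z \<noteq> 0" using g z by (intro mj_nonzero) (auto simp: SL2Z_def)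
  define \<sigma> where "\<sigma> = (\<lambda>(m :: int, n :: int). (m * a + n * c, m * b + n * d))"
  define \<tau> where "\<tau> = (\<lambda>(m :: int, n :: int). (m * d - n * c, n * a - m * b))"
  have inv1: "\<tau> (\<sigma> p) = p" for p
  proof (cases p)
    case (Pair m n)
    have "(m * a + n * c) * d - (m * b + n * d) * c = m * (a * d - b * c)"
      "(m * b + n * d) * a - (m * a + n * c) * b = n * (a * d - b * c)" by (simp_all add: algebra_simps)
    then show ?thesis using Pair det by (simp add: \<sigma>_def \<tau>_def)
  qed
  have inv2: "\<sigma> (\<tau> p) = p" for p
  proof (cases p)
    case (Pair m n)
    have "(m * d - n * c) * a + (n * a - m * b) * c = m * (a * d - b * c)"
      "(m * d - n * c) * b + (n * a - m * b) * d = n * (a * d - b * c)" by (simp_all add: algebra_simps)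
    then show ?thesis using Pair det by (simp add: \<sigma>_def \<tau>_def)
  qed
  have "\<sigma> (0, 0) = (0, 0)" "\<tau> (0, 0) = (0, 0)" by (simp_all add: \<sigma>_def \<tau>_def)
  then have bij: "bij_betw \<sigma> lattice_pts lattice_pts"
    using inv1 inv2 unfolding lattice_pts_def by (intro bij_betw_byWitness[where f' = \<tau>]) force+
  have tm: "eis_term j (mact g z) p = mj g z ^ j * eis_term j z (\<sigma> p)" for p
  proof (cases p)
    case (Pair m n)
    have "of_int m * mact g z + of_int n = (of_int (m * a + n * c) * z + of_int (m * b + n * d)) / mj g z"
      using nz gs by (simp add: field_simps)
    then show ?thesis using nz Pair by (simp add: eis_term_def \<sigma>_def power_divide inverse_eq_divide)
  qed
  have "eis j (mact g z) = infsum (\<lambda>p. mj g z ^ j * eis_term j z (\<sigma> p)) lattice_pts"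
    unfolding eis_def by (intro infsum_cong tm)
  also have "\<dots> = mj g z ^ j * infsum (\<lambda>p. eis_term j z (\<sigma> p)) lattice_pts" by (rule infsum_cmult_right')
  also have "infsum (\<lambda>p. eis_term j z (\<sigma> p)) lattice_pts = eis j z"
    unfolding eis_def by (rule infsum_reindex_bij_betw[OF bij])
  finally show ?thesis .
qed

text \<open>Off the row c = 0 one factor |c z + d|^-2 is at most y^-2. The remaining exponent 2 (s -
  1) must be at least 4 for the majorant to apply, hence s >= 3. The estimate is made on |Re z| <=
  1/2 and spread by periodicity.\<close>

lemma eis_near_cusp:
  assumes s: "s \<ge> 3"
  obtains C where "C \<ge> 0" "\<And>z. Im z \<ge> 1 \<Longrightarrow> cmod (eis (2 * s) z - eis_const (2 * s)) \<le> C / (Im z)\<^sup>2"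
proof -
  define t where "t = s - 1"
  have t: "t \<ge> 2" "s = Suc t" using s by (auto simp: t_def)
  obtain C where C: "C \<ge> 0"
    "\<And>z p. \<bar>Re z\<bar> \<le> 1 / 2 \<Longrightarrow> Im z \<ge> 1 \<Longrightarrow> p \<in> lattice_pts \<Longrightarrow> norm (eis_term (2 * t) z p) \<le> C * lattice_weight p"
    using eis_term_bound[OF _ _ t(1), of 1 "1/2"] by auto
  define A B where "A = {0 :: int} \<times> (- {0 :: int})" and "B = (- {0 :: int}) \<times> (UNIV :: int set)"
  have AB: "lattice_pts = A \<union> B" "A \<inter> B = {}" by (auto simp: lattice_pts_def A_def B_def)
  have main: "cmod (eis (2 * s) z - eis_const (2 * s)) \<le> 9 * C / (Im z)\<^sup>2"
    if z: "\<bar>Re z\<bar> \<le> 1 / 2" "Im z \<ge> 1" for z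
  proof -
    have sm: "(\<lambda>p. norm (eis_term (2 * s) z p)) summable_on A" "(\<lambda>p. norm (eis_term (2 * s) z p)) summable_on B"
      using AB z s by (auto intro!: eis_term_abs_summable)
    have "eis (2 * s) z = infsum (eis_term (2 * s) z) A + infsum (eis_term (2 * s) z) B"
      unfolding eis_def AB(1) by (rule infsum_Un_disjoint[OF abs_summable_summable[OF sm(1)] abs_summable_summable[OF sm(2)] AB(2)])
    moreover have "infsum (eis_term (2 * s) z) A = eis_const (2 * s)"
      unfolding eis_const_def A_def[symmetric] by (intro infsum_cong) (auto simp: A_def eis_term_def)
    ultimately have "cmod (eis (2 * s) z - eis_const (2 * s)) = norm (infsum (eis_term (2 * s) z) B)" by simp
    also have "\<dots> \<le> infsum (\<lambda>p. norm (eis_term (2 * s) z p)) B" by (rule norm_infsum_bound[OF sm(2)])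
    also have "\<dots> \<le> infsum (\<lambda>p. C / (Im z)\<^sup>2 * lattice_weight p) B"
    proof (intro infsum_mono sm(2) summable_on_cmult_right lattice_weight_summable)
      fix p assume p: "p \<in> B"
      obtain c d where cd: "p = (c, d)" by (cases p)
      have c: "c \<noteq> 0" using p cd by (auto simp: B_def)
      have "1 * Im z \<le> \<bar>of_int c\<bar> * Im z" using c z by (intro mult_right_mono) auto
      also have "\<dots> = \<bar>Im (of_int c * z + of_int d)\<bar>" using z by (simp add: abs_mult)
      also have "\<dots> \<le> cmod (of_int c * z + of_int d)" by (rule abs_Im_le_cmod)
      finally have "(Im z)\<^sup>2 \<le> (cmod (of_int c * z + of_int d))\<^sup>2" using z by (intro power_mono) auto
      then have 1: "inverse ((cmod (of_int c * z + of_int d))\<^sup>2) \<le> inverse ((Im z)\<^sup>2)"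
        using z by (intro le_imp_inverse_le) auto
      have "norm (eis_term (2 * s) z p) = inverse ((cmod (of_int c * z + of_int d))\<^sup>2) * norm (eis_term (2 * t) z p)"
        unfolding cd norm_eis_term t(2) by simp
      also have "\<dots> \<le> inverse ((Im z)\<^sup>2) * (C * lattice_weight p)"
        using 1 C(2)[OF z, of p] p AB by (intro mult_mono) auto
      finally show "norm (eis_term (2 * s) z p) \<le> C / (Im z)\<^sup>2 * lattice_weight p" by (simp add: field_simps)
    qed
    also have "\<dots> = C / (Im z)\<^sup>2 * infsum lattice_weight B" by (rule infsum_cmult_right')
    also have "\<dots> \<le> C / (Im z)\<^sup>2 * 9"
      using C(1) by (intro mult_left_mono infsum_lattice_weight_le) auto
    finally show ?thesis by (simp add: mult.commute)
  qed
  have "cmod (eis (2 * s) z - eis_const (2 * s)) \<le> 9 * C / (Im z)\<^sup>2" if z: "Im z \<ge> 1" for z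
  proof -
    define n where "n = round (Re z)"
    have per: "eis (2 * s) (w + 1) = eis (2 * s) w" if "Im w > 0" for w
      using eis_mact[of "(1, 1, 0, 1)" w "2 * s"] that by (simp add: SL2Z_def)
    have "eis (2 * s) (z + of_int (- n)) = eis (2 * s) z"
      by (rule periodic_shift) (use z per in auto)
    moreover have "\<bar>Re (z + of_int (- n))\<bar> \<le> 1 / 2"
      using of_int_round_abs_le[of "Re z"] by (simp add: n_def abs_minus_commute)
    ultimately show ?thesis using main[of "z + of_int (- n)"] z by simp
  qed
  then show ?thesis using that[of "9 * C"] C(1) by simp
qed

lemma eis_mform:
  assumes s: "s \<ge> 3"
  shows "mform (2 * s) (eis (2 * s)) (eis_const (2 * s))"
proof -
  obtain C where C: "C \<ge> 0" "\<And>z. Im z \<ge> 1 \<Longrightarrow> cmod (eis (2 * s) z - eis_const (2 * s)) \<le> C / (Im z)\<^sup>2"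
    using eis_near_cusp[OF s] by metis
  have "((\<lambda>y. C / y\<^sup>2) \<longlongrightarrow> 0) (at_top :: real filter)"
    by (intro tendsto_divide_0[OF tendsto_const] filterlim_at_top_imp_at_infinity filterlim_pow_at_top filterlim_ident) auto
  then have "((\<lambda>z. C / (Im z)\<^sup>2) \<longlongrightarrow> 0) at_cusp"
    by (rule filterlim_compose[OF _ filterlim_filtercomap])
  then have "((\<lambda>z. eis (2 * s) z - eis_const (2 * s)) \<longlongrightarrow> 0) at_cusp"
    by (rule Lim_null_comparison[rotated]) (use C(2) in \<open>auto simp: eventually_filtercomap_at_top_linorder\<close>)
  then have "(eis (2 * s) \<longlongrightarrow> eis_const (2 * s)) at_cusp" by (rule Lim_null[THEN iffD2])
  then show ?thesis unfolding mform_def using eis_holomorphic[of s] eis_mact s by auto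
qed


section \<open>Eisenstein values at i and at the cusp\<close>

text \<open>Of the s factors 1 / (c^2 + d^2) <= 1/2 all but two give the power of 1/2; the last two
  are at most 9 times the lattice weight, whose total is at most 9.\<close>

lemma lattice_tail_small:
  fixes f :: "int \<times> int \<Rightarrow> complex"
  assumes s: "s \<ge> 2" and A: "\<And>c d. (c, d) \<in> A \<Longrightarrow> c\<^sup>2 + d\<^sup>2 \<ge> 2"
    and f: "\<And>c d. (c, d) \<in> A \<Longrightarrow> norm (f (c, d)) \<le> inverse ((real_of_int c)\<^sup>2 + (real_of_int d)\<^sup>2) ^ s"
  shows "(\<lambda>p. norm (f p)) summable_on A" "norm (infsum f A) \<le> 81 * (1 / 2) ^ (s - 2)"
proof -
  have le: "norm (f p) \<le> (1 / 2) ^ (s - 2) * 9 * lattice_weight p" if "p \<in> A" for p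
  proof -
    obtain c d where cd: "p = (c, d)" by (cases p)
    define Q where "Q = (real_of_int c)\<^sup>2 + (real_of_int d)\<^sup>2"
    have "c\<^sup>2 + d\<^sup>2 \<ge> 2" using A that cd by simp
    then have "real_of_int (c\<^sup>2 + d\<^sup>2) \<ge> 2" by linarith
    then have Q: "Q \<ge> 2" by (simp add: Q_def)
    have "norm (f p) \<le> inverse Q ^ s" using f that cd by (simp add: Q_def)
    also have "\<dots> = inverse Q ^ (s - 2) * inverse Q ^ 2" using s by (metis le_add_diff_inverse2 power_add)
    also have "\<dots> \<le> (1 / 2) ^ (s - 2) * (3 ^ 2 * lattice_weight (c, d))"
    proof (intro mult_mono power_mono)
      show "inverse Q \<le> 1 / 2" using Q by (simp add: field_simps)
      have "(c, d) \<in> lattice_pts" using A[of c d] that cd by (auto simp: lattice_pts_def)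
      then show "inverse Q ^ 2 \<le> 3 ^ 2 * lattice_weight (c, d)"
        unfolding Q_def by (rule lattice_weight_ge) simp
    qed (use Q in auto)
    finally show ?thesis by (simp add: cd)
  qed
  have sm: "(\<lambda>p. (1 / 2) ^ (s - 2) * 9 * lattice_weight p) summable_on A"
    by (rule summable_on_cmult_right[OF lattice_weight_summable])
  show abs: "(\<lambda>p. norm (f p)) summable_on A" by (rule Infinite_Sum.abs_summable_on_comparison_test'[OF sm le])
  have "norm (infsum f A) \<le> infsum (\<lambda>p. norm (f p)) A" by (rule norm_infsum_bound[OF abs])
  also have "\<dots> \<le> infsum (\<lambda>p. (1 / 2) ^ (s - 2) * 9 * lattice_weight p) A"
    using le by (intro infsum_mono abs sm)
  also have "\<dots> = (1 / 2) ^ (s - 2) * 9 * infsum lattice_weight A" by (rule infsum_cmult_right')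
  also have "\<dots> \<le> (1 / 2) ^ (s - 2) * 9 * 9" by (intro mult_left_mono infsum_lattice_weight_le) auto
  finally show "norm (infsum f A) \<le> 81 * (1 / 2) ^ (s - 2)" by simp
qed

lemma int_sum_squares_ge_2:
  fixes c d :: int
  assumes "(c, d) \<noteq> (0, 0)" "(c, d) \<notin> {(1, 0), (-1, 0), (0, 1), (0, -1)}"
  shows "c\<^sup>2 + d\<^sup>2 \<ge> 2"
proof (rule ccontr)
  assume "\<not> c\<^sup>2 + d\<^sup>2 \<ge> 2"
  then have *: "c\<^sup>2 \<le> 1" "d\<^sup>2 \<le> 1" "c\<^sup>2 + d\<^sup>2 \<le> 1"
    using zero_le_power2[of c] zero_le_power2[of d] by linarith+
  then have "\<bar>c\<bar> \<le> 1" "\<bar>d\<bar> \<le> 1" by (auto simp: abs_square_le_1)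
  then have "c \<in> {-1, 0, 1}" "d \<in> {-1, 0, 1}" by auto
  then show False using assms *(3) by auto
qed

text \<open>The leading 4 comes from the shortest vectors, the units of Z[i]; since s is even, all
  four have 2s-th power 1 and add up instead of cancelling.\<close>

lemma eis_at_i:
  assumes s: "s \<ge> 2" "even s"
  shows "cmod (eis (2 * s) \<i> - 4) \<le> 81 * (1 / 2) ^ (s - 2)"
proof -
  define P :: "(int \<times> int) set" where "P = {(1, 0), (-1, 0), (0, 1), (0, -1)}"
  define A where "A = lattice_pts - P"
  have lat: "lattice_pts = P \<union> A" "P \<inter> A = {}" by (auto simp: A_def P_def lattice_pts_def)
  have A2: "c\<^sup>2 + d\<^sup>2 \<ge> 2" if "(c, d) \<in> A" for c d
    using that by (intro int_sum_squares_ge_2) (auto simp: A_def P_def lattice_pts_def)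
  have nt: "norm (eis_term (2 * s) \<i> (c, d)) \<le> inverse ((real_of_int c)\<^sup>2 + (real_of_int d)\<^sup>2) ^ s" for c d
    unfolding norm_eis_term by (simp add: cmod_power2 add.commute)
  note tail = lattice_tail_small[of s A "eis_term (2 * s) \<i>", OF s(1) A2 nt]
  have "eis (2 * s) \<i> = infsum (eis_term (2 * s) \<i>) P + infsum (eis_term (2 * s) \<i>) A"
    unfolding eis_def lat(1)
    by (intro infsum_Un_disjoint lat(2) abs_summable_summable[OF tail(1)] summable_on_finite) (auto simp: P_def)
  also have "infsum (eis_term (2 * s) \<i>) P = sum (eis_term (2 * s) \<i>) P"
    by (intro infsum_finite) (auto simp: P_def)
  also have "\<dots> = 4" using s(2) by (simp add: P_def eis_term_def power_mult)
  finally show ?thesis using tail(2) by simp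
qed

lemma eis_const_approx:
  assumes s: "s \<ge> 2"
  shows "cmod (eis_const (2 * s) - 2) \<le> 81 * (1 / 2) ^ (s - 2)"
proof -
  define P :: "(int \<times> int) set" where "P = {(0, 1), (0, -1)}"
  define A where "A = {0} \<times> (- {0}) - P"
  have lat: "{0} \<times> (- {0}) = P \<union> A" "P \<inter> A = {}" by (auto simp: A_def P_def)
  have A2: "c\<^sup>2 + d\<^sup>2 \<ge> 2" if "(c, d) \<in> A" for c d
    using that by (intro int_sum_squares_ge_2) (auto simp: A_def P_def)
  have nt: "norm (eis_term (2 * s) 0 (c, d)) \<le> inverse ((real_of_int c)\<^sup>2 + (real_of_int d)\<^sup>2) ^ s"
    if "(c, d) \<in> A" for c d
    using that unfolding norm_eis_term by (simp add: A_def)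
  note tail = lattice_tail_small[of s A "eis_term (2 * s) 0", OF s A2 nt]
  have "eis_const (2 * s) = infsum (eis_term (2 * s) 0) P + infsum (eis_term (2 * s) 0) A"
    unfolding eis_const_def lat(1)
    by (intro infsum_Un_disjoint lat(2) abs_summable_summable[OF tail(1)] summable_on_finite) (auto simp: P_def)
  also have "infsum (eis_term (2 * s) 0) P = sum (eis_term (2 * s) 0) P"
    by (intro infsum_finite) (auto simp: P_def)
  also have "\<dots> = 2" by (simp add: P_def eis_term_def power_mult)
  finally show ?thesis using tail(2) by simp
qed

lemma eis_const_nonzero:
  assumes "s \<ge> 10"
  shows "eis_const (2 * s) \<noteq> 0"
proof
  assume "eis_const (2 * s) = 0"
  then have "2 \<le> 81 * (1 / 2 :: real) ^ (s - 2)" using eis_const_approx[of s] assms by simp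
  also have "\<dots> \<le> 81 * (1 / 2) ^ 8" using assms by (intro mult_left_mono power_decreasing) auto
  finally show False by (simp add: power_divide)
qed

text \<open>The weight 80 cusp form \<open>E\<^sub>4\<^sub>0\<^sup>2 - E\<^sub>8\<^sub>0\<close> (up to scaling); at \<open>i\<close> all four leading terms
  \<open>(\<plusminus>1)\<^sup>-\<^sup>4\<^sup>0, (\<plusminus>i)\<^sup>-\<^sup>4\<^sup>0\<close> have the same sign, so its value there is close to \<open>16 - 8\<close>.\<close>

lemma cusp_form_weight_80:
  obtains u where "mform 80 u 0" "u \<i> \<noteq> 0"
proof -
  define c where "c = eis_const 40 * eis_const 40 / eis_const 80"
  define u where "u z = eis 40 z * eis 40 z - c * eis 80 z" for z
  have m40: "mform 40 (eis 40) (eis_const 40)" and m80: "mform 80 (eis 80) (eis_const 80)"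
    using eis_mform[of 20] eis_mform[of 40] by simp_all
  have c40: "cmod (eis_const 40 - 2) \<le> 1 / 1000" and c80: "cmod (eis_const 80 - 2) \<le> 1 / 1000"
    using eis_const_approx[of 20] eis_const_approx[of 40] by (simp_all add: power_divide)
  have e40: "cmod (eis 40 \<i> - 4) \<le> 1 / 1000" and e80: "cmod (eis 80 \<i> - 4) \<le> 1 / 1000"
    using eis_at_i[of 20] eis_at_i[of 40] by (simp_all add: power_divide)
  have nz: "eis_const 80 \<noteq> 0" using eis_const_nonzero[of 40] by simp
  have "mform (40 + 40) u (eis_const 40 * eis_const 40 - c * eis_const 80)"
    unfolding u_def[abs_def] using mform_diff[OF mform_mult[OF m40 m40], of "\<lambda>z. c * eis 80 z" "c * eis_const 80"]
      mform_cmult[OF m80, of c] by simp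
  then have "mform 80 u 0" using nz by (simp add: c_def)
  moreover have "u \<i> \<noteq> 0"
  proof
    assume "u \<i> = 0"
    then have "eis 40 \<i> * eis 40 \<i> * eis_const 80 = eis_const 40 * eis_const 40 * eis 80 \<i>"
      using nz by (simp add: u_def c_def field_simps)
    then have "cmod (eis 40 \<i>) * cmod (eis 40 \<i>) * cmod (eis_const 80) = cmod (eis_const 40) * cmod (eis_const 40) * cmod (eis 80 \<i>)"
      by (metis norm_mult)
    \<comment> \<open>The ideal values of the two sides are 4 * 4 * 2 = 32 and 2 * 2 * 4 = 16; the
      crude bounds 17.1 and about 16.02 already separate them.\<close>
    moreover have "3 * 3 * (19/10) \<le> cmod (eis 40 \<i>) * cmod (eis 40 \<i>) * cmod (eis_const 80)"
    proof (intro mult_mono)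
      show "3 \<le> cmod (eis 40 \<i>)" using norm_triangle_ineq2[of 4 "4 - eis 40 \<i>"] e40 by (simp add: norm_minus_commute)
      then show "3 \<le> cmod (eis 40 \<i>)" .
      show "19/10 \<le> cmod (eis_const 80)" using norm_triangle_ineq2[of 2 "2 - eis_const 80"] c80 by (simp add: norm_minus_commute)
    qed auto
    moreover have "cmod (eis_const 40) * cmod (eis_const 40) * cmod (eis 80 \<i>) \<le> (2001/1000) * (2001/1000) * (4001/1000)"
    proof (intro mult_mono)
      show "cmod (eis_const 40) \<le> 2001/1000" using norm_triangle_ineq2[of "eis_const 40" 2] c40 by simp
      then show "cmod (eis_const 40) \<le> 2001/1000" .
      show "cmod (eis 80 \<i>) \<le> 4001/1000" using norm_triangle_ineq2[of "eis 80 \<i>" 4] e80 by simp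
    qed auto
    ultimately show False by simp
  qed
  ultimately show ?thesis using that by blast
qed

section \<open>Two independent cusp forms\<close>

lemma uhp_zero_product:
  assumes f: "f holomorphic_on uhp" and g: "g holomorphic_on uhp" and "Im w > 0" "f w \<noteq> 0"
    and fg: "\<And>z. Im z > 0 \<Longrightarrow> f z * g z = 0" and z: "Im z > 0"
  shows "g z = 0"
proof -
  define S where "S = uhp \<inter> f -` (- {0})"
  have "open S"
    unfolding S_def by (intro continuous_open_preimage[OF holomorphic_on_imp_continuous_on[OF f] open_uhp]) auto
  moreover have "w \<in> S" using assms by (simp add: S_def)
  ultimately show ?thesis
    using fg z by (intro analytic_continuation_open[of S uhp g "\<lambda>_. 0" z] open_uhp connected_uhp g) (auto simp: S_def)
qed

text \<open>The forms u E and u^2 E' vanish to different orders at the cusp. Cancelling u from a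
  relation \<alpha> u E = \<beta> u^2 E' and letting Im z tend to infinity leaves \<alpha> times the
  nonzero constant of E. The condition h >= 90 gives E' weight 2 (h - 80) >= 20, the range of
  \<open>eis_const_nonzero\<close>.\<close>

lemma dim_cusp_forms_ge_2:
  assumes h: "h \<ge> 90"
  shows "cfun.dim (cusp_forms (2 * h)) \<ge> 2"
proof -
  obtain u where u: "mform 80 u 0" "u \<i> \<noteq> 0" using cusp_form_weight_80 by metis
  define e1 e2 where "e1 = eis (2 * (h - 40))" and "e2 = eis (2 * (h - 80))"
  define c1 c2 where "c1 = eis_const (2 * (h - 40))" and "c2 = eis_const (2 * (h - 80))"
  have m1: "mform (2 * (h - 40)) e1 c1" and m2: "mform (2 * (h - 80)) e2 c2"
    unfolding e1_def e2_def c1_def c2_def using h by (auto intro!: eis_mform)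
  have c1: "c1 \<noteq> 0" unfolding c1_def using h by (intro eis_const_nonzero) auto
  have hu: "u holomorphic_on uhp" and h1: "e1 holomorphic_on uhp" and h2: "e2 holomorphic_on uhp"
    using u m1 m2 by (auto simp: mform_def)
  have lim: "(u \<longlongrightarrow> 0) at_cusp" "(e1 \<longlongrightarrow> c1) at_cusp" "(e2 \<longlongrightarrow> c2) at_cusp"
    using u m1 m2 by (auto simp: mform_def)
  have ev: "eventually (\<lambda>z. Im z > 0) at_cusp"
    unfolding eventually_filtercomap_at_top_linorder by (rule exI[of _ 1]) auto
  define F1 where "F1 z = (if Im z > 0 then u z * e1 z else 0)" for z
  define F2 where "F2 z = (if Im z > 0 then u z * (u z * e2 z) else 0)" for z
  have F1: "F1 \<in> cusp_forms (2 * h)"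
  proof -
    have "80 + 2 * (h - 40) = 2 * h" using h by simp
    then show ?thesis
      unfolding F1_def[abs_def] using mform_mult[OF u(1) m1] by (intro mform_cusp_form) (simp only: mult_zero_left)
  qed
  have F2: "F2 \<in> cusp_forms (2 * h)"
  proof -
    have "80 + (80 + 2 * (h - 80)) = 2 * h" using h by simp
    then show ?thesis
      unfolding F2_def[abs_def] using mform_mult[OF u(1) mform_mult[OF u(1) m2]]
      by (intro mform_cusp_form) (simp only: mult_zero_left)
  qed
  have key: "\<alpha> = 0" if "\<And>z. \<alpha> * F1 z = \<beta> * F2 z" for \<alpha> \<beta>
  proof -
    have "\<alpha> * e1 z - \<beta> * (u z * e2 z) = 0" if z: "Im z > 0" for z
    proof (rule uhp_zero_product[OF hu _ _ u(2) _ z])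
      show "(\<lambda>z. \<alpha> * e1 z - \<beta> * (u z * e2 z)) holomorphic_on uhp"
        by (intro holomorphic_intros hu h1 h2)
      show "u z * (\<alpha> * e1 z - \<beta> * (u z * e2 z)) = 0" if "Im z > 0" for z
        using \<open>\<And>z. \<alpha> * F1 z = \<beta> * F2 z\<close>[of z] that by (simp add: F1_def F2_def algebra_simps)
    qed simp
    then have "eventually (\<lambda>z. \<alpha> * e1 z - \<beta> * (u z * e2 z) = 0) at_cusp"
      using ev by (auto elim: eventually_mono)
    then have "((\<lambda>z. \<alpha> * e1 z - \<beta> * (u z * e2 z)) \<longlongrightarrow> 0) at_cusp" by (rule tendsto_eventually)
    moreover have "((\<lambda>z. \<alpha> * e1 z - \<beta> * (u z * e2 z)) \<longlongrightarrow> \<alpha> * c1 - \<beta> * (0 * c2)) at_cusp"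
      by (intro tendsto_intros lim)
    ultimately have "\<alpha> * c1 - \<beta> * (0 * c2) = 0" using at_cusp_neq_bot by (metis tendsto_unique)
    then show ?thesis using c1 by simp
  qed
  have c2: "c2 \<noteq> 0" unfolding c2_def using h by (intro eis_const_nonzero) auto
  have "F2 \<noteq> 0"
  proof
    assume 0: "F2 = 0"
    have "e2 z = 0" if z: "Im z > 0" for z
    proof (rule uhp_zero_product[OF _ h2 _ _ _ z])
      show "(\<lambda>z. u z * u z) holomorphic_on uhp" by (intro holomorphic_intros hu)
      show "u z * u z * e2 z = 0" if "Im z > 0" for z
        using fun_cong[OF 0, of z] that by (simp add: F2_def)
    qed (use u(2) in auto)
    then have "eventually (\<lambda>z. e2 z = 0) at_cusp" using ev by (auto elim: eventually_mono)
    then have "(e2 \<longlongrightarrow> 0) at_cusp" by (rule tendsto_eventually)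
    then show False using lim(3) c2 at_cusp_neq_bot by (metis tendsto_unique)
  qed
  have F1_span: "F1 \<notin> cfun.span {F2}"
  proof
    assume "F1 \<in> cfun.span {F2}"
    then obtain b where "F1 = fscale b F2" by (auto simp: cfun.span_singleton)
    then have "1 * F1 z = b * F2 z" for z by (simp add: fscale_def)
    then show False using key[of 1 b] by simp
  qed
  then have "F1 \<noteq> F2" using cfun.span_base[of F2 "{F2}"] by auto
  have "cfun.independent {F1, F2}"
    using \<open>F2 \<noteq> 0\<close> F1_span \<open>F1 \<noteq> F2\<close> by (simp add: cfun.independent_insert)
  then have "card {F1, F2} \<le> cfun.dim (cusp_forms (2 * h))"
    using independent_card_le_dim_cusp_forms F1 F2 by blast
  then show ?thesis using \<open>F1 \<noteq> F2\<close> by simp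
qed

section \<open>Hecke eigenvalues are real\<close>

text \<open>Instead of integrating over a fundamental domain, the Petersson product is written with the
  region \<open>B\<close>, which meets every orbit, weighted by the number \<open>W\<close> of translates in \<open>B\<close>.
  Unfolding both weights turns \<open>\<langle>T\<^sub>n f, f\<rangle>\<close> into a sum over all integer matrices of
  determinant \<open>n\<close>, which is visibly symmetric under the adjugate.\<close>

definition siegel_set :: "complex set" where
  "siegel_set = {z. \<bar>Re z\<bar> \<le> 1 \<and> Im z \<ge> 1 / 2}"

definition translates :: "complex \<Rightarrow> imat set" where
  "translates z = {g \<in> SL2Z. mact g z \<in> siegel_set}"

text \<open>For Im z > 0 this is the number of elements of \<open>translates z\<close>. The form as
  a series over an enumeration of SL2Z makes its measurability immediate.\<close>

definition multiplicity_fun :: "complex \<Rightarrow> real" where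
  "multiplicity_fun z = (\<Sum>i. indicator siegel_set (mact (from_nat_into SL2Z i) z))"

lemma closed_siegel_set: "closed siegel_set"
  unfolding siegel_set_def by (intro closed_Collect_conj closed_Collect_le continuous_intros)

text \<open>If g z lies in the Siegel set, then |c z + d|^2 <= 2 y bounds the lower row, and a z + b
  = (g z)(c z + d) bounds the upper one. As Im (g z) = y / |c z + d|^2, this also takes the lower
  bound \<open>\<mu>\<close> for |c z + d|.\<close>

lemma finite_translates:
  assumes z: "Im z > 0"
  shows "finite (translates z)"
proof -
  define y where "y = Im z"
  define \<mu> where "\<mu> = min y 1"
  have \<mu>: "\<mu> > 0" using z by (simp add: \<mu>_def y_def)
  define R where "R = sqrt (2 * y) + y / \<mu>"
  have yR: "sqrt (2 * y) \<le> R" using z \<mu> by (simp add: R_def y_def)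
  let ?L = "{(c :: int, d :: int). cmod (of_int c * z + of_int d) \<le> R}"
  have "translates z \<subseteq> (\<lambda>((a, b), (c, d)). (a, b, c, d)) ` (?L \<times> ?L)"
  proof
    fix g assume g: "g \<in> translates z"
    obtain a b c d where gs: "g = (a, b, c, d)" by (cases g)
    have det: "mdet g = 1" and B: "\<bar>Re (mact g z)\<bar> \<le> 1" "Im (mact g z) \<ge> 1/2"
      using g by (auto simp: translates_def SL2Z_def siegel_set_def)
    have nz: "mj g z \<noteq> 0" using mj_nonzero[OF z, of g] det by simp
    have Im: "Im (mact g z) = y / (cmod (mj g z))\<^sup>2" using Im_mact[OF z, of g] det by (simp add: y_def)
    have "(cmod (mj g z))\<^sup>2 \<le> 2 * y" using B(2) nz unfolding Im by (simp add: field_simps)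
    then have j: "cmod (mj g z) \<le> sqrt (2 * y)" by (rule real_le_rsqrt)
    have \<mu>j: "\<mu> \<le> cmod (mj g z)"
    proof (cases "c = 0")
      case True
      then have "d \<noteq> 0" using det gs by auto
      then have "1 \<le> \<bar>real_of_int d\<bar>" by linarith
      then show ?thesis using True gs by (simp add: \<mu>_def)
    next
      case False
      then have "1 * y \<le> \<bar>of_int c\<bar> * y" using z by (intro mult_right_mono) (auto simp: y_def)
      also have "\<dots> \<le> cmod (mj g z)"
        using abs_Im_le_cmod[of "mj g z"] z gs by (simp add: y_def abs_mult)
      finally show ?thesis by (simp add: \<mu>_def)
    qed
    have "of_int a * z + of_int b = mact g z * mj g z" using nz gs by simp
    then have "cmod (of_int a * z + of_int b) = cmod (mact g z) * cmod (mj g z)" by (simp add: norm_mult)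
    also have "\<dots> \<le> (1 + y / (cmod (mj g z))\<^sup>2) * cmod (mj g z)"
      using cmod_le[of "mact g z"] B(1) Im z by (intro mult_right_mono) (auto simp: y_def)
    also have "\<dots> = cmod (mj g z) + y / cmod (mj g z)" using nz by (simp add: field_simps power2_eq_square)
    also have "\<dots> \<le> R"
      unfolding R_def using j \<mu> \<mu>j z nz by (intro add_mono divide_left_mono mult_pos_pos) (auto simp: y_def)
    finally have "(a, b) \<in> ?L" by simp
    moreover have "(c, d) \<in> ?L" using j yR gs by simp
    ultimately show "g \<in> (\<lambda>((a, b), (c, d)). (a, b, c, d)) ` (?L \<times> ?L)" using gs by force
  qed
  then show ?thesis
    using finite_lattice_ball[OF z, of R] by (meson finite_SigmaI finite_imageI finite_subset)
qed

lemma translates_nonempty: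
  assumes "Im z > 0"
  shows "translates z \<noteq> {}"
proof -
  obtain g where g: "g \<in> SL2Z" "\<bar>Re (mact g z)\<bar> \<le> 1/2" "Im (mact g z) \<ge> 1/2"
    using SL2Z_reduction[OF assms] by metis
  then have "g \<in> translates z" by (auto simp: translates_def siegel_set_def)
  then show ?thesis by blast
qed

lemma countable_imat: "countable (A :: imat set)" by (rule countableI_type)

lemma infinite_SL2Z: "infinite SL2Z"
proof -
  have "inj (\<lambda>q::int. (1::int, q, 0::int, 1::int))" by (rule injI) simp
  then have "infinite (range (\<lambda>q::int. (1::int, q, 0::int, 1::int)))"
    by (simp add: finite_image_iff infinite_UNIV_int)
  moreover have "range (\<lambda>q::int. (1::int, q, 0::int, 1::int)) \<subseteq> SL2Z" by (auto simp: SL2Z_def)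
  ultimately show ?thesis using finite_subset by blast
qed

lemma multiplicity_fun_eq:
  assumes z: "Im z > 0"
  shows "multiplicity_fun z = real (card (translates z))"
proof -
  let ?e = "from_nat_into SL2Z"
  have bij: "bij_betw ?e UNIV SL2Z"
    by (rule bij_betw_from_nat_into[OF countable_imat infinite_SL2Z])
  define N where "N = {i. ?e i \<in> translates z}"
  have bijN: "bij_betw ?e N (translates z)"
  proof (rule bij_betw_subset[OF bij])
    have "translates z \<subseteq> range ?e"
      using bij_betw_imp_surj_on[OF bij] by (auto simp: translates_def)
    then show "?e ` N = translates z" unfolding N_def by blast
  qed simp
  then have "finite N" using finite_translates[OF z] bij_betw_finite by blast
  then have "multiplicity_fun z = (\<Sum>i\<in>N. indicator siegel_set (mact (?e i) z))"
    unfolding multiplicity_fun_def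
    by (rule suminf_finite) (use bij in \<open>auto simp: N_def translates_def bij_betw_def\<close>)
  also have "\<dots> = (\<Sum>i\<in>N. 1)" by (rule sum.cong) (auto simp: N_def translates_def)
  also have "\<dots> = real (card (translates z))" using bij_betw_same_card[OF bijN] by simp
  finally show ?thesis .
qed

lemma multiplicity_fun_ge_1: "Im z > 0 \<Longrightarrow> multiplicity_fun z \<ge> 1"
  using finite_translates[of z] translates_nonempty[of z]
  by (simp add: multiplicity_fun_eq Suc_leI card_gt_0_iff)

lemma bij_betw_mmul_SL2Z:
  assumes g: "g \<in> SL2Z"
  shows "bij_betw (\<lambda>x. mmul x g) SL2Z SL2Z"
proof (rule bij_betw_byWitness[where f' = "\<lambda>x. mmul x (madj g)"])
  show "\<forall>a\<in>SL2Z. mmul (mmul a g) (madj g) = a" "\<forall>a'\<in>SL2Z. mmul (mmul a' (madj g)) g = a'"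
    using g by (simp_all add: mmul_assoc mmul_madj_self madj_mmul_self SL2Z_def)
qed (use g SL2Z_mmul SL2Z_madj in blast)+

lemma multiplicity_fun_mact:
  assumes g: "g \<in> SL2Z" and z: "Im z > 0"
  shows "multiplicity_fun (mact g z) = multiplicity_fun z"
proof -
  have "bij_betw (\<lambda>x. mmul x g) (translates (mact g z)) (translates z)"
  proof (rule bij_betw_subset[OF bij_betw_mmul_SL2Z[OF g]])
    have *: "mact (mmul x g) z = mact x (mact g z)" for x
      using g z by (intro mact_mmul) (auto simp: SL2Z_def)
    show "(\<lambda>x. mmul x g) ` translates (mact g z) = translates z"
    proof (intro equalityI subsetI)
      fix y assume y: "y \<in> translates z"
      then have "y \<in> (\<lambda>x. mmul x g) ` SL2Z"
        using bij_betw_imp_surj_on[OF bij_betw_mmul_SL2Z[OF g]] by (simp add: translates_def)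
      then obtain x where "x \<in> SL2Z" "y = mmul x g" by blast
      with y show "y \<in> (\<lambda>x. mmul x g) ` translates (mact g z)" by (auto simp: translates_def *)
    next
      fix y assume "y \<in> (\<lambda>x. mmul x g) ` translates (mact g z)"
      then obtain x where "x \<in> translates (mact g z)" "y = mmul x g" by blast
      then show "y \<in> translates z" using g by (simp add: translates_def * SL2Z_mmul)
    qed
  qed (auto simp: translates_def)
  then show ?thesis
    using multiplicity_fun_eq z Im_mact_pos[OF z, of g] g bij_betw_same_card by (auto simp: SL2Z_def)
qed

section \<open>Measurability and unfolding\<close>

lemma borel_measurable_mact [measurable]: "mact g \<in> borel_measurable borel"
proof (cases g)
  case (fields a b c d)
  have "mact g = (\<lambda>z. (of_int a * z + of_int b) / (of_int c * z + of_int d))"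
    by (simp add: fields fun_eq_iff)
  then show ?thesis by simp
qed

lemma borel_measurable_mj [measurable]: "mj g \<in> borel_measurable borel"
proof (cases g)
  case (fields a b c d)
  have "mj g = (\<lambda>z. of_int c * z + of_int d)"
    by (simp add: fields fun_eq_iff)
  then show ?thesis by simp
qed

lemmas borel_measurable_mact_compose [measurable (raw)] = measurable_compose[OF _ borel_measurable_mact]
  and borel_measurable_mj_compose [measurable (raw)] = measurable_compose[OF _ borel_measurable_mj]

lemma borel_measurable_cnj_compose [measurable (raw)]:
  "f \<in> borel_measurable M \<Longrightarrow> (\<lambda>x. cnj (f x)) \<in> borel_measurable M"
  by (rule measurable_compose[of f M borel cnj]) (auto intro!: borel_measurable_continuous_onI continuous_intros)

lemma borel_measurable_Im_compose [measurable (raw)]: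
  "f \<in> borel_measurable M \<Longrightarrow> (\<lambda>x. Im (f x)) \<in> borel_measurable M"
  by (rule measurable_compose[of f M borel Im]) (auto intro!: borel_measurable_continuous_onI continuous_intros)

lemma sets_siegel_set [measurable]: "siegel_set \<in> sets borel"
  using closed_siegel_set by simp

lemma borel_measurable_multiplicity_fun [measurable]: "multiplicity_fun \<in> borel_measurable borel"
  unfolding multiplicity_fun_def[abs_def] by measurable

lemmas borel_measurable_multiplicity_fun_compose [measurable (raw)] =
  measurable_compose[OF _ borel_measurable_multiplicity_fun]

lemma borel_measurable_cusp_form:
  assumes "f \<in> cusp_forms k"
  shows "f \<in> borel_measurable borel"
proof -
  have "continuous_on uhp f"
    using assms by (auto simp: cusp_forms_def intro: holomorphic_on_imp_continuous_on)
  then have "(\<lambda>z. indicator uhp z *\<^sub>R f z) \<in> borel_measurable borel"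
    using open_uhp by (intro borel_measurable_continuous_on_indicator) auto
  also have "(\<lambda>z. indicator uhp z *\<^sub>R f z) = f"
    using assms by (auto simp: fun_eq_iff cusp_forms_def indicator_def)
  finally show ?thesis .
qed

text \<open>The unfolding identity. Every matrix of determinant n is uniquely g h with h a Hecke
  representative; for fixed h, exactly \<open>multiplicity_fun (mact h z)\<close> of the g land in
  the Siegel set, and the weight divides by this number. With F = 1 it counts representatives, with
  a slash sum it produces T_n f.\<close>

lemma translates_coset_sum:
  assumes n: "n > 0" and z: "Im z > 0"
  defines "D \<equiv> {x. mdet x = int n \<and> mact x z \<in> siegel_set}"
  shows "finite D"
    and "(\<And>g h. g \<in> SL2Z \<Longrightarrow> h \<in> hecke_reps n \<Longrightarrow> F (mmul g h) = G h) \<Longrightarrow>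
      (\<Sum>x\<in>D. F x / multiplicity_fun (mact x z)) = (\<Sum>h\<in>hecke_reps n. G h :: real)"
proof -
  have Imh: "Im (mact h z) > 0" and deth: "mdet h \<noteq> 0" if "h \<in> hecke_reps n" for h
    using mdet_hecke_reps[OF n that] n z by (auto intro!: Im_mact_pos)
  have mact: "mact (mmul g h) z = mact g (mact h z)" if "h \<in> hecke_reps n" for g h
    using deth[OF that] z by (intro mact_mmul)
  have bij: "bij_betw (\<lambda>(h, g). mmul g h) (SIGMA h:hecke_reps n. translates (mact h z)) D"
    unfolding bij_betw_def
  proof
    show "inj_on (\<lambda>(h, g). mmul g h) (SIGMA h:hecke_reps n. translates (mact h z))"
      using hecke_rep_unique[OF n] by (force simp: inj_on_def translates_def)
    show "(\<lambda>(h, g). mmul g h) ` (SIGMA h:hecke_reps n. translates (mact h z)) = D"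
    proof (intro equalityI subsetI)
      fix x assume x: "x \<in> D"
      then obtain g h where gh: "g \<in> SL2Z" "h \<in> hecke_reps n" "x = mmul g h"
        using hecke_rep_exists[OF n, of x] unfolding D_def by blast
      then have "g \<in> translates (mact h z)" using x mact by (auto simp: D_def translates_def)
      then show "x \<in> (\<lambda>(h, g). mmul g h) ` (SIGMA h:hecke_reps n. translates (mact h z))"
        using gh by (intro image_eqI[where x = "(h, g)"]) auto
    next
      fix x assume "x \<in> (\<lambda>(h, g). mmul g h) ` (SIGMA h:hecke_reps n. translates (mact h z))"
      then obtain g h where "h \<in> hecke_reps n" "g \<in> translates (mact h z)" "x = mmul g h" by auto
      then show "x \<in> D" using mact mdet_hecke_reps[OF n] by (auto simp: D_def translates_def SL2Z_def)
    qed
  qed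
  have "finite (SIGMA h:hecke_reps n. translates (mact h z))"
    using n Imh by (intro finite_SigmaI finite_translates) auto
  then show "finite D" using bij bij_betw_finite by blast
  assume FG: "\<And>g h. g \<in> SL2Z \<Longrightarrow> h \<in> hecke_reps n \<Longrightarrow> F (mmul g h) = G h"
  have "(\<Sum>x\<in>D. F x / multiplicity_fun (mact x z)) =
      (\<Sum>(h, g)\<in>(SIGMA h:hecke_reps n. translates (mact h z)). F (mmul g h) / multiplicity_fun (mact (mmul g h) z))"
    by (subst sum.reindex_bij_betw[OF bij, symmetric]) (simp add: case_prod_unfold)
  also have "\<dots> = (\<Sum>h\<in>hecke_reps n. \<Sum>g\<in>translates (mact h z). F (mmul g h) / multiplicity_fun (mact (mmul g h) z))"
    using n Imh by (intro sum.Sigma[symmetric]) (auto intro: finite_translates)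
  also have "\<dots> = (\<Sum>h\<in>hecke_reps n. G h)"
  proof (intro sum.cong refl)
    fix h assume h: "h \<in> hecke_reps n"
    have "(\<Sum>g\<in>translates (mact h z). F (mmul g h) / multiplicity_fun (mact (mmul g h) z)) =
        (\<Sum>g\<in>translates (mact h z). G h / multiplicity_fun (mact h z))"
      using FG h Imh[OF h] by (intro sum.cong refl) (auto simp: mact[OF h] multiplicity_fun_mact translates_def)
    also have "\<dots> = G h"
      using multiplicity_fun_ge_1[OF Imh[OF h]] multiplicity_fun_eq[OF Imh[OF h]] by simp
    finally show "(\<Sum>g\<in>translates (mact h z). F (mmul g h) / multiplicity_fun (mact (mmul g h) z)) = G h" .
  qed
  finally show "(\<Sum>x\<in>D. F x / multiplicity_fun (mact x z)) = (\<Sum>h\<in>hecke_reps n. G h)" .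
qed


section \<open>Invariance of the hyperbolic area\<close>

text \<open>The plane is modelled as \<open>real ^ 2\<close> for integration, where Jacobians are
  determinants of matrices; \<open>vc\<close> and \<open>cv\<close> translate from and to complex
  numbers.\<close>

definition vc :: "real ^ 2 \<Rightarrow> complex" where "vc v = Complex (v $ 1) (v $ 2)"

definition cv :: "complex \<Rightarrow> real ^ 2" where "cv z = (\<chi> i. if i = 1 then Re z else Im z)"

definition uhp2 :: "(real ^ 2) set" where "uhp2 = {v. v $ 2 > 0}"

lemma vc_cv [simp]: "vc (cv z) = z" by (simp add: vc_def cv_def)

lemma cv_vc [simp]: "cv (vc v) = v"
  by (simp add: vc_def cv_def vec_eq_iff forall_2)

lemma Re_vc [simp]: "Re (vc v) = v $ 1" and Im_vc [simp]: "Im (vc v) = v $ 2" by (simp_all add: vc_def)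

lemma cv_nth [simp]: "cv z $ 1 = Re z" "cv z $ 2 = Im z" by (simp_all add: cv_def)

lemma bounded_linear_vc: "bounded_linear vc"
  by (intro linear_conv_bounded_linear[THEN iffD1] linearI) (simp_all add: complex_eq_iff)

lemma bounded_linear_cv: "bounded_linear cv"
  by (intro linear_conv_bounded_linear[THEN iffD1] linearI) (simp_all add: vec_eq_iff forall_2)

lemma borel_measurable_vc [measurable]: "vc \<in> borel_measurable borel"
  by (intro borel_measurable_continuous_onI linear_continuous_on bounded_linear_vc)

lemma borel_measurable_vec_nth2 [measurable]: "(\<lambda>v :: real ^ 2. v $ i) \<in> borel_measurable borel"
  by (intro borel_measurable_continuous_onI continuous_intros)

lemma open_uhp2: "open uhp2"
  unfolding uhp2_def by (intro open_Collect_less continuous_intros)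

lemma uhp2_sets [measurable]: "uhp2 \<in> sets borel"
  using open_uhp2 by simp

lemma mact_has_field_derivative:
  assumes "Im z > 0" "mdet g \<noteq> 0"
  shows "(mact g has_field_derivative (of_int (mdet g) / (mj g z)\<^sup>2)) (at z)"
proof (cases g)
  case (fields a b c d)
  have nz: "of_int c * z + of_int d \<noteq> (0::complex)" using mj_nonzero[OF assms] fields by simp
  have "((\<lambda>z. (of_int a * z + of_int b) / (of_int c * z + of_int d)) has_field_derivative
      ((of_int a * (of_int c * z + of_int d) - (of_int a * z + of_int b) * of_int c) /
        ((of_int c * z + of_int d) * (of_int c * z + of_int d)))) (at z)"
    using nz by (auto intro!: derivative_eq_intros)
  moreover have "mact g = (\<lambda>z. (of_int a * z + of_int b) / (of_int c * z + of_int d))"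
    by (simp add: fields fun_eq_iff)
  moreover have "of_int a * (of_int c * z + of_int d) - (of_int a * z + of_int b) * of_int c = of_int (mdet g)"
    by (simp add: fields algebra_simps)
  ultimately show ?thesis by (simp add: fields power2_eq_square)
qed

text \<open>The Jacobian of a holomorphic map is |g'(z)|^2 = det^2 / |c z + d|^4, which is (Im g z /
  Im z)^2 and cancels against the density 1 / y^2. The equivalence transports integrability and
  value together.\<close>

lemma hyperbolic_change_of_variables:
  fixes \<Phi> :: "complex \<Rightarrow> real"
  assumes g: "mdet g > 0"
  shows "(\<lambda>v. \<Phi> (mact g (vc v)) / (v $ 2)\<^sup>2) absolutely_integrable_on uhp2 \<and>
           integral uhp2 (\<lambda>v. \<Phi> (mact g (vc v)) / (v $ 2)\<^sup>2) = b \<longleftrightarrow>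
         (\<lambda>v. \<Phi> (vc v) / (v $ 2)\<^sup>2) absolutely_integrable_on uhp2 \<and>
           integral uhp2 (\<lambda>v. \<Phi> (vc v) / (v $ 2)\<^sup>2) = b"
proof -
  define G where "G v = cv (mact g (vc v))" for v
  define D where "D v = of_int (mdet g) / (mj g (vc v))\<^sup>2" for v
  define G' where "G' v u = cv (D v * vc u)" for v u
  have H: "Im (vc v) > 0" if "v \<in> uhp2" for v using that by (simp add: uhp2_def)
  have der: "(G has_derivative G' v) (at v within uhp2)" if v: "v \<in> uhp2" for v
  proof -
    have "(mact g has_derivative (*) (D v)) (at (vc v))"
      using mact_has_field_derivative[OF H[OF v], of g] g
      by (simp add: has_field_derivative_def D_def)
    moreover have "(vc has_derivative vc) (at v within uhp2)"
      by (rule bounded_linear_imp_has_derivative[OF bounded_linear_vc])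
    ultimately have "((\<lambda>v. mact g (vc v)) has_derivative (\<lambda>u. D v * vc u)) (at v within uhp2)"
      using has_derivative_compose[of vc vc v uhp2 "mact g" "(*) (D v)"] by simp
    then show ?thesis
      unfolding G_def[abs_def] G'_def[abs_def] by (rule bounded_linear.has_derivative[OF bounded_linear_cv])
  qed
  have adj: "mact (madj g) (mact g z) = z" if "Im z > 0" for z
    using mact_mmul[OF that, of g "madj g"] g by (simp add: madj_mmul_self)
  have adj': "mact g (mact (madj g) z) = z" if "Im z > 0" for z
    using mact_mmul[OF that, of "madj g" g] g by (simp add: mmul_madj_self)
  have inj: "inj_on G uhp2"
    by (rule inj_on_inverseI[where g = "\<lambda>v. cv (mact (madj g) (vc v))"]) (simp only: G_def vc_cv cv_vc adj[OF H])
  have img: "G ` uhp2 = uhp2"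
  proof (intro equalityI subsetI)
    fix v assume v: "v \<in> uhp2"
    have "cv (mact (madj g) (vc v)) \<in> uhp2"
      using Im_mact_pos[OF H[OF v], of "madj g"] g by (simp add: uhp2_def)
    moreover have "v = G (cv (mact (madj g) (vc v)))" by (simp only: G_def vc_cv adj'[OF H[OF v]] cv_vc)
    ultimately show "v \<in> G ` uhp2" by blast
  next
    fix u assume "u \<in> G ` uhp2"
    then obtain v where "v \<in> uhp2" "u = G v" by blast
    then show "u \<in> uhp2" using Im_mact_pos[OF H g] by (simp add: G_def uhp2_def)
  qed
  have det: "det (matrix (G' v)) = (cmod (D v))\<^sup>2" for v
    unfolding det_2 unfolding cmod_power2 by (simp add: matrix_def G'_def axis_def power2_eq_square)
  have eq: "\<bar>det (matrix (G' v))\<bar> * \<Phi> (vc (G v)) / (G v $ 2)\<^sup>2 = \<Phi> (mact g (vc v)) / (v $ 2)\<^sup>2"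
    if v: "v \<in> uhp2" for v
  proof -
    have nz: "mj g (vc v) \<noteq> 0" using mj_nonzero[OF H[OF v], of g] g by simp
    have Im: "Im (mact g (vc v)) = of_int (mdet g) * v $ 2 / (cmod (mj g (vc v)))\<^sup>2"
      using Im_mact[OF H[OF v], of g] g by simp
    have "v $ 2 > 0" using v by (simp add: uhp2_def)
    then show ?thesis
      using g nz unfolding det D_def G_def vc_cv cv_nth Im norm_divide norm_power
      by (simp add: power_divide power_mult_distrib)
  qed
  have S: "uhp2 \<in> sets lebesgue" by (simp add: borel_open lebesgue_openin open_uhp2)
  have cong1: "set_integrable lebesgue uhp2 (\<lambda>v. \<bar>det (matrix (G' v))\<bar> * \<Phi> (vc (G v)) / (G v $ 2)\<^sup>2) \<longleftrightarrow>
      set_integrable lebesgue uhp2 (\<lambda>v. \<Phi> (mact g (vc v)) / (v $ 2)\<^sup>2)"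
    using eq by (intro set_integrable_cong) auto
  have cong2: "integral uhp2 (\<lambda>v. \<bar>det (matrix (G' v))\<bar> * \<Phi> (vc (G v)) / (G v $ 2)\<^sup>2) =
      integral uhp2 (\<lambda>v. \<Phi> (mact g (vc v)) / (v $ 2)\<^sup>2)"
    using eq by (rule Henstock_Kurzweil_Integration.integral_cong)
  \<comment> \<open>The theorem is applied to functions into \<open>real ^ 1\<close>;
    \<open>vec\<close> wraps the scalars.\<close>
  have "(\<lambda>v. \<bar>det (matrix (G' v))\<bar> *\<^sub>R (vec (\<Phi> (vc (G v)) / (G v $ 2)\<^sup>2) :: real ^ 1)) absolutely_integrable_on uhp2 \<and>
      integral uhp2 (\<lambda>v. \<bar>det (matrix (G' v))\<bar> *\<^sub>R (vec (\<Phi> (vc (G v)) / (G v $ 2)\<^sup>2) :: real ^ 1)) = vec b \<longleftrightarrow>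
      (\<lambda>v. vec (\<Phi> (vc v) / (v $ 2)\<^sup>2) :: real ^ 1) absolutely_integrable_on uhp2 \<and>
      integral uhp2 (\<lambda>v. vec (\<Phi> (vc v) / (v $ 2)\<^sup>2) :: real ^ 1) = vec b"
    using has_absolute_integral_change_of_variables[OF S der inj, of "\<lambda>v. vec (\<Phi> (vc v) / (v $ 2)\<^sup>2) :: real ^ 1" "vec b"]
    unfolding img .
  then show ?thesis
    unfolding absolutely_integrable_on_1_iff integral_on_1_eq
    by (simp add: cong1 cong2)
qed

lemma hyperbolic_integral_mact:
  fixes \<Phi> :: "complex \<Rightarrow> real"
  assumes g: "mdet g > 0" and [measurable]: "\<Phi> \<in> borel_measurable borel"
    and int: "set_integrable lborel uhp2 (\<lambda>v. \<Phi> (vc v) / (v $ 2)\<^sup>2)"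
  shows "(LINT v:uhp2|lborel. \<Phi> (mact g (vc v)) / (v $ 2)\<^sup>2) = (LINT v:uhp2|lborel. \<Phi> (vc v) / (v $ 2)\<^sup>2)"
proof -
  have m: "(\<lambda>v. indicator uhp2 v *\<^sub>R (\<Phi> (vc v) / (v $ 2)\<^sup>2)) \<in> borel_measurable lborel"
    "(\<lambda>v. indicator uhp2 v *\<^sub>R (\<Phi> (mact g (vc v)) / (v $ 2)\<^sup>2)) \<in> borel_measurable lborel"
    by measurable
  have i1: "set_integrable lebesgue uhp2 (\<lambda>v. \<Phi> (vc v) / (v $ 2)\<^sup>2)"
    using int unfolding set_integrable_def integrable_completion[OF m(1)] .
  have i2: "set_integrable lebesgue uhp2 (\<lambda>v. \<Phi> (mact g (vc v)) / (v $ 2)\<^sup>2)"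
    and eq: "integral uhp2 (\<lambda>v. \<Phi> (mact g (vc v)) / (v $ 2)\<^sup>2) = integral uhp2 (\<lambda>v. \<Phi> (vc v) / (v $ 2)\<^sup>2)"
    using hyperbolic_change_of_variables[OF g, of \<Phi> "integral uhp2 (\<lambda>v. \<Phi> (vc v) / (v $ 2)\<^sup>2)"] i1 by auto
  have "(LINT v:uhp2|lebesgue. \<Phi> (mact g (vc v)) / (v $ 2)\<^sup>2) = (LINT v:uhp2|lebesgue. \<Phi> (vc v) / (v $ 2)\<^sup>2)"
    using set_lebesgue_integral_eq_integral(2)[OF i1] set_lebesgue_integral_eq_integral(2)[OF i2] eq by simp
  then show ?thesis
    unfolding set_lebesgue_integral_def integral_completion[OF m(1)] integral_completion[OF m(2)] .
qed

text \<open>The boxes \<open>Q m\<close>, of width 2 and height 1/2 and hence of area 1, are stacked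
  along the strip; on the m-th one y >= (m + 1) / 2, so the density is at most 4 / (m +
  1)^2.\<close>

lemma siegel_set_finite_volume:
  "set_integrable lborel uhp2 (\<lambda>v. indicator siegel_set (vc v) / (v $ 2)\<^sup>2 :: real)"
proof -
  define F :: "real ^ 2 \<Rightarrow> real" where "F v = indicator siegel_set (vc v) / (v $ 2)\<^sup>2" for v
  define Q :: "nat \<Rightarrow> (real ^ 2) set" where
    "Q m = cbox (vector [-1, (real m + 1) / 2]) (vector [1, (real m + 2) / 2])" for m
  have [measurable]: "F \<in> borel_measurable borel" unfolding F_def[abs_def] by measurable
  have Qm [measurable]: "Q m \<in> sets borel" for m by (simp add: Q_def)
  have emQ: "emeasure lborel (Q m) = 1" for m
  proof -
    have "Q m \<noteq> {}" unfolding Q_def by (auto simp: interval_ne_empty_cart forall_2)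
    then have "measure lborel (Q m) = 1"
      unfolding Q_def by (subst content_cbox_cart) (simp_all add: UNIV_2 field_simps)
    moreover have "emeasure lborel (Q m) \<noteq> top"
      using emeasure_lborel_cbox_finite unfolding Q_def by (metis infinity_ennreal_def less_irrefl)
    ultimately show ?thesis using emeasure_eq_ennreal_measure[of lborel "Q m"] by simp
  qed
  have le: "ennreal (F v) \<le> (\<Sum>m. ennreal (4 / (real m + 1)\<^sup>2) * indicator (Q m) v)" for v
  proof (cases "vc v \<in> siegel_set")
    case True
    then have v: "\<bar>v $ 1\<bar> \<le> 1" "v $ 2 \<ge> 1 / 2" by (auto simp: siegel_set_def)
    define m where "m = nat (\<lfloor>2 * v $ 2\<rfloor> - 1)"
    have fl: "\<lfloor>2 * v $ 2\<rfloor> \<ge> 1" using v(2) by (simp add: le_floor_iff)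
    then have m: "real m + 1 = of_int \<lfloor>2 * v $ 2\<rfloor>" by (simp add: m_def)
    have "real m + 1 \<le> 2 * v $ 2" "2 * v $ 2 \<le> real m + 2"
      using m floor_correct[of "2 * v $ 2"] by linarith+
    then have mQ: "v \<in> Q m" using v(1) by (auto simp: Q_def mem_box_cart forall_2)
    have "F v \<le> 4 / (real m + 1)\<^sup>2"
    proof -
      have "(real m + 1)\<^sup>2 \<le> (2 * v $ 2)\<^sup>2" unfolding m using fl by (intro power_mono) auto
      then have "4 / (2 * v $ 2)\<^sup>2 \<le> 4 / (real m + 1)\<^sup>2" by (intro divide_left_mono) (use v in auto)
      then show ?thesis using True by (simp add: F_def power_mult_distrib)
    qed
    then have "ennreal (F v) \<le> (\<Sum>i\<in>{m}. ennreal (4 / (real i + 1)\<^sup>2) * indicator (Q i) v)"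
      using mQ by (simp add: ennreal_leI)
    also have "\<dots> \<le> (\<Sum>m. ennreal (4 / (real m + 1)\<^sup>2) * indicator (Q m) v)"
      by (intro sum_le_suminf) auto
    finally show ?thesis .
  qed (simp add: F_def)
  have sm: "summable (\<lambda>m. 4 / (real m + 1)\<^sup>2)"
  proof -
    have "summable (\<lambda>m. 4 * (1 / real m ^ 2))"
      using inverse_power_summable[of 2, where 'a = real] by (intro summable_mult) (simp add: inverse_eq_divide)
    then have "summable (\<lambda>m. 4 * (1 / real (Suc m) ^ 2))" by (rule summable_Suc_iff[THEN iffD2])
    then show ?thesis by (simp add: add.commute)
  qed
  have "(\<integral>\<^sup>+ v. ennreal (F v) \<partial>lborel) \<le> (\<integral>\<^sup>+ v. (\<Sum>m. ennreal (4 / (real m + 1)\<^sup>2) * indicator (Q m) v) \<partial>lborel)"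
    by (intro nn_integral_mono le)
  also have "\<dots> = (\<Sum>m. \<integral>\<^sup>+ v. ennreal (4 / (real m + 1)\<^sup>2) * indicator (Q m) v \<partial>lborel)"
    by (intro nn_integral_suminf) measurable
  also have "\<dots> = (\<Sum>m. ennreal (4 / (real m + 1)\<^sup>2))"
    by (simp add: nn_integral_cmult emQ)
  also have "\<dots> < \<infinity>" using sm by (simp add: suminf_ennreal2)
  finally have "integrable lborel F"
    by (intro integrableI_nonneg) (auto simp: F_def)
  moreover have "(\<lambda>v. indicator uhp2 v *\<^sub>R F v) = F"
    by (auto simp: fun_eq_iff F_def indicator_def siegel_set_def uhp2_def)
  ultimately show ?thesis unfolding set_integrable_def F_def[symmetric] by simp
qed


section \<open>The symmetric sum over matrices of determinant n\<close>

lemma infinite_det_matrices: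
  assumes "n > 0"
  shows "infinite {x. mdet x = int n}"
proof -
  have "inj (\<lambda>q::int. (1::int, q, 0::int, int n))" by (rule injI) simp
  then have "infinite (range (\<lambda>q::int. (1::int, q, 0::int, int n)))"
    by (simp add: finite_image_iff infinite_UNIV_int)
  moreover have "range (\<lambda>q::int. (1::int, q, 0::int, int n)) \<subseteq> {x. mdet x = int n}" by auto
  ultimately show ?thesis using finite_subset by blast
qed

text \<open>With j = \<open>mj g z\<close> and N = \<open>mdet g\<close>, the adjugate has factor N
  / j at g z, and Im (g z) = N Im z / |j|^2. The powers of N cancel and only a conjugation is left:
  this is self-adjointness before integration.\<close>

lemma slash_madj:
  assumes z: "Im z > 0" and g: "mdet g > 0"
  shows "slash (2 * h) f (madj g) (mact g z) * cnj (f (mact g z)) * of_real (Im (mact g z)) ^ (2 * h) =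
    cnj (slash (2 * h) f g z * cnj (f z) * of_real (Im z) ^ (2 * h))"
proof -
  define j where "j = mj g z"
  define N where "N = complex_of_int (mdet g)"
  have j: "j \<noteq> 0" and N: "N \<noteq> 0" using mj_nonzero[OF z, of g] g by (auto simp: j_def N_def)
  have "mj (mmul (madj g) g) z = N" by (simp add: madj_mmul_self N_def)
  then have "mj (madj g) (mact g z) * j = N" using mj_mmul[OF z, of g "madj g"] g by (simp add: j_def)
  then have j': "mj (madj g) (mact g z) = N / j" using j by (simp add: field_simps)
  have a: "mact (madj g) (mact g z) = z"
    using mact_mmul[OF z, of g "madj g"] g by (simp add: madj_mmul_self)
  have "complex_of_real (Im (mact g z)) = N * of_real (Im z) / (of_real (cmod j))\<^sup>2"
    using Im_mact[OF z, of g] g by (simp add: N_def j_def)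
  also have "(of_real (cmod j))\<^sup>2 = j * cnj j" by (simp only: complex_norm_square of_real_power[symmetric])
  finally have Im: "complex_of_real (Im (mact g z)) = N * of_real (Im z) / (j * cnj j)" .
  show ?thesis
    unfolding slash_def a j' Im j_def[symmetric] using j N
    by (simp add: power_divide power_mult_distrib)
qed

text \<open>The integrals \<open>I x\<close> sum to c times the weighted Petersson norm, the
  integral of \<open>H\<close>, where c is Im l up to a positive factor. The adjugate permutes the
  matrices and negates every \<open>I x\<close>, so the sum is 0; for nonzero f the norm is not
  0.\<close>

theorem hecke_eigenvalue_real:
  assumes f: "f \<in> cusp_forms (2 * h)" "f \<noteq> 0" and n: "n > 0"
    and eig: "hecke (2 * h) n f = fscale l f"
  shows "Im l = 0"
proof -
  let ?k = "2 * h" and ?B = "indicator siegel_set :: complex \<Rightarrow> real" and ?W = multiplicity_fun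
  obtain M where M: "M \<ge> 0" "\<And>z. Im z > 0 \<Longrightarrow> cmod (f z) * Im z ^ h \<le> M"
    using cusp_form_height_bounded[OF f(1)] by metis
  define D where "D = {x. mdet x = int n}"
  have detD: "mdet x > 0" if "x \<in> D" for x using that n by (simp add: D_def)
  define core where "core x z = Im (slash ?k f x z * cnj (f z)) * Im z ^ ?k" for x z
  \<comment> \<open>Both end points z and x z carry the weight indicator / multiplicity. Thus (x, z)
    -> (madj x, x z) preserves the weights and affects only the sign of \<open>core\<close>.\<close>
  define \<Phi> where "\<Phi> x z = ?B z * ?B (mact x z) / (?W z * ?W (mact x z)) * core x z" for x z
  note [measurable (raw)] = measurable_compose[OF _ borel_measurable_cusp_form[OF f(1)]]
  have \<Phi>_meas [measurable]: "\<Phi> x \<in> borel_measurable borel" for x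
    unfolding \<Phi>_def[abs_def] core_def slash_def by measurable
  have core_adj: "core (madj x) (mact x z) = - core x z" if x: "x \<in> D" and z: "Im z > 0" for x z
  proof -
    have c: "core x z = Im (slash ?k f x z * cnj (f z) * of_real (Im z) ^ ?k)" for x z
      unfolding core_def of_real_power[symmetric] by simp
    show ?thesis unfolding c using arg_cong[OF slash_madj[OF z detD[OF x], of h f], of Im] by (simp only: cnj.simps)
  qed
  have \<Phi>_adj: "\<Phi> (madj x) (mact x z) = - \<Phi> x z" if x: "x \<in> D" and z: "Im z > 0" for x z
  proof -
    have "mact (madj x) (mact x z) = z"
      using mact_mmul[OF z, of x "madj x"] detD[OF x] by (simp add: madj_mmul_self)
    then show ?thesis by (simp add: \<Phi>_def core_adj[OF x z] mult_ac)
  qed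
  have core_le: "\<bar>core x z\<bar> \<le> M\<^sup>2" if x: "x \<in> D" and z: "Im z > 0" for x z
  proof -
    let ?j = "cmod (mj x z)"
    have j: "?j > 0" using mj_nonzero[OF z, of x] detD[OF x] by simp
    have Imx: "Im (mact x z) = real n * Im z / ?j\<^sup>2"
      using Im_mact[OF z, of x] detD[OF x] x by (simp add: D_def)
    have "cmod (f (mact x z)) * (real n * Im z / ?j\<^sup>2) ^ h \<le> M"
      using M(2)[OF Im_mact_pos[OF z detD[OF x]]] unfolding Imx .
    then have "real n ^ h * (cmod (slash ?k f x z) * Im z ^ h) \<le> M"
      using j power_mult[of ?j 2 h] power_mult[of ?j h 2]
      by (simp add: slash_def norm_divide norm_power power_divide power_mult_distrib field_simps)
    moreover have "1 * (cmod (slash ?k f x z) * Im z ^ h) \<le> real n ^ h * (cmod (slash ?k f x z) * Im z ^ h)"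
      using n z by (intro mult_right_mono) auto
    ultimately have 1: "cmod (slash ?k f x z) * Im z ^ h \<le> M" by linarith
    have "\<bar>core x z\<bar> \<le> cmod (slash ?k f x z * cnj (f z)) * Im z ^ ?k"
      unfolding core_def abs_mult using z abs_Im_le_cmod[of "slash ?k f x z * cnj (f z)"]
      by (intro mult_mono) auto
    also have "\<dots> = (cmod (slash ?k f x z) * Im z ^ h) * (cmod (f z) * Im z ^ h)"
    proof -
      have "Im z ^ ?k = Im z ^ h * Im z ^ h" by (simp add: mult_2 power_add)
      then show ?thesis by (simp add: norm_mult mult_ac)
    qed
    also have "\<dots> \<le> M * M" using 1 M z by (intro mult_mono) auto
    finally show ?thesis by (simp add: power2_eq_square)
  qed
  \<comment> \<open>Only the weight at z is estimated by 1; the one at x z is kept, because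
    \<open>count\<close> evaluates its sum over x exactly.\<close>
  have \<Phi>_le: "\<bar>\<Phi> x z\<bar> \<le> M\<^sup>2 * (?B z * (?B (mact x z) / ?W (mact x z)))" if x: "x \<in> D" and z: "Im z > 0" for x z
  proof -
    have W: "?W z \<ge> 1" "?W (mact x z) \<ge> 1"
      using multiplicity_fun_ge_1 z Im_mact_pos[OF z detD[OF x]] by auto
    have "\<bar>\<Phi> x z\<bar> = (?B z * ?B (mact x z) / (?W z * ?W (mact x z))) * \<bar>core x z\<bar>"
      using W by (simp add: \<Phi>_def abs_mult)
    also have "\<dots> \<le> (?B z * ?B (mact x z) / (1 * ?W (mact x z))) * M\<^sup>2"
      using W core_le[OF x z] by (intro mult_mono divide_left_mono mult_right_mono mult_pos_pos) auto
    finally show ?thesis by (simp add: mult_ac)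
  qed
  define G where "G v = indicator uhp2 v *\<^sub>R (?B (vc v) / (v $ 2)\<^sup>2)" for v
  have G: "integrable lborel G"
    using siegel_set_finite_volume unfolding set_integrable_def G_def[abs_def] .
  have G0: "G v \<ge> 0" for v by (simp add: G_def)
  define F where "F x v = indicator uhp2 v *\<^sub>R (\<Phi> x (vc v) / (v $ 2)\<^sup>2)" for x v
  have F_meas [measurable]: "F x \<in> borel_measurable borel" for x
    unfolding F_def[abs_def] by measurable
  have F_le': "\<bar>F x v\<bar> \<le> M\<^sup>2 * G v * (?B (mact x (vc v)) / ?W (mact x (vc v)))" if x: "x \<in> D" for x v
  proof (cases "v \<in> uhp2")
    case True
    then have z: "Im (vc v) > 0" by (simp add: uhp2_def)
    have "\<bar>F x v\<bar> = \<bar>\<Phi> x (vc v)\<bar> / (v $ 2)\<^sup>2" using True by (simp add: F_def)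
    also have "\<dots> \<le> M\<^sup>2 * (?B (vc v) * (?B (mact x (vc v)) / ?W (mact x (vc v)))) / (v $ 2)\<^sup>2"
      by (intro divide_right_mono \<Phi>_le[OF x z]) simp
    finally show ?thesis using True by (simp add: G_def mult_ac)
  qed (simp add: F_def G_def)
  have F_le: "\<bar>F x v\<bar> \<le> M\<^sup>2 * G v" if x: "x \<in> D" for x v
  proof (cases "v \<in> uhp2")
    case True
    then have z: "Im (vc v) > 0" by (simp add: uhp2_def)
    have "?W (mact x (vc v)) \<ge> 1" using multiplicity_fun_ge_1 Im_mact_pos[OF z detD[OF x]] by auto
    then have "?B (mact x (vc v)) / ?W (mact x (vc v)) \<le> 1"
      by (simp add: indicator_def)
    then have "M\<^sup>2 * G v * (?B (mact x (vc v)) / ?W (mact x (vc v))) \<le> M\<^sup>2 * G v * 1"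
      using G0 by (intro mult_left_mono) auto
    then show ?thesis using F_le'[OF x, of v] by simp
  qed (simp add: F_def G_def)
  have F_int: "integrable lborel (F x)" if x: "x \<in> D" for x
    by (rule Bochner_Integration.integrable_bound[OF integrable_mult_right[OF G, of "M\<^sup>2"]])
       (use F_le[OF x] G0 in auto)
  define I where "I x = integral\<^sup>L lborel (F x)" for x
  have madjD: "madj x \<in> D" if "x \<in> D" for x using that by (simp add: D_def)
  have I_adj: "I (madj x) = - I x" if x: "x \<in> D" for x
  proof -
    have "set_integrable lborel uhp2 (\<lambda>v. \<Phi> (madj x) (vc v) / (v $ 2)\<^sup>2)"
      using F_int[OF madjD[OF x]] unfolding set_integrable_def F_def[abs_def] .
    from hyperbolic_integral_mact[OF detD[OF x] \<Phi>_meas this]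
    have "I (madj x) = (LINT v:uhp2|lborel. \<Phi> (madj x) (mact x (vc v)) / (v $ 2)\<^sup>2)"
      unfolding I_def F_def[abs_def] set_lebesgue_integral_def by simp
    also have "\<dots> = (LINT v:uhp2|lborel. - (\<Phi> x (vc v) / (v $ 2)\<^sup>2))"
      by (intro set_lebesgue_integral_cong) (auto simp: \<Phi>_adj[OF x] uhp2_def)
    also have "\<dots> = - I x" unfolding I_def F_def[abs_def] set_lebesgue_integral_def by simp
    finally show ?thesis .
  qed
  define e where "e = from_nat_into D"
  have e: "bij_betw e UNIV D"
    unfolding e_def D_def by (rule bij_betw_from_nat_into[OF countable_imat infinite_det_matrices[OF n]])
  have eD: "e i \<in> D" for i using bij_betw_imp_surj_on[OF e] by blast
  define Z where "Z v = {x. mdet x = int n \<and> mact x (vc v) \<in> siegel_set}" for v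
  have count: "(\<Sum>x\<in>Z v. 1 / ?W (mact x (vc v))) = real (card (hecke_reps n))" and Zfin: "finite (Z v)"
    if "v \<in> uhp2" for v
  proof -
    have z: "Im (vc v) > 0" using that by (simp add: uhp2_def)
    show "finite (Z v)" unfolding Z_def by (rule translates_coset_sum(1)[OF n z])
    show "(\<Sum>x\<in>Z v. 1 / ?W (mact x (vc v))) = real (card (hecke_reps n))"
      unfolding Z_def using translates_coset_sum(2)[OF n z, of "\<lambda>_. 1" "\<lambda>_. 1"] by simp
  qed
  \<comment> \<open>An integrable majorant uniform in N, which permits exchanging the sum over
    matrices with the integral.\<close>
  have partial: "(\<Sum>i<N. \<bar>F (e i) v\<bar>) \<le> M\<^sup>2 * real (card (hecke_reps n)) * G v" for N v
  proof (cases "v \<in> uhp2")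
    case True
    have W: "?W (mact x (vc v)) \<ge> 0" if "x \<in> D" for x
      using multiplicity_fun_ge_1[OF Im_mact_pos[OF _ detD[OF that], of "vc v"]] True by (simp add: uhp2_def)
    have "(\<Sum>x\<in>e ` {..<N}. ?B (mact x (vc v)) / ?W (mact x (vc v))) \<le> (\<Sum>x\<in>e ` {..<N} \<union> Z v. ?B (mact x (vc v)) / ?W (mact x (vc v)))"
      using Zfin[OF True] eD W by (intro sum_mono2) (auto simp: Z_def D_def)
    also have "\<dots> = (\<Sum>x\<in>Z v. 1 / ?W (mact x (vc v)))"
    proof (rule sum.mono_neutral_cong_right)
      show "\<forall>x\<in>e ` {..<N} \<union> Z v - Z v. ?B (mact x (vc v)) / ?W (mact x (vc v)) = 0"
      proof
        fix x assume "x \<in> e ` {..<N} \<union> Z v - Z v"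
        then have "x \<in> D" "x \<notin> Z v" using eD by blast+
        then show "?B (mact x (vc v)) / ?W (mact x (vc v)) = 0" by (simp add: Z_def D_def)
      qed
    qed (use Zfin[OF True] in \<open>auto simp: Z_def\<close>)
    also have "\<dots> = real (card (hecke_reps n))" by (rule count[OF True])
    finally have S: "(\<Sum>x\<in>e ` {..<N}. ?B (mact x (vc v)) / ?W (mact x (vc v))) \<le> real (card (hecke_reps n))" .
    have "(\<Sum>i<N. \<bar>F (e i) v\<bar>) \<le> (\<Sum>i<N. M\<^sup>2 * G v * (?B (mact (e i) (vc v)) / ?W (mact (e i) (vc v))))"
      by (intro sum_mono F_le' eD)
    also have "\<dots> = M\<^sup>2 * G v * (\<Sum>x\<in>e ` {..<N}. ?B (mact x (vc v)) / ?W (mact x (vc v)))"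
      using bij_betw_imp_inj_on[OF e] by (subst sum.reindex) (auto simp: inj_on_def sum_distrib_left)
    also have "\<dots> \<le> M\<^sup>2 * G v * real (card (hecke_reps n))"
      using G0 by (intro mult_left_mono S) auto
    finally show ?thesis by (simp only: mult_ac)
  qed (simp add: F_def G_def)
  define H where "H v = indicator uhp2 v *\<^sub>R (?B (vc v) / ?W (vc v) * ((cmod (f (vc v)))\<^sup>2 * (v $ 2) ^ ?k) / (v $ 2)\<^sup>2)" for v
  define c where "c = Im l / real n ^ (?k - 1)"
  \<comment> \<open>Pointwise unfolding turns the sum over matrices into T_n f(z) times the
    conjugate of f(z), that is l |f(z)|^2 up to scaling; the imaginary part then isolates Im
    l.\<close>
  have total: "(\<Sum>i. F (e i) v) = c * H v" for v
  proof (cases "v \<in> uhp2")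
    case True
    then have z: "Im (vc v) > 0" by (simp add: uhp2_def)
    define z where "z = vc v"
    have z: "Im z > 0" using True by (simp add: uhp2_def z_def)
    define N where "N = {i. e i \<in> Z v}"
    have bijN: "bij_betw e N (Z v)"
    proof (rule bij_betw_subset[OF e])
      have "Z v \<subseteq> range e" using bij_betw_imp_surj_on[OF e] by (auto simp: Z_def D_def)
      then show "e ` N = Z v" unfolding N_def by blast
    qed simp
    have "finite N" using bijN Zfin[OF True] bij_betw_finite by blast
    then have "(\<Sum>i. F (e i) v) = (\<Sum>i\<in>N. F (e i) v)"
      by (rule suminf_finite) (use eD in \<open>auto simp: N_def Z_def D_def F_def \<Phi>_def\<close>)
    also have "\<dots> = (\<Sum>x\<in>Z v. F x v)" by (rule sum.reindex_bij_betw[OF bijN])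
    also have "\<dots> = (\<Sum>x\<in>Z v. (?B z / ?W z / (v $ 2)\<^sup>2 * core x z) / ?W (mact x z))"
      using True by (intro sum.cong refl) (auto simp: Z_def F_def \<Phi>_def z_def)
    also have "\<dots> = (\<Sum>x\<in>hecke_reps n. ?B z / ?W z / (v $ 2)\<^sup>2 * core x z)"
      unfolding Z_def z_def[symmetric]
    proof (rule translates_coset_sum(2)[OF n z])
      fix g x assume "g \<in> SL2Z" "x \<in> hecke_reps n"
      then show "?B z / ?W z / (v $ 2)\<^sup>2 * core (mmul g x) z = ?B z / ?W z / (v $ 2)\<^sup>2 * core x z"
        using slash_SL2Z_mmul[OF f(1) _ z, of g x] mdet_hecke_reps[OF n, of x] n by (simp add: core_def)
    qed
    also have "\<dots> = ?B z / ?W z / (v $ 2)\<^sup>2 * (Im ((\<Sum>x\<in>hecke_reps n. slash ?k f x z) * cnj (f z)) * Im z ^ ?k)"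
      by (simp only: core_def sum_distrib_left[symmetric] sum_distrib_right[symmetric] Im_sum[symmetric])
    also have "(\<Sum>x\<in>hecke_reps n. slash ?k f x z) = l * f z / of_nat n ^ (?k - 1)"
      using fun_cong[OF eig, of z] n by (simp add: hecke_eq_slash fscale_def field_simps)
    also have "Im (l * f z / of_nat n ^ (?k - 1) * cnj (f z)) = c * (cmod (f z))\<^sup>2"
    proof -
      have "l * f z / of_nat n ^ (?k - 1) * cnj (f z) = of_real ((cmod (f z))\<^sup>2 / real n ^ (?k - 1)) * l"
        unfolding of_real_divide complex_norm_square by simp
      then have "Im (l * f z / of_nat n ^ (?k - 1) * cnj (f z)) = Im (of_real ((cmod (f z))\<^sup>2 / real n ^ (?k - 1)) * l)"
        by (rule arg_cong)
      also have "\<dots> = c * (cmod (f z))\<^sup>2" by (simp add: c_def)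
      finally show ?thesis .
    qed
    finally show ?thesis using True by (simp add: H_def z_def)
  qed (simp add: F_def H_def)
  have smI: "summable (\<lambda>i. \<integral>v. norm (F (e i) v) \<partial>lborel)"
  proof (rule summableI_nonneg_bounded)
    fix N
    have "(\<Sum>i<N. \<integral>v. norm (F (e i) v) \<partial>lborel) = (\<integral>v. (\<Sum>i<N. norm (F (e i) v)) \<partial>lborel)"
      by (intro Bochner_Integration.integral_sum[symmetric] integrable_norm F_int eD)
    also have "\<dots> \<le> (\<integral>v. M\<^sup>2 * real (card (hecke_reps n)) * G v \<partial>lborel)"
      using partial by (intro integral_mono integrable_mult_right G Bochner_Integration.integrable_sum integrable_norm F_int eD) simp
    finally show "(\<Sum>i<N. \<integral>v. norm (F (e i) v) \<partial>lborel) \<le> (\<integral>v. M\<^sup>2 * real (card (hecke_reps n)) * G v \<partial>lborel)" .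
  qed simp
  have smF: "AE v in lborel. summable (\<lambda>i. norm (F (e i) v))"
    using partial by (intro AE_I2 summableI_nonneg_bounded[where x = "M\<^sup>2 * real (card (hecke_reps n)) * G _"]) auto
  have sums: "(\<lambda>i. I (e i)) sums (\<integral>v. c * H v \<partial>lborel)"
    unfolding I_def using sums_integral[OF F_int[OF eD] smF smI] by (simp add: total)
  have "summable (\<lambda>i. norm (I (e i)))"
    by (rule summable_comparison_test'[OF smI, of 0]) (auto simp: I_def)
  \<comment> \<open>Passing to an unordered sum removes the enumeration \<open>e\<close>, so that
    \<open>madj\<close> may reindex it.\<close>
  from norm_summable_imp_has_sum[OF this sums]
  have hs: "(I has_sum (\<integral>v. c * H v \<partial>lborel)) D"
    using has_sum_reindex_bij_betw[OF e, of I] by blast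
  have bij_adj: "bij_betw madj D D"
    by (rule bij_betw_byWitness[where f' = madj]) (use madjD in auto)
  have "((\<lambda>x. I (madj x)) has_sum (\<integral>v. c * H v \<partial>lborel)) D"
    using has_sum_reindex_bij_betw[OF bij_adj, of I] hs by blast
  then have "((\<lambda>x. - I x) has_sum (\<integral>v. c * H v \<partial>lborel)) D"
    using has_sum_cong[of D "\<lambda>x. I (madj x)" "\<lambda>x. - I x"] I_adj by blast
  then have "(I has_sum - (\<integral>v. c * H v \<partial>lborel)) D"
    by (simp add: has_sum_uminus)
  then have zero: "c * (\<integral>v. H v \<partial>lborel) = 0"
    using hs has_sum_unique by (metis integral_mult_right_zero equal_neg_zero)
  show ?thesis
  proof (rule ccontr)
    assume "Im l \<noteq> 0"
    then have c: "c \<noteq> 0" using n by (simp add: c_def)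
    have "integrable lborel (\<lambda>v. c * H v)"
      using integrable_suminf[OF F_int[OF eD] smF smI] by (simp add: total)
    then have Hint: "integrable lborel H" using c by simp
    have W: "?W (vc v) \<ge> 1" if "v \<in> uhp2" for v
      using that by (intro multiplicity_fun_ge_1) (simp add: uhp2_def)
    have H0: "H v \<ge> 0" for v
      using W[of v] by (cases "v \<in> uhp2") (auto simp: H_def uhp2_def)
    have AE: "AE v in lborel. H v = 0"
      using integral_nonneg_eq_0_iff_AE[OF Hint] H0 zero c by auto
    \<comment> \<open>On the interior of the Siegel set H vanishes only where f does. The open set
      where f is nonzero there is null, hence empty, and analytic continuation gives f = 0.\<close>
    define U :: "(real ^ 2) set" where "U = {v. \<bar>v $ 1\<bar> < 1 \<and> v $ 2 > 1 / 2}"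
    have Uuhp: "U \<subseteq> uhp2" by (auto simp: U_def uhp2_def)
    have openU: "open U" unfolding U_def
      by (intro open_Collect_conj open_Collect_less continuous_intros)
    have contf: "continuous_on uhp f"
      using f(1) by (auto simp: cusp_forms_def intro: holomorphic_on_imp_continuous_on)
    have contU: "continuous_on U (\<lambda>v. f (vc v))"
      by (rule continuous_on_compose2[OF contf linear_continuous_on[OF bounded_linear_vc]])
         (use Uuhp in \<open>auto simp: uhp2_def\<close>)
    define N where "N = U \<inter> (\<lambda>v. f (vc v)) -` (- {0})"
    have "open N" unfolding N_def by (rule continuous_open_preimage[OF contU openU]) auto
    have HN: "H v \<noteq> 0" if "v \<in> N" for v
    proof -
      have v: "v \<in> U" "f (vc v) \<noteq> 0" using that by (auto simp: N_def)
      then have "vc v \<in> siegel_set" "v \<in> uhp2" "v $ 2 > 0"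
        using Uuhp by (auto simp: U_def siegel_set_def uhp2_def)
      then show ?thesis using W[of v] v(2) by (auto simp: H_def)
    qed
    then have "AE v in lborel. v \<notin> N" using HN by (intro eventually_mono[OF AE]) blast
    then have "N \<in> null_sets lborel"
      using AE_iff_null_sets[of N lborel] \<open>open N\<close> by auto
    then have "negligible N" by (simp add: negligible_iff_null_sets null_sets_completionI)
    then have "N = {}" using open_not_negligible[OF \<open>open N\<close>] by blast
    have fU: "f z = 0" if "z \<in> vc ` U" for z using \<open>N = {}\<close> that by (auto simp: N_def)
    define V where "V = {z. \<bar>Re z\<bar> < 1 \<and> Im z > 1 / 2}"
    have "f z = 0" if "z \<in> uhp" for z
    proof (rule analytic_continuation_open[of V uhp f "\<lambda>_. 0" z])
      show "open V" unfolding V_def by (intro open_Collect_conj open_Collect_less continuous_intros)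
      have "\<i> \<in> V" by (simp add: V_def)
      then show "V \<noteq> {}" by blast
      show "f holomorphic_on uhp" using f(1) by (simp add: cusp_forms_def)
      show "f z = 0" if "z \<in> V" for z
        by (rule fU, rule image_eqI[where x = "cv z"]) (use that in \<open>auto simp: V_def U_def\<close>)
    qed (use that open_uhp connected_uhp in \<open>auto simp: V_def\<close>)
    then have "f = 0" using f(1) by (auto simp: fun_eq_iff cusp_forms_def)
    then show False using f(2) by simp
  qed
qed

section \<open>The period polynomial as a Mellin transform\<close>

lemma set_integral_sum_complex:
  fixes f :: "'i \<Rightarrow> 'a \<Rightarrow> complex"
  assumes "\<And>i. i \<in> I \<Longrightarrow> set_integrable M A (f i)"
  shows "(LINT x:A|M. (\<Sum>i\<in>I. f i x)) = (\<Sum>i\<in>I. LINT x:A|M. f i x)"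
  using assms unfolding set_integrable_def set_lebesgue_integral_def
  by (simp only: scaleR_sum_right Bochner_Integration.integral_sum)

lemma set_integral_Ici_Ioi:
  fixes f :: "real \<Rightarrow> 'a::{banach, second_countable_topology}"
  assumes "set_integrable lborel {0..} f"
  shows "set_integrable lborel {0<..} f" "(LINT t:{0<..}|lborel. f t) = (LINT t:{0..}|lborel. f t)"
proof -
  show i: "set_integrable lborel {0<..} f"
    by (rule set_integrable_subset[OF assms]) auto
  have "AE t in lborel. t \<noteq> (0::real)" by (rule AE_lborel_singleton)
  then have "AE t in lborel. t \<in> {0::real..} \<longleftrightarrow> t \<in> {0<..}" by eventually_elim auto
  then show "(LINT t:{0<..}|lborel. f t) = (LINT t:{0..}|lborel. f t)"
    using assms i unfolding set_integrable_def
    by (intro set_integral_cong_set) (auto simp: set_borel_measurable_def)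
qed

lemma FTC_Ioi_nonneg:
  fixes f F :: "real \<Rightarrow> real"
  assumes [measurable]: "f \<in> borel_measurable borel"
    and F: "\<And>t. 0 \<le> t \<Longrightarrow> DERIV F t :> f t" and f: "\<And>t. 0 \<le> t \<Longrightarrow> 0 \<le> f t" and lim: "(F \<longlongrightarrow> T) at_top"
  shows "set_integrable lborel {0..} f" "(LINT t:{0<..}|lborel. f t) = T - F 0"
proof -
  have nn: "(\<integral>\<^sup>+ t. ennreal (f t) * indicator {0..} t \<partial>lborel) = ennreal (T - F 0)"
    by (rule nn_integral_FTC_atLeast[OF _ F f lim]) auto
  have eq: "ennreal (indicator {0..} t *\<^sub>R f t) = ennreal (f t) * indicator {0..} t" for t
    by (auto simp: indicator_def)
  show i: "set_integrable lborel {0..} f"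
    unfolding set_integrable_def
  proof (rule integrableI_nonneg)
    show "AE t in lborel. 0 \<le> indicator {0..} t *\<^sub>R f t"
      by (rule AE_I2) (simp add: f indicator_def)
  qed (simp_all only: eq nn, auto)
  have "T - F 0 \<ge> 0"
  proof -
    have "F 0 \<le> F t" if "t \<ge> 0" for t 
      by (rule DERIV_nonneg_imp_nondecreasing[OF that]) (use F f in blast)
    then have "F 0 \<le> T"
      by (intro tendsto_lowerbound[OF lim]) (auto simp: eventually_at_top_linorder)
    then show ?thesis by simp
  qed
  then have "(LINT t:{0..}|lborel. f t) = T - F 0"
    unfolding set_lebesgue_integral_def
    by (subst integral_eq_nn_integral) (simp_all only: eq nn, auto simp: f indicator_def)
  then show "(LINT t:{0<..}|lborel. f t) = T - F 0" using set_integral_Ici_Ioi(2)[OF i] by simp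
qed

lemma FTC_Ioi_dominated:
  fixes f F :: "real \<Rightarrow> 'a::euclidean_space"
  assumes F: "\<And>t. 0 \<le> t \<Longrightarrow> (F has_vector_derivative f t) (at t within {0..})"
    and cont: "continuous_on {0..} f"
    and le: "\<And>t. 0 \<le> t \<Longrightarrow> norm (f t) \<le> g t" and g: "set_integrable lborel {0..} g"
  shows "set_integrable lborel {0<..} f" "(F \<longlongrightarrow> F 0 + (LINT t:{0<..}|lborel. f t)) at_top"
proof -
  have i: "set_integrable lborel {0..} f"
  proof (rule set_integrable_bound[OF g])
    show "set_borel_measurable lborel {0..} f"
      unfolding set_borel_measurable_def using cont
      by (simp add: borel_measurable_continuous_on_indicator)
    show "AE x in lborel. x \<in> {0..} \<longrightarrow> norm (f x) \<le> norm (g x)"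
      using le by (intro AE_I2) (auto intro: order_trans[OF _ abs_ge_self])
  qed
  then show "set_integrable lborel {0<..} f" by (rule set_integral_Ici_Ioi)
  have "((\<lambda>b. LINT t:{0..b}|lborel. f t) \<longlongrightarrow> (LINT t:{0..}|lborel. f t)) at_top"
    by (rule tendsto_set_lebesgue_integral_at_top[OF _ i]) auto
  moreover have "eventually (\<lambda>b. (LINT t:{0..b}|lborel. f t) = F b - F 0) at_top"
    using eventually_ge_at_top[of "0::real"]
  proof eventually_elim
    case (elim b)
    show ?case unfolding set_lebesgue_integral_def
      by (rule integral_FTC_Icc[OF elim])
         (auto intro!: has_vector_derivative_within_subset[OF F] continuous_on_subset[OF cont])
  qed
  ultimately have "((\<lambda>b. F b - F 0) \<longlongrightarrow> (LINT t:{0..}|lborel. f t)) at_top"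
    using tendsto_cong by fast
  from tendsto_add[OF this tendsto_const[of "F 0"]]
  show "(F \<longlongrightarrow> F 0 + (LINT t:{0<..}|lborel. f t)) at_top"
    using set_integral_Ici_Ioi(2)[OF i] by (simp add: add.commute)
qed

lemma set_integrable_exp_minus: "set_integrable lborel {0..} (\<lambda>t. C * exp (- t) :: real)"
proof -
  have "((\<lambda>t::real. - exp (- t)) \<longlongrightarrow> - 0) at_top"
    by (intro tendsto_minus filterlim_compose[OF exp_at_bot] filterlim_uminus_at_bot_at_top)
  then have "set_integrable lborel {0..} (\<lambda>t::real. exp (- t))"
    by (intro FTC_Ioi_nonneg(1)[where F = "\<lambda>t. - exp (- t)"]) (auto intro!: derivative_eq_intros)
  then show ?thesis by (rule set_integrable_mult_right)
qed

section \<open>Cusp forms along vertical rays\<close>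

text \<open>The kernels that multiply f: powers of u - z, of 1 + u z and of - i u. Each is harmless
  against exponential decay.\<close>

definition poly_growth :: "(complex \<Rightarrow> complex) \<Rightarrow> bool" where
  "poly_growth \<psi> \<longleftrightarrow> \<psi> holomorphic_on uhp \<and> (\<exists>C\<ge>0. \<exists>K. \<forall>u. cmod (\<psi> u) \<le> C * (1 + cmod u) ^ K)"

lemma poly_growth_affine_power: "poly_growth (\<lambda>u. (a + b * u) ^ K)"
  unfolding poly_growth_def
proof (intro conjI exI allI)
  fix u
  have "cmod (a + b * u) \<le> cmod a * 1 + cmod b * cmod u"
    using norm_triangle_ineq[of a "b * u"] by (simp add: norm_mult)
  also have "\<dots> \<le> (cmod a + cmod b) * (1 + cmod u)" by (simp add: algebra_simps)
  finally have "cmod ((a + b * u) ^ K) \<le> ((cmod a + cmod b) * (1 + cmod u)) ^ K"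
    unfolding norm_power by (intro power_mono) auto
  then show "cmod ((a + b * u) ^ K) \<le> (cmod a + cmod b) ^ K * (1 + cmod u) ^ K"
    by (simp add: power_mult_distrib)
qed (auto intro!: holomorphic_intros)

lemma cusp_form_times_poly_decay:
  assumes f: "f \<in> cusp_forms k" and \<psi>: "poly_growth \<psi>" and \<eta>: "\<eta> > 0" and R: "R \<ge> 0"
  obtains C where "C \<ge> 0"
    "\<And>u. \<bar>Re u\<bar> \<le> R \<Longrightarrow> Im u \<ge> \<eta> \<Longrightarrow> cmod (f u * \<psi> u) \<le> C * exp (- Im u)"
proof -
  obtain C1 where C1: "C1 \<ge> 0" "\<And>z. Im z \<ge> \<eta> \<Longrightarrow> cmod (f z) \<le> C1 * exp (- 2 * pi * Im z)"
    using cusp_form_decay[OF f \<eta>] by metis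
  obtain C2 K where C2: "C2 \<ge> 0" "\<And>u. cmod (\<psi> u) \<le> C2 * (1 + cmod u) ^ K"
    using \<psi> unfolding poly_growth_def by blast
  define C where "C = C1 * (C2 * (fact K * exp (1 + R)))"
  have "cmod (f u * \<psi> u) \<le> C * exp (- Im u)" if u: "\<bar>Re u\<bar> \<le> R" "Im u \<ge> \<eta>" for u
  proof -
    have "(1 + cmod u) ^ K \<le> fact K * exp (1 + cmod u)" by (rule power_le_fact_exp) simp
    also have "\<dots> \<le> fact K * exp (1 + R + Im u)"
      using cmod_le[of u] u \<eta> by (intro mult_left_mono) auto
    finally have 1: "cmod (\<psi> u) \<le> C2 * (fact K * exp (1 + R + Im u))"
      using C2 by (meson mult_left_mono order_trans)
    have "cmod (f u * \<psi> u) \<le> (C1 * exp (- 2 * pi * Im u)) * (C2 * (fact K * exp (1 + R + Im u)))"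
      unfolding norm_mult using C1 u 1 by (intro mult_mono) auto
    also have "\<dots> = C * exp (- 2 * pi * Im u + Im u)"
    proof -
      have "exp (- 2 * pi * Im u) * exp (1 + R + Im u) = exp (1 + R) * exp (- 2 * pi * Im u + Im u)"
        by (simp add: algebra_simps flip: exp_add)
      then show ?thesis by (simp add: C_def mult_ac)
    qed
    also have "\<dots> \<le> C * exp (- Im u)"
    proof -
      have "2 * Im u \<le> 2 * pi * Im u" using u \<eta> pi_gt3 by simp
      then show ?thesis using C1(1) C2(1) by (intro mult_left_mono) (auto simp: C_def)
    qed
    finally show ?thesis .
  qed
  moreover have "C \<ge> 0" using C1(1) C2(1) by (simp add: C_def)
  ultimately show ?thesis using that by blast
qed

lemma cusp_form_primitive:
  assumes f: "f \<in> cusp_forms k" and \<psi>: "poly_growth \<psi>"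
  obtains P where "\<And>u. Im u > 0 \<Longrightarrow> (P has_field_derivative f u * \<psi> u) (at u)"
proof -
  have "(\<lambda>u. f u * \<psi> u) holomorphic_on uhp"
    using f \<psi> by (intro holomorphic_intros) (auto simp: cusp_forms_def poly_growth_def)
  then obtain P where P: "\<And>u. u \<in> uhp \<Longrightarrow> (P has_field_derivative f u * \<psi> u) (at u within uhp)"
    using holomorphic_convex_primitive'[OF convex_halfspace_Im_gt open_uhp, of "\<lambda>u. f u * \<psi> u"] by auto
  have "(P has_field_derivative f u * \<psi> u) (at u)" if "Im u > 0" for u
  proof -
    have u: "u \<in> uhp" using that by simp
    show ?thesis using P[OF u] unfolding at_within_open[OF u open_uhp] .
  qed
  then show ?thesis using that by blast
qed

text \<open>An integral up to i times infinity becomes the limit of a primitive along the ray, so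
  that moving a contour amounts to comparing two such limits.\<close>

lemma ray_integral:
  assumes f: "f \<in> cusp_forms k" and \<psi>: "poly_growth \<psi>" and z: "Im z > 0"
    and P: "\<And>u. Im u > 0 \<Longrightarrow> (P has_field_derivative f u * \<psi> u) (at u)"
  shows "set_integrable lborel {0<..} (\<lambda>t. f (z + \<i> * of_real t) * \<psi> (z + \<i> * of_real t) * \<i>)"
    and "((\<lambda>t. P (z + \<i> * of_real t)) \<longlongrightarrow>
      P z + (LINT t:{0<..}|lborel. f (z + \<i> * of_real t) * \<psi> (z + \<i> * of_real t) * \<i>)) at_top"
proof -
  obtain C where C: "C \<ge> 0"
    "\<And>u. \<bar>Re u\<bar> \<le> \<bar>Re z\<bar> \<Longrightarrow> Im u \<ge> Im z \<Longrightarrow> cmod (f u * \<psi> u) \<le> C * exp (- Im u)"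
    using cusp_form_times_poly_decay[OF f \<psi> z, of "\<bar>Re z\<bar>"] by auto
  let ?u = "\<lambda>t::real. z + \<i> * of_real t"
  let ?g = "\<lambda>t. f (?u t) * \<psi> (?u t) * \<i>"
  have hol: "(\<lambda>u. f u * \<psi> u) holomorphic_on uhp"
    using f \<psi> by (intro holomorphic_intros) (auto simp: cusp_forms_def poly_growth_def)
  have d: "((\<lambda>t. P (?u t)) has_vector_derivative ?g t) (at t within {0..})" if "0 \<le> t" for t
  proof -
    have "(P has_field_derivative f (?u t) * \<psi> (?u t)) (at (?u t))" using P[of "?u t"] z that by simp
    moreover have "(?u has_vector_derivative \<i>) (at t within {0..})"
      by (auto intro!: derivative_eq_intros)
    ultimately show ?thesis
      using field_vector_diff_chain_within[of ?u \<i> t "{0..}" P "f (?u t) * \<psi> (?u t)"]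
      by (simp add: o_def mult.commute has_field_derivative_at_within)
  qed
  have c: "continuous_on {0..} ?g"
    by (intro continuous_on_mult continuous_on_const
        continuous_on_compose2[OF holomorphic_on_imp_continuous_on[OF hol], of "{0..}" ?u] continuous_intros)
       (use z in auto)
  have b: "norm (?g t) \<le> C * exp (- t)" if "0 \<le> t" for t
  proof -
    have "norm (?g t) \<le> C * exp (- Im (?u t))" using C(2)[of "?u t"] z that by (simp add: norm_mult)
    also have "\<dots> \<le> C * exp (- t)" using C(1) z by (intro mult_left_mono) auto
    finally show ?thesis .
  qed
  show "set_integrable lborel {0<..} ?g"
    by (rule FTC_Ioi_dominated(1)[OF d c b set_integrable_exp_minus])
  show "((\<lambda>t. P (?u t)) \<longlongrightarrow> P z + (LINT t:{0<..}|lborel. ?g t)) at_top"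
    using FTC_Ioi_dominated(2)[OF d c b set_integrable_exp_minus] by simp
qed

text \<open>The segment between the two rays at height t has fixed length, while the derivative of P
  on it is O(exp (- t)).\<close>

lemma ray_limits_agree:
  assumes f: "f \<in> cusp_forms k" and \<psi>: "poly_growth \<psi>" and z: "Im z > 0" and w: "Im w > 0"
    and P: "\<And>u. Im u > 0 \<Longrightarrow> (P has_field_derivative f u * \<psi> u) (at u)"
  shows "((\<lambda>t. P (z + \<i> * of_real t) - P (w + \<i> * of_real t)) \<longlongrightarrow> 0) at_top"
proof -
  define R \<eta> where "R = max \<bar>Re z\<bar> \<bar>Re w\<bar>" and "\<eta> = min (Im z) (Im w)"
  have \<eta>: "\<eta> > 0" using z w by (simp add: \<eta>_def)
  obtain C where C: "C \<ge> 0"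
    "\<And>u. \<bar>Re u\<bar> \<le> R \<Longrightarrow> Im u \<ge> \<eta> \<Longrightarrow> cmod (f u * \<psi> u) \<le> C * exp (- Im u)"
  proof -
    have "R \<ge> 0" by (simp add: R_def)
    then show ?thesis using cusp_form_times_poly_decay[OF f \<psi> \<eta>, of R] that by metis
  qed
  have le: "norm (P (z + \<i> * of_real t) - P (w + \<i> * of_real t)) \<le> C * exp (- t) * norm (z - w)" if t: "t \<ge> 0" for t
  proof -
    define S where "S = {u. \<bar>Re u\<bar> \<le> R \<and> Im u \<ge> \<eta> + t}"
    have "S = {u. Re u \<le> R} \<inter> {u. Re u \<ge> - R} \<inter> {u. Im u \<ge> \<eta> + t}" by (auto simp: S_def)
    then have "convex S"
      by (simp only: convex_Int convex_halfspace_Re_le convex_halfspace_Re_ge convex_halfspace_Im_ge)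
    moreover have "(P has_field_derivative f u * \<psi> u) (at u within S)" if "u \<in> S" for u
      using P[of u] that \<eta> t by (auto simp: S_def intro: has_field_derivative_at_within)
    moreover have "norm (f u * \<psi> u) \<le> C * exp (- t)" if "u \<in> S" for u
    proof -
      have "norm (f u * \<psi> u) \<le> C * exp (- Im u)" using C(2)[of u] that t by (simp add: S_def)
      also have "\<dots> \<le> C * exp (- t)" using that C(1) \<eta> by (intro mult_left_mono) (auto simp: S_def)
      finally show ?thesis .
    qed
    moreover have "z + \<i> * of_real t \<in> S" "w + \<i> * of_real t \<in> S" by (auto simp: S_def R_def \<eta>_def)
    ultimately have "norm (P (z + \<i> * of_real t) - P (w + \<i> * of_real t)) \<le>
        C * exp (- t) * norm ((z + \<i> * of_real t) - (w + \<i> * of_real t))"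
      by (rule field_differentiable_bound)
    then show ?thesis by simp
  qed
  have "((\<lambda>t::real. exp (- t)) \<longlongrightarrow> 0) at_top"
    by (intro filterlim_compose[OF exp_at_bot] filterlim_uminus_at_bot_at_top)
  then have "((\<lambda>t. C * exp (- t) * norm (z - w)) \<longlongrightarrow> C * 0 * norm (z - w)) at_top"
    by (intro tendsto_intros)
  then have lim: "((\<lambda>t. C * exp (- t) * norm (z - w)) \<longlongrightarrow> 0) at_top" by simp
  show ?thesis
    by (rule Lim_null_comparison[OF eventually_mono[OF eventually_ge_at_top[of "0::real"] le] lim])
qed

text \<open>Moving the contours of both Eichler integrals to the imaginary axis: a primitive \<open>P\<close> of
  \<open>f(u) (u - z)\<^sup>k\<^sup>-\<^sup>2\<close> and its transform \<open>P(-1/u)\<close> take the same values at \<open>z\<close> and at \<open>i\<close>.\<close>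

lemma eichler_cocycle:
  assumes f: "f \<in> cusp_forms (2 * h)" and h: "h \<ge> 1" and z: "Im z > 0"
  defines "K \<equiv> 2 * h - 2"
  shows "eichler_integral (2 * h) f z - z ^ K * eichler_integral (2 * h) f (- 1 / z) =
    (LINT t:{0<..}|lborel. f (\<i> + \<i> * of_real t) * ((\<i> + \<i> * of_real t) - z) ^ K * \<i>) -
    (LINT t:{0<..}|lborel. f (\<i> + \<i> * of_real t) * (1 + (\<i> + \<i> * of_real t) * z) ^ K * \<i>)"
proof -
  define \<psi>1 where "\<psi>1 u = (- z + 1 * u) ^ K" for u
  define \<psi>2 where "\<psi>2 u = (1 + z * u) ^ K" for u
  have g1: "poly_growth \<psi>1" and g2: "poly_growth \<psi>2"
    unfolding \<psi>1_def[abs_def] \<psi>2_def[abs_def] by (rule poly_growth_affine_power)+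
  obtain P where P: "\<And>u. Im u > 0 \<Longrightarrow> (P has_field_derivative f u * \<psi>1 u) (at u)"
    using cusp_form_primitive[OF f g1] by metis
  \<comment> \<open>The powers cancel: u^(2h) from modularity, u^-K from the kernel (K is even) and
    u^-2 from the derivative of - 1 / u. So Q is a primitive for the second kernel.\<close>
  define Q where "Q u = P (- 1 / u)" for u
  have Q: "(Q has_field_derivative f u * \<psi>2 u) (at u)" if u: "Im u > 0" for u
  proof -
    have u0: "u \<noteq> 0" using u by auto
    have Imu: "Im (- 1 / u) > 0" using Im_mact_pos[OF u, of "(0, -1, 1, 0)"] by simp
    have fu: "f (- 1 / u) = u ^ (2 * h) * f u"
      using cusp_forms_mact[OF f, of "(0, -1, 1, 0)" u] u by (simp add: SL2Z_def)
    have "((\<lambda>u. - 1 / u) has_field_derivative 1 / u\<^sup>2) (at u)"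
      using u0 by (auto intro!: derivative_eq_intros simp: power2_eq_square)
    from DERIV_chain2[OF P[OF Imu] this]
    have "(Q has_field_derivative f (- 1 / u) * \<psi>1 (- 1 / u) * (1 / u\<^sup>2)) (at u)"
      unfolding Q_def[abs_def] .
    moreover have "f (- 1 / u) * \<psi>1 (- 1 / u) * (1 / u\<^sup>2) = f u * \<psi>2 u"
    proof -
      have evenK: "even K" by (simp add: K_def)
      have "- z + 1 * (- 1 / u) = - (1 + z * u) / u" using u0 by (simp add: field_simps)
      then have "\<psi>1 (- 1 / u) = \<psi>2 u / u ^ K"
        unfolding \<psi>1_def \<psi>2_def by (simp only: power_divide power_minus_even[OF evenK])
      moreover have "2 * h = K + 2" using h unfolding K_def by simp
      then have "u ^ (2 * h) = u ^ K * u\<^sup>2" by (simp only: power_add)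
      ultimately show ?thesis using u0 unfolding fu by simp
    qed
    ultimately show ?thesis by simp
  qed
  have z0: "z \<noteq> 0" using z by auto
  define w where "w = - 1 / z"
  have w: "Im w > 0" using Im_mact_pos[OF z, of "(0, -1, 1, 0)"] by (simp add: w_def)
  have i: "Im \<i> > 0" by simp
  define J where "J \<psi> v = (LINT t:{0<..}|lborel. f (v + \<i> * of_real t) * \<psi> (v + \<i> * of_real t) * \<i>)" for \<psi> v
  have lim: "P z + J \<psi>1 z = P \<i> + J \<psi>1 \<i>" "Q w + J \<psi>2 w = Q \<i> + J \<psi>2 \<i>"
  proof -
    have "((\<lambda>t. P (z + \<i> * of_real t) - P (\<i> + \<i> * of_real t)) \<longlongrightarrow> (P z + J \<psi>1 z) - (P \<i> + J \<psi>1 \<i>)) at_top"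
      unfolding J_def by (intro tendsto_diff ray_integral(2)[OF f g1 z P] ray_integral(2)[OF f g1 i P])
    then have "(P z + J \<psi>1 z) - (P \<i> + J \<psi>1 \<i>) = 0"
      using ray_limits_agree[OF f g1 z i P] by (rule tendsto_unique[rotated]) auto
    then show "P z + J \<psi>1 z = P \<i> + J \<psi>1 \<i>" by simp
    have "((\<lambda>t. Q (w + \<i> * of_real t) - Q (\<i> + \<i> * of_real t)) \<longlongrightarrow> (Q w + J \<psi>2 w) - (Q \<i> + J \<psi>2 \<i>)) at_top"
      unfolding J_def by (intro tendsto_diff ray_integral(2)[OF f g2 w Q] ray_integral(2)[OF f g2 i Q])
    then have "(Q w + J \<psi>2 w) - (Q \<i> + J \<psi>2 \<i>) = 0"
      using ray_limits_agree[OF f g2 w i Q] by (rule tendsto_unique[rotated]) auto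
    then show "Q w + J \<psi>2 w = Q \<i> + J \<psi>2 \<i>" by simp
  qed
  \<comment> \<open>The map - 1 / u sends w to z and fixes i, so the boundary terms of P and Q
    coincide and cancel in the difference.\<close>
  have QP: "Q w = P z" "Q \<i> = P \<i>" using z0 by (simp_all add: Q_def w_def)
  have "eichler_integral (2 * h) f z = J \<psi>1 z"
    unfolding eichler_integral_def J_def \<psi>1_def K_def by simp
  moreover have "z ^ K * eichler_integral (2 * h) f w = J \<psi>2 w"
  proof -
    have "J \<psi>2 w = (LINT t:{0<..}|lborel. z ^ K * (f (w + \<i> * of_real t) * (\<i> * of_real t) ^ K * \<i>))"
      unfolding J_def \<psi>2_def
    proof (intro set_lebesgue_integral_cong allI impI)
      fix t :: real
      have "1 + z * (w + \<i> * of_real t) = z * (\<i> * of_real t)" using z0 by (simp add: w_def field_simps)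
      then show "f (w + \<i> * of_real t) * (1 + z * (w + \<i> * of_real t)) ^ K * \<i> =
          z ^ K * (f (w + \<i> * of_real t) * (\<i> * of_real t) ^ K * \<i>)"
        by (simp add: power_mult_distrib)
    qed simp
    then show ?thesis unfolding eichler_integral_def K_def by simp
  qed
  moreover have "J \<psi>1 z - J \<psi>2 w = J \<psi>1 \<i> - J \<psi>2 \<i>"
    using lim unfolding QP by (metis add_diff_cancel_left)
  ultimately have "eichler_integral (2 * h) f z - z ^ K * eichler_integral (2 * h) f w = J \<psi>1 \<i> - J \<psi>2 \<i>"
    by (simp only:)
  then show ?thesis by (simp add: w_def J_def \<psi>1_def \<psi>2_def mult.commute)
qed

section \<open>Period coefficients as moments on the imaginary axis\<close>

text \<open>The Mellin transform of f(i y) against y^(2h-2-n) over (0, infinity), folded at y = 1 by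
  f(i / y) = (-1)^h y^(2h) f(i y). In the folded form y = 1 + t >= 1, where the Fourier expansion
  converges fast.\<close>

definition period_moment :: "nat \<Rightarrow> (complex \<Rightarrow> complex) \<Rightarrow> nat \<Rightarrow> complex" where
  "period_moment h f n = (LINT t:{0<..}|lborel.
     f (\<i> + \<i> * of_real t) * of_real ((1 + t) ^ (2 * h - 2 - n) + (- 1) ^ h * (1 + t) ^ n))"

definition period_coeff :: "nat \<Rightarrow> (complex \<Rightarrow> complex) \<Rightarrow> nat \<Rightarrow> complex" where
  "period_coeff h f n = of_nat ((2 * h - 2) choose n) * period_moment h f n"

lemma period_integrable:
  assumes f: "f \<in> cusp_forms k"
  shows "set_integrable lborel {0<..} (\<lambda>t. f (\<i> + \<i> * of_real t) * of_real ((1 + t) ^ j))"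
proof -
  define \<psi> where "\<psi> u = (0 + (- \<i>) * u) ^ j" for u
  have g: "poly_growth \<psi>" unfolding \<psi>_def[abs_def] by (rule poly_growth_affine_power)
  obtain P where P: "\<And>u. Im u > 0 \<Longrightarrow> (P has_field_derivative f u * \<psi> u) (at u)"
    using cusp_form_primitive[OF f g] by metis
  have "\<psi> (\<i> + \<i> * of_real t) = of_real ((1 + t) ^ j)" for t
    by (simp add: \<psi>_def algebra_simps)
  then show ?thesis
    using ray_integral(1)[OF f g _ P, of \<i>] by (simp add: set_integrable_mult_left_iff)
qed

text \<open>With w = i z and s = 1 + t the two kernels of \<open>eichler_cocycle\<close> become i^K
  (w + s)^K and (s w + 1)^K, where i^K = - (-1)^h; the binomial theorem then pairs the powers
  s^(K-n) and s^n.\<close>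

lemma period_poly_eq:
  assumes f: "f \<in> cusp_forms (2 * h)" and h: "h \<ge> 1"
  shows "poly (period_poly (2 * h) f) z =
    - \<i> * (- 1) ^ h * (\<Sum>n\<le>2 * h - 2. period_coeff h f n * (\<i> * z) ^ n)"
proof -
  define K where "K = 2 * h - 2"
  define e :: complex where "e = (- 1) ^ h"
  have ee: "e * e = 1" unfolding e_def by (simp flip: power_mult_distrib)
  have iK: "\<i> ^ K = - e"
  proof -
    have "K = 2 * (h - 1)" unfolding K_def by simp
    then have "\<i> ^ K = (- 1) ^ (h - 1)" by (simp add: power_mult)
    also have "\<dots> = - e" using h unfolding e_def by (cases h) auto
    finally show ?thesis .
  qed
  let ?R = "\<lambda>z. eichler_integral (2 * h) f z - z ^ (2 * h - 2) * eichler_integral (2 * h) f (- 1 / z)"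
  have int: "set_integrable lborel {0<..} (\<lambda>t. f (\<i> + \<i> * of_real t) * of_real ((1 + t) ^ (K - n) + (- 1) ^ h * (1 + t) ^ n))" for n
  proof -
    have "set_integrable lborel {0<..} (\<lambda>t. f (\<i> + \<i> * of_real t) * of_real ((1 + t) ^ (K - n)) +
        e * (f (\<i> + \<i> * of_real t) * of_real ((1 + t) ^ n)))"
      by (intro set_integral_add set_integrable_mult_right period_integrable[OF f])
    then show ?thesis by (simp add: e_def algebra_simps)
  qed
  have R: "?R z = - \<i> * e * (\<Sum>n\<le>K. period_coeff h f n * (\<i> * z) ^ n)" if z: "Im z > 0" for z
  proof -
    define w where "w = \<i> * z"
    have zw: "z = - \<i> * w" by (simp add: w_def)
    let ?F = "\<lambda>t::real. f (\<i> + \<i> * of_real t)"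
    have exp: "?F t * ((\<i> + \<i> * of_real t) - z) ^ K * \<i> - ?F t * (1 + (\<i> + \<i> * of_real t) * z) ^ K * \<i> =
        (\<Sum>n\<le>K. (- \<i> * e * (of_nat (K choose n) * w ^ n)) *
          (?F t * of_real ((1 + t) ^ (K - n) + (- 1) ^ h * (1 + t) ^ n)))" for t
    proof -
      define s where "s = complex_of_real (1 + t)"
      have 1: "(\<i> + \<i> * of_real t) - z = \<i> * (w + s)" by (simp add: zw s_def algebra_simps)
      have 2: "1 + (\<i> + \<i> * of_real t) * z = s * w + 1" by (simp add: zw s_def algebra_simps)
      have "((\<i> + \<i> * of_real t) - z) ^ K - (1 + (\<i> + \<i> * of_real t) * z) ^ K = - e * ((w + s) ^ K + e * (s * w + 1) ^ K)"
        unfolding 1 2 power_mult_distrib iK using ee by (simp add: distrib_left mult.assoc[symmetric])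
      also have "(w + s) ^ K + e * (s * w + 1) ^ K = (\<Sum>n\<le>K. of_nat (K choose n) * w ^ n * (s ^ (K - n) + e * s ^ n))"
        unfolding binomial_ring by (simp add: sum_distrib_left power_mult_distrib algebra_simps flip: sum.distrib)
      finally have "?F t * (((\<i> + \<i> * of_real t) - z) ^ K - (1 + (\<i> + \<i> * of_real t) * z) ^ K) * \<i> =
          ?F t * (- e * (\<Sum>n\<le>K. of_nat (K choose n) * w ^ n * (s ^ (K - n) + e * s ^ n))) * \<i>" by simp
      moreover have "of_real ((1 + t) ^ (K - n) + (- 1) ^ h * (1 + t) ^ n) = s ^ (K - n) + e * s ^ n" for n
        by (simp add: s_def e_def)
      ultimately show ?thesis by (simp add: sum_distrib_left sum_distrib_right algebra_simps)
    qed
    have i1: "set_integrable lborel {0<..} (\<lambda>t. ?F t * ((\<i> + \<i> * of_real t) - z) ^ K * \<i>)" and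
      i2: "set_integrable lborel {0<..} (\<lambda>t. ?F t * (1 + (\<i> + \<i> * of_real t) * z) ^ K * \<i>)"
    proof -
      have *: "set_integrable lborel {0<..} (\<lambda>t. ?F t * \<psi> (\<i> + \<i> * of_real t) * \<i>)" if g: "poly_growth \<psi>" for \<psi>
      proof -
        obtain P where P: "\<And>u. Im u > 0 \<Longrightarrow> (P has_field_derivative f u * \<psi> u) (at u)"
          using cusp_form_primitive[OF f g] by metis
        show ?thesis by (rule ray_integral(1)[OF f g _ P]) auto
      qed
      show "set_integrable lborel {0<..} (\<lambda>t. ?F t * ((\<i> + \<i> * of_real t) - z) ^ K * \<i>)"
        using *[OF poly_growth_affine_power[of "- z" 1 K]] by simp
      show "set_integrable lborel {0<..} (\<lambda>t. ?F t * (1 + (\<i> + \<i> * of_real t) * z) ^ K * \<i>)"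
        using *[OF poly_growth_affine_power[of 1 z K]] by (simp add: mult.commute)
    qed
    have "?R z = (LINT t:{0<..}|lborel. ?F t * ((\<i> + \<i> * of_real t) - z) ^ K * \<i> - ?F t * (1 + (\<i> + \<i> * of_real t) * z) ^ K * \<i>)"
      using eichler_cocycle[OF f h z] set_integral_diff(2)[OF i1 i2] by (simp add: K_def)
    also have "\<dots> = (\<Sum>n\<le>K. (- \<i> * e * (of_nat (K choose n) * w ^ n)) * period_moment h f n)"
      unfolding exp period_moment_def K_def[symmetric]
      by (simp only: set_integral_sum_complex[OF set_integrable_mult_right[OF int]] set_integral_mult_right)
    also have "\<dots> = - \<i> * e * (\<Sum>n\<le>K. period_coeff h f n * (\<i> * z) ^ n)"
      unfolding sum_distrib_left by (intro sum.cong refl) (simp add: period_coeff_def K_def w_def)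
    finally show ?thesis .
  qed
  define p where "p = (\<Sum>n\<le>K. monom (- \<i> * e * period_coeff h f n * \<i> ^ n) n)"
  have p: "poly p z = - \<i> * e * (\<Sum>n\<le>K. period_coeff h f n * (\<i> * z) ^ n)" for z
    unfolding p_def poly_sum poly_monom sum_distrib_left
    by (intro sum.cong refl) (simp add: power_mult_distrib mult_ac)
  have "period_poly (2 * h) f = p"
    unfolding period_poly_def
  proof (rule the_equality)
    show "\<forall>z. 0 < Im z \<longrightarrow> poly p z = ?R z" using R p by simp
    fix q assume q: "\<forall>z. 0 < Im z \<longrightarrow> poly q z = ?R z"
    have "\<not> finite {z. poly (q - p) z = 0}"
    proof
      assume "finite {z. poly (q - p) z = 0}"
      moreover have "uhp \<subseteq> {z. poly (q - p) z = 0}" using q R p by auto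
      ultimately have "finite uhp" by (rule finite_subset[rotated])
      moreover have "\<i> \<in> uhp" by simp
      ultimately show False using open_uhp finite_imp_not_open by blast
    qed
    then show "q = p" using poly_roots_finite[of "q - p"] by auto
  qed
  then show ?thesis using p by (simp add: e_def K_def)
qed

section \<open>Zeros of self-reciprocal polynomials\<close>

text \<open>The polynomial splits as q + \<epsilon> w r, with q the lower half and r its reversal.
  On the circle |r| = |q| since the coefficients are real; as q has no zero in the closed disc, the
  maximum principle gives |r| <= |q| inside, where |w| < 1 excludes q = - \<epsilon> w r.
  Self-reciprocity carries zeros outside to zeros inside.\<close>

lemma self_reciprocal_zeros:
  fixes p :: "nat \<Rightarrow> complex" and \<epsilon> :: complex
  assumes H: "H \<ge> 1" and real: "\<And>n. cnj (p n) = p n"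
    and sym: "\<And>n. n \<le> 2 * H \<Longrightarrow> p (2 * H - n) = \<epsilon> * p n" and \<epsilon>: "\<epsilon> * \<epsilon> = 1"
    and q: "\<And>w. norm w \<le> 1 \<Longrightarrow> (\<Sum>n<H. p n * w ^ n) + p H / 2 * w ^ H \<noteq> 0"
    and zero: "(\<Sum>n\<le>2 * H. p n * w ^ n) = 0"
  shows "norm w = 1"
proof -
  have n\<epsilon>: "norm \<epsilon> = 1"
  proof -
    have "norm \<epsilon> * norm \<epsilon> = 1" using \<epsilon> by (metis norm_mult norm_one)
    then show ?thesis by (metis norm_ge_zero power2_eq_square power2_eq_1_iff less_le_not_le zero_less_one neg_0_le_iff_le)
  qed
  define q where "q w = (\<Sum>n<H. p n * w ^ n) + p H / 2 * w ^ H" for w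
  define r where "r w = (\<Sum>n<H. p n * w ^ (2 * H - 1 - n)) + p H / 2 * w ^ (H - 1)" for w
  define P where "P w = (\<Sum>n\<le>2 * H. p n * w ^ n)" for w
  have P_eq: "P w = q w + \<epsilon> * (w * r w)" for w
  proof -
    have "{..2 * H} = {..<H} \<union> {H} \<union> {H<..2 * H}" by auto
    then have "P w = (\<Sum>n<H. p n * w ^ n) + p H * w ^ H + (\<Sum>n\<in>{H<..2 * H}. p n * w ^ n)"
      unfolding P_def by (simp only:) (subst sum.union_disjoint; force)+
    also have "(\<Sum>n\<in>{H<..2 * H}. p n * w ^ n) = (\<Sum>n<H. p (2 * H - n) * w ^ (2 * H - n))"
      by (rule sum.reindex_bij_witness[of _ "\<lambda>n. 2 * H - n" "\<lambda>n. 2 * H - n"]) auto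
    also have "\<dots> = \<epsilon> * (\<Sum>n<H. p n * w ^ (2 * H - n))"
      unfolding sum_distrib_left by (intro sum.cong refl) (simp add: sym)
    also have "(\<Sum>n<H. p n * w ^ (2 * H - n)) = w * (\<Sum>n<H. p n * w ^ (2 * H - 1 - n))"
      unfolding sum_distrib_left
    proof (intro sum.cong refl)
      fix n assume "n \<in> {..<H}"
      then have "2 * H - n = Suc (2 * H - 1 - n)" by auto
      then show "p n * w ^ (2 * H - n) = w * (p n * w ^ (2 * H - 1 - n))" by simp
    qed
    \<comment> \<open>The middle term is shared equally between q and its reversal. This is
      consistent because p H = \<epsilon> p H, so it vanishes when \<epsilon> = -1.\<close>
    also have "p H * w ^ H = p H / 2 * w ^ H + \<epsilon> * (w * (p H / 2 * w ^ (H - 1)))"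
    proof -
      have "p H = \<epsilon> * p H" using sym[of H] by simp
      moreover have "w * w ^ (H - 1) = w ^ H" using H by (metis Suc_diff_1 less_eq_Suc_le One_nat_def power_Suc)
      ultimately have "\<epsilon> * (w * (p H / 2 * w ^ (H - 1))) = p H / 2 * w ^ H"
        by (metis (no_types, opaque_lifting) mult.assoc mult.left_commute times_divide_eq_right)
      then show ?thesis by (simp only:) simp
    qed
    finally show ?thesis by (simp add: q_def r_def algebra_simps)
  qed
  have hq: "q holomorphic_on A" and hr: "r holomorphic_on A" for A
    unfolding q_def[abs_def] r_def[abs_def] by (intro holomorphic_intros)+
  have q0: "q w \<noteq> 0" if "norm w \<le> 1" for w using q[OF that] by (simp add: q_def)
  have on_circle: "norm (r w) = norm (q w)" if w: "norm w = 1" for w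
  proof -
    have w0: "w \<noteq> 0" using w by auto
    have "cnj w * w = 1" using w by (simp add: complex_norm_square[symmetric] mult.commute)
    have pow: "w ^ (2 * H - 1) * cnj w ^ n = w ^ (2 * H - 1 - n)" if "n \<le> 2 * H - 1" for n
    proof -
      have "w ^ (2 * H - 1) = w ^ (2 * H - 1 - n) * w ^ n"
        using that by (metis le_add_diff_inverse2 power_add)
      then have "w ^ (2 * H - 1) * cnj w ^ n = w ^ (2 * H - 1 - n) * (cnj w * w) ^ n"
        by (simp add: power_mult_distrib mult_ac)
      then show ?thesis using \<open>cnj w * w = 1\<close> by simp
    qed
    have "w ^ (2 * H - 1) * cnj (q w) = (\<Sum>n<H. p n * (w ^ (2 * H - 1) * cnj w ^ n)) + p H / 2 * (w ^ (2 * H - 1) * cnj w ^ H)"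
      by (simp add: q_def real sum_distrib_left algebra_simps)
    also have "\<dots> = r w"
    proof -
      have "2 * H - 1 - H = H - 1" by simp
      then have "w ^ (2 * H - 1) * cnj w ^ H = w ^ (H - 1)" using pow[of H] H by simp
      moreover have "(\<Sum>n<H. p n * (w ^ (2 * H - 1) * cnj w ^ n)) = (\<Sum>n<H. p n * w ^ (2 * H - 1 - n))"
        by (intro sum.cong refl) (use pow in auto)
      ultimately show ?thesis unfolding r_def by (simp only:)
    qed
    finally have "norm (r w) = norm w ^ (2 * H - 1) * norm (q w)"
      by (metis complex_mod_cnj norm_mult norm_power)
    then show ?thesis using w by simp
  qed
  have inside: "P w \<noteq> 0" if w: "norm w < 1" for w
  proof
    assume "P w = 0"
    have "norm (r w / q w) \<le> 1"
    proof (rule maximum_modulus_frontier[where S = "ball 0 1" and f = "\<lambda>w. r w / q w"])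
      show "(\<lambda>w. r w / q w) holomorphic_on interior (ball 0 1)"
        using q0 by (intro holomorphic_intros hq hr) auto
      show "continuous_on (closure (ball 0 1)) (\<lambda>w. r w / q w)"
        using q0 by (intro continuous_on_divide holomorphic_on_imp_continuous_on hq hr) auto
      show "norm (r z / q z) \<le> 1" if "z \<in> frontier (ball 0 1)" for z
        using on_circle[of z] that by (simp add: norm_divide)
    qed (use w in auto)
    moreover have "norm (q w) = norm w * norm (r w)"
    proof -
      have "q w = - (\<epsilon> * (w * r w))" using P_eq[of w] \<open>P w = 0\<close> by (simp add: eq_neg_iff_add_eq_0)
      then show ?thesis using n\<epsilon> by (simp add: norm_mult)
    qed
    moreover have "norm (r w) \<le> norm (q w)"
      using \<open>norm (r w / q w) \<le> 1\<close> q0[of w] w by (simp only: norm_divide) (simp add: divide_le_eq)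
    ultimately have "norm (q w) \<le> norm w * norm (q w)" by (metis mult_left_mono norm_ge_zero)
    then show False using q0[of w] w by simp
  qed
  have Pw: "P w = 0" using zero by (simp add: P_def)
  then have "\<not> norm w < 1" using inside by blast
  moreover have "\<not> norm w > 1"
  proof
    assume w: "norm w > 1"
    then have w0: "w \<noteq> 0" by auto
    have "w ^ (2 * H) * P (1 / w) = (\<Sum>n\<le>2 * H. p n * w ^ (2 * H - n))"
      unfolding P_def sum_distrib_left
      by (intro sum.cong refl) (use w0 in \<open>simp add: power_diff power_divide\<close>)
    also have "\<dots> = (\<Sum>n\<le>2 * H. p (2 * H - n) * w ^ n)"
      by (rule sum.reindex_bij_witness[of _ "\<lambda>n. 2 * H - n" "\<lambda>n. 2 * H - n"]) auto
    also have "\<dots> = \<epsilon> * P w"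
      unfolding P_def sum_distrib_left by (intro sum.cong refl) (simp add: sym)
    finally have "P (1 / w) = 0" using Pw w0 by simp
    moreover have "norm (1 / w) < 1" using w w0 by (simp add: norm_divide divide_less_eq)
    ultimately show False using inside by blast
  qed
  ultimately show ?thesis by simp
qed

section \<open>Estimates for the period polynomial\<close>

text \<open>Rankin's trick: for i >= N one has x^i <= (1/8)^N (8 x)^i, so the tail is at most
  (1/8)^N times an exponential series. For x = 2 pi and N >= 89 the gain 8^-N far outweighs exp (8
  x).\<close>

lemma exp_tail_le:
  fixes x :: real
  assumes "x \<ge> 0"
  shows "0 \<le> exp x - (\<Sum>i<N. x ^ i / fact i)" "exp x - (\<Sum>i<N. x ^ i / fact i) \<le> (1 / 8) ^ N * exp (8 * x)"
    and "finite A \<Longrightarrow> (\<Sum>i\<in>A. x ^ i / fact i) \<le> exp x"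
proof -
  have e: "(\<lambda>i. x ^ i / fact i) sums exp x" for x :: real
    using exp_converges[of x] by (simp add: divide_inverse mult.commute)
  have s: "(\<lambda>i. x ^ (i + N) / fact (i + N)) sums (exp x - (\<Sum>i<N. x ^ i / fact i))"
    by (rule sums_split_initial_segment[OF e])
  show "0 \<le> exp x - (\<Sum>i<N. x ^ i / fact i)"
    using sums_le[OF _ sums_zero s] assms by simp
  have s8: "(\<lambda>i. (1 / 8) ^ N * ((8 * x) ^ (i + N) / fact (i + N))) sums ((1 / 8) ^ N * (exp (8 * x) - (\<Sum>i<N. (8 * x) ^ i / fact i)))"
    by (intro sums_mult sums_split_initial_segment[OF e])
  have "x ^ (i + N) / fact (i + N) \<le> (1 / 8) ^ N * ((8 * x) ^ (i + N) / fact (i + N))" for i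
  proof -
    have "(1 / 8) ^ N * (8 * x) ^ (i + N) = 8 ^ i * x ^ (i + N)"
      by (simp add: power_mult_distrib power_add power_divide)
    moreover have "1 * x ^ (i + N) \<le> 8 ^ i * x ^ (i + N)"
      using assms by (intro mult_right_mono) auto
    ultimately have "x ^ (i + N) \<le> (1 / 8) ^ N * (8 * x) ^ (i + N)" by (simp only: mult_1)
    from divide_right_mono[OF this, of "fact (i + N)"] show ?thesis by (simp only: times_divide_eq_right) simp
  qed
  then have "exp x - (\<Sum>i<N. x ^ i / fact i) \<le> (1 / 8) ^ N * (exp (8 * x) - (\<Sum>i<N. (8 * x) ^ i / fact i))"
    by (rule sums_le[OF _ s s8])
  also have "\<dots> \<le> (1 / 8) ^ N * exp (8 * x)"
    using assms by (intro mult_left_mono) (auto intro!: sum_nonneg)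
  finally show "exp x - (\<Sum>i<N. x ^ i / fact i) \<le> (1 / 8) ^ N * exp (8 * x)" .
  show "(\<Sum>i\<in>A. x ^ i / fact i) \<le> exp x" if "finite A"
    using sum_le_suminf[OF sums_summable[OF e] that, of x] sums_unique[OF e, of x] assms by simp
qed

lemma sum_inverse_squares_from_2:
  "(\<lambda>n. 1 / (real n + 1) - 1 / (real n + 2)) sums 1"
  "1 / (real n + 2) ^ 2 \<le> 1 / (real n + 1) - 1 / (real n + 2)"
proof -
  have "(\<lambda>n. 1 / real (Suc n)) \<longlonglongrightarrow> 0"
    using LIMSEQ_inverse_real_of_nat by (simp add: inverse_eq_divide)
  from telescope_sums'[OF this]
  show "(\<lambda>n. 1 / (real n + 1) - 1 / (real n + 2)) sums 1" by (simp add: add.commute)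
  have "1 / (real n + 1) - 1 / (real n + 2) = 1 / ((real n + 1) * (real n + 2))" by (simp add: field_simps)
  then show "1 / (real n + 2) ^ 2 \<le> 1 / (real n + 1) - 1 / (real n + 2)"
    by (simp add: power2_eq_square frac_le)
qed

section \<open>Cusp forms and their moments on the imaginary axis\<close>

lemma cusp_form_axis_expansion:
  assumes "f \<in> cusp_forms k" "s > 0"
  shows "(\<lambda>n. qcoeff f n * of_real (exp (- 2 * pi * s) ^ n)) sums f (\<i> * of_real s)"
proof -
  have "2 * of_real pi * \<i> * (\<i> * of_real s) = complex_of_real (- 2 * pi * s)"
    by (simp add: algebra_simps)
  then have "exp (2 * of_real pi * \<i> * (\<i> * of_real s)) = complex_of_real (exp (- 2 * pi * s))"
    by (simp only: exp_of_real)
  moreover have "(\<lambda>n. qcoeff f n * exp (2 * of_real pi * \<i> * (\<i> * of_real s)) ^ n) sums f (\<i> * of_real s)"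
    using cusp_form_q_expansion(1)[OF assms(1)] assms(2) unfolding has_q_expansion_def by simp
  ultimately show ?thesis by simp
qed

lemma cusp_form_axis_real:
  assumes f: "f \<in> cusp_forms k" and real: "\<And>n. Im (qcoeff f n) = 0" and s: "s > 0"
  shows "Im (f (\<i> * of_real s)) = 0"
proof -
  have "(\<lambda>n. Im (qcoeff f n * of_real (exp (- 2 * pi * s) ^ n))) sums Im (f (\<i> * of_real s))"
    by (rule sums_Im[OF cusp_form_axis_expansion[OF f s]])
  then have "(\<lambda>n. 0) sums Im (f (\<i> * of_real s))" using real by simp
  then show ?thesis using sums_unique2 sums_zero by blast
qed

text \<open>The exponential is weakened to exp (- y) <= \<sigma>! / y^\<sigma>, which has the size
  of a Gamma factor and so compares directly with the main term. Of l^(m - \<sigma>) two powers make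
  the sum over l >= 2 converge, and the others give the power of 1/2.\<close>

lemma cusp_form_axis_tail:
  assumes f: "f \<in> cusp_forms k" and a1: "qcoeff f 1 = of_real A" and A: "A \<ge> 0"
    and a: "\<And>n. n \<ge> 1 \<Longrightarrow> cmod (qcoeff f n) \<le> A * real n ^ m" and s: "s > 0" and \<sigma>: "\<sigma> \<ge> m + 2"
  shows "cmod (f (\<i> * of_real s) - of_real (A * exp (- 2 * pi * s))) \<le>
    A * fact \<sigma> / (2 * pi * s) ^ \<sigma> * (1 / 2) ^ (\<sigma> - m - 2)"
proof -
  define x where "x = exp (- 2 * pi * s)"
  define B where "B = A * fact \<sigma> / (2 * pi * s) ^ \<sigma> * (1 / 2) ^ (\<sigma> - m - 2)"
  have B: "B \<ge> 0" using A s by (simp add: B_def)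
  have "(\<lambda>n. qcoeff f (n + 2) * of_real (x ^ (n + 2))) sums (f (\<i> * of_real s) - (\<Sum>n<2. qcoeff f n * of_real (x ^ n)))"
    unfolding x_def by (rule sums_split_initial_segment[OF cusp_form_axis_expansion[OF f s]])
  moreover have "(\<Sum>n<2. qcoeff f n * of_real (x ^ n)) = of_real (A * x)"
    using cusp_form_q_expansion(2)[OF f] a1 by (simp add: numeral_2_eq_2)
  ultimately have sm: "(\<lambda>n. qcoeff f (n + 2) * of_real (x ^ (n + 2))) sums (f (\<i> * of_real s) - of_real (A * x))" by simp
  have le: "norm (qcoeff f (n + 2) * of_real (x ^ (n + 2))) \<le> B * (1 / (real n + 1) - 1 / (real n + 2))" for n
  proof -
    define l where "l = real n + 2"
    have l: "l \<ge> 2" by (simp add: l_def)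
    define y where "y = 2 * pi * s * l"
    have y: "y > 0" using s l by (simp add: y_def)
    have "real (n + 2) * (- 2 * pi * s) = - y" by (simp add: y_def l_def algebra_simps)
    then have "x ^ (n + 2) = exp (- y)" by (simp only: x_def exp_of_nat_mult[symmetric])
    also have "\<dots> \<le> fact \<sigma> / y ^ \<sigma>"
      using power_le_fact_exp[of y \<sigma>] y by (simp add: exp_minus field_simps)
    finally have "norm (qcoeff f (n + 2) * of_real (x ^ (n + 2))) \<le> (A * l ^ m) * (fact \<sigma> / y ^ \<sigma>)"
      unfolding norm_mult norm_of_real using a[of "n + 2"] A l
      by (intro mult_mono) (auto simp: l_def x_def add.commute)
    also have "\<dots> = A * fact \<sigma> / (2 * pi * s) ^ \<sigma> * (l ^ m / l ^ \<sigma>)"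
      by (simp add: y_def power_mult_distrib)
    also have "l ^ m / l ^ \<sigma> = (1 / l) ^ (\<sigma> - m - 2) * (1 / l ^ 2)"
    proof -
      have "\<sigma> = m + ((\<sigma> - m - 2) + 2)" using \<sigma> by simp
      then have "l ^ \<sigma> = l ^ m * (l ^ (\<sigma> - m - 2) * l ^ 2)" by (metis power_add)
      then show ?thesis using l by (simp add: power_divide)
    qed
    also have "A * fact \<sigma> / (2 * pi * s) ^ \<sigma> * ((1 / l) ^ (\<sigma> - m - 2) * (1 / l ^ 2)) \<le>
        A * fact \<sigma> / (2 * pi * s) ^ \<sigma> * ((1 / 2) ^ (\<sigma> - m - 2) * (1 / (real n + 1) - 1 / (real n + 2)))"
      using A s l sum_inverse_squares_from_2(2)[of n]
      by (intro mult_left_mono mult_mono power_mono) (auto simp: l_def)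
    finally show ?thesis by (simp add: B_def mult.assoc)
  qed
  have sB: "(\<lambda>n. B * (1 / (real n + 1) - 1 / (real n + 2))) sums (B * 1)"
    by (intro sums_mult sum_inverse_squares_from_2)
  have "norm (f (\<i> * of_real s) - of_real (A * x)) \<le> (\<Sum>n. B * (1 / (real n + 1) - 1 / (real n + 2)))"
    unfolding sums_unique[OF sm] using le by (intro norm_suminf_le sums_summable[OF sB])
  also have "\<dots> = B" using sums_unique[OF sB] by simp
  finally show ?thesis by (simp add: B_def x_def)
qed

text \<open>This is the upper incomplete Gamma function \<open>\<Gamma>(j + 1, c)\<close> divided by
  c^(j+1). For integer j it is elementary through partial exponential sums, whose derivative is c
  times the same sum without its last term.\<close>

lemma incomplete_gamma_integral:
  fixes c :: real
  assumes c: "c > 0"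
  shows "set_integrable lborel {0<..} (\<lambda>t. exp (- c * (1 + t)) * (1 + t) ^ j)"
    and "(LINT t:{0<..}|lborel. exp (- c * (1 + t)) * (1 + t) ^ j) =
      fact j / c ^ (j + 1) * (exp (- c) * (\<Sum>i<Suc j. c ^ i / fact i))"
proof -
  define S where "S j t = (\<Sum>i<Suc j. (c * (1 + t)) ^ i / fact i)" for j t
  define F where "F t = - (fact j / c ^ (j + 1)) * (exp (- c * (1 + t)) * S j t)" for t
  have dS: "(S j has_real_derivative (c * (S j t - (c * (1 + t)) ^ j / fact j))) (at t)" for j t
  proof (induction j)
    case 0
    show ?case by (simp add: S_def)
  next
    case (Suc j)
    have eq: "S (Suc j) = (\<lambda>t. S j t + (c * (1 + t)) ^ Suc j / fact (Suc j))"
      by (simp add: S_def fun_eq_iff)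
    have "((\<lambda>t. (c * (1 + t)) ^ Suc j / fact (Suc j)) has_real_derivative
        real (Suc j) * (c * (1 + t)) ^ j * c / fact (Suc j)) (at t)"
      by (auto intro!: derivative_eq_intros simp del: power_Suc fact_Suc)
    moreover have "real (Suc j) * (c * (1 + t)) ^ j * c / fact (Suc j) = c * ((c * (1 + t)) ^ j / fact j)"
      by (simp add: fact_Suc del: of_nat_Suc)
    ultimately have d: "((\<lambda>t. (c * (1 + t)) ^ Suc j / fact (Suc j)) has_real_derivative
        c * ((c * (1 + t)) ^ j / fact j)) (at t)" by (simp only:)
    have "(S (Suc j) has_real_derivative
        (c * (S j t - (c * (1 + t)) ^ j / fact j) + c * ((c * (1 + t)) ^ j / fact j))) (at t)"
      unfolding eq by (rule DERIV_add[OF Suc d])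
    then show ?case by (simp add: eq algebra_simps)
  qed
  have dF: "(F has_real_derivative (exp (- c * (1 + t)) * (1 + t) ^ j)) (at t)" for t
  proof -
    have "((\<lambda>t. exp (- c * (1 + t)) * S j t) has_real_derivative
        (exp (- c * (1 + t)) * (- c) * S j t + (c * (S j t - (c * (1 + t)) ^ j / fact j)) * exp (- c * (1 + t)))) (at t)"
      by (intro DERIV_mult dS) (auto intro!: derivative_eq_intros)
    then have "(F has_real_derivative (- (fact j / c ^ (j + 1)) *
        (exp (- c * (1 + t)) * (- c) * S j t + (c * (S j t - (c * (1 + t)) ^ j / fact j)) * exp (- c * (1 + t))))) (at t)"
      unfolding F_def[abs_def] by (rule DERIV_cmult)
    moreover have "- (fact j / c ^ (j + 1)) *
        (exp (- c * (1 + t)) * (- c) * S j t + (c * (S j t - (c * (1 + t)) ^ j / fact j)) * exp (- c * (1 + t))) =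
        exp (- c * (1 + t)) * (1 + t) ^ j"
      using c unfolding power_mult_distrib[of c "1 + t" j] by (simp add: field_simps)
    ultimately show ?thesis by simp
  qed
  have lim: "(F \<longlongrightarrow> 0) at_top"
  proof -
    have "((\<lambda>x. x ^ i / exp x) \<longlongrightarrow> 0) (at_top :: real filter)" for i by (rule tendsto_power_div_exp_0)
    moreover have top: "filterlim (\<lambda>t. c * (1 + t)) at_top at_top"
      using c by (intro filterlim_tendsto_pos_mult_at_top[OF tendsto_const] filterlim_tendsto_add_at_top[OF tendsto_const] filterlim_ident)
    ultimately have "((\<lambda>t. (c * (1 + t)) ^ i / exp (c * (1 + t))) \<longlongrightarrow> 0) at_top" for i
      by (rule filterlim_compose)
    then have "((\<lambda>t. - (fact j / c ^ (j + 1)) * (\<Sum>i<Suc j. (c * (1 + t)) ^ i / exp (c * (1 + t)) / fact i)) \<longlongrightarrow>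
        - (fact j / c ^ (j + 1)) * (\<Sum>i<Suc j. 0 / fact i)) at_top"
      by (intro tendsto_intros) auto
    moreover have "F = (\<lambda>t. - (fact j / c ^ (j + 1)) * (\<Sum>i<Suc j. (c * (1 + t)) ^ i / exp (c * (1 + t)) / fact i))"
      unfolding F_def[abs_def] S_def sum_distrib_left
      by (intro ext sum.cong refl) (simp add: exp_minus divide_inverse mult_ac)
    ultimately show ?thesis by simp
  qed
  have m: "(\<lambda>t. exp (- c * (1 + t)) * (1 + t) ^ j) \<in> borel_measurable borel" by measurable
  have nn: "0 \<le> exp (- c * (1 + t)) * (1 + t) ^ j" if "0 \<le> t" for t using that by simp
  note FTC = FTC_Ioi_nonneg[OF m dF nn lim]
  show "set_integrable lborel {0<..} (\<lambda>t. exp (- c * (1 + t)) * (1 + t) ^ j)"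
    using FTC(1) by (rule set_integral_Ici_Ioi)
  show "(LINT t:{0<..}|lborel. exp (- c * (1 + t)) * (1 + t) ^ j) =
      fact j / c ^ (j + 1) * (exp (- c) * (\<Sum>i<Suc j. c ^ i / fact i))"
    using FTC(2) by (simp add: F_def S_def)
qed

lemma integral_inverse_square_shift:
  "set_integrable lborel {0<..} (\<lambda>t. 1 / (1 + t)\<^sup>2 :: real)" "(LINT t:{0<..}|lborel. 1 / (1 + t)\<^sup>2 :: real) = 1"
proof -
  have m: "(\<lambda>t::real. 1 / (1 + t)\<^sup>2) \<in> borel_measurable borel" by measurable
  have d: "((\<lambda>t. - 1 / (1 + t)) has_real_derivative 1 / (1 + t)\<^sup>2) (at t)" if "0 \<le> t" for t :: real
    using that by (auto intro!: derivative_eq_intros simp: power2_eq_square)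
  have lim: "((\<lambda>t::real. - 1 / (1 + t)) \<longlongrightarrow> 0) at_top"
    by (intro tendsto_divide_0[OF tendsto_const] filterlim_at_top_imp_at_infinity
        filterlim_tendsto_add_at_top[OF tendsto_const] filterlim_ident)
  note FTC = FTC_Ioi_nonneg[OF m d _ lim]
  show "set_integrable lborel {0<..} (\<lambda>t. 1 / (1 + t)\<^sup>2 :: real)"
    by (rule set_integral_Ici_Ioi(1)[OF FTC(1)]) auto
  show "(LINT t:{0<..}|lborel. 1 / (1 + t)\<^sup>2 :: real) = 1" by (subst FTC(2)) auto
qed


text \<open>The moment of the first Fourier term is explicit, and the other terms gain
  (1/2)^(h-1-n). In the range n <= h - 1 the power s^(K-n) is the larger of the two that are
  paired.\<close>

lemma period_moment_approx:
  assumes f: "f \<in> cusp_forms (2 * h)" and real: "\<And>n. Im (qcoeff f n) = 0"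
    and a1: "qcoeff f 1 = of_real A" and A: "A \<ge> 0"
    and a: "\<And>n. n \<ge> 1 \<Longrightarrow> cmod (qcoeff f n) \<le> A * real n ^ (h + 1)"
    and n: "n \<le> h - 1" and h: "h \<ge> 1"
  defines "c \<equiv> 2 * pi" and "K \<equiv> 2 * h - 2"
  defines "I \<equiv> (\<lambda>j. fact j / c ^ (j + 1) * (exp (- c) * (\<Sum>i<Suc j. c ^ i / fact i)))"
  shows "Im (period_moment h f n) = 0"
    and "cmod (period_moment h f n - of_real (A * (I (K - n) + (- 1) ^ h * I n))) \<le>
      2 * A * fact (K - n + 4) / c ^ (K - n + 4) * (1 / 2) ^ (h - 1 - n)"
proof -
  \<comment> \<open>At n = h - 1 the requirement \<sigma> >= h + 3 of
    \<open>cusp_form_axis_tail\<close> holds with equality, so 4 is the least shift that works for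
    all n. The integrand is then O(s^-4), integrated as O(s^-2).\<close>
  define \<sigma> where "\<sigma> = K - n + 4"
  have \<sigma>: "\<sigma> = 2 * h + 2 - n" "\<sigma> \<ge> h + 1 + 2" "\<sigma> - (h + 1) - 2 = h - 1 - n"
    using n h by (auto simp: \<sigma>_def K_def)
  have c: "c > 0" by (simp add: c_def)
  define e :: real where "e = (- 1) ^ h"
  have e1: "\<bar>e\<bar> = 1" by (simp add: e_def power_abs)
  define \<phi> where "\<phi> t = f (\<i> + \<i> * of_real t)" for t :: real
  define T where "T t = (1 + t) ^ (K - n) + e * (1 + t) ^ n" for t :: real
  have \<phi>_eq: "\<phi> t = f (\<i> * of_real (1 + t))" for t by (simp add: \<phi>_def distrib_left)
  have int_pow: "set_integrable lborel {0<..} (\<lambda>t. \<phi> t * of_real ((1 + t) ^ j))" for j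
    unfolding \<phi>_def by (rule period_integrable[OF f])
  have int: "set_integrable lborel {0<..} (\<lambda>t. \<phi> t * of_real (T t))"
  proof -
    have "set_integrable lborel {0<..} (\<lambda>t. \<phi> t * of_real ((1 + t) ^ (K - n)) + of_real e * (\<phi> t * of_real ((1 + t) ^ n)))"
      by (intro set_integral_add set_integrable_mult_right int_pow)
    then show ?thesis by (simp add: T_def algebra_simps)
  qed
  have pm: "period_moment h f n = (LINT t:{0<..}|lborel. \<phi> t * of_real (T t))"
    by (simp add: period_moment_def \<phi>_def T_def K_def e_def)
  have "period_moment h f n = (LINT t:{0<..}|lborel. of_real (Re (\<phi> t) * T t))"
    unfolding pm
  proof (intro set_lebesgue_integral_cong allI impI)
    fix t :: real assume "t \<in> {0<..}"
    then have "Im (\<phi> t) = 0" unfolding \<phi>_eq using cusp_form_axis_real[OF f real, of "1 + t"] by simp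
    then show "\<phi> t * of_real (T t) = of_real (Re (\<phi> t) * T t)" by (simp add: complex_eq_iff)
  qed simp
  also have "\<dots> = of_real (LINT t:{0<..}|lborel. Re (\<phi> t) * T t)"
    by (rule set_integral_complex_of_real)
  finally show "Im (period_moment h f n) = 0" by simp
  define G where "G t = A * (exp (- c * (1 + t)) * (1 + t) ^ (K - n) + e * (exp (- c * (1 + t)) * (1 + t) ^ n))" for t
  have Gint: "set_integrable lborel {0<..} G"
    unfolding G_def[abs_def]
    by (intro set_integrable_mult_right set_integral_add incomplete_gamma_integral c)
  have GI: "(LINT t:{0<..}|lborel. G t) = A * (I (K - n) + e * I n)"
    unfolding G_def I_def using c
    by (simp only: set_integral_mult_right set_integral_add(2)[OF incomplete_gamma_integral(1)[OF c]
          set_integrable_mult_right[OF incomplete_gamma_integral(1)[OF c]]] incomplete_gamma_integral(2)[OF c])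
  have Gcint: "set_integrable lborel {0<..} (\<lambda>t. complex_of_real (G t))"
  proof -
    have "(\<lambda>t. indicator {0<..} t *\<^sub>R complex_of_real (G t)) = (\<lambda>t. of_real (indicator {0<..} t *\<^sub>R G t))"
      by (simp add: scaleR_conv_of_real fun_eq_iff)
    then show ?thesis using Gint unfolding set_integrable_def by (simp only: integrable_of_real)
  qed
  have GcI: "(LINT t:{0<..}|lborel. complex_of_real (G t)) = of_real (A * (I (K - n) + e * I n))"
    unfolding GI[symmetric] by (rule set_integral_complex_of_real)
  define B where "B = A * fact \<sigma> / c ^ \<sigma> * (1 / 2) ^ (h - 1 - n)"
  have B: "B \<ge> 0" using A c by (simp add: B_def)
  have le: "norm (\<phi> t * of_real (T t) - of_real (G t)) \<le> 2 * B * (1 / (1 + t)\<^sup>2)" if t: "t \<in> {0<..}" for t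
  proof -
    define s where "s = 1 + t"
    have s: "s > 1" using t by (simp add: s_def)
    have "norm (\<phi> t - of_real (A * exp (- c * s))) \<le> A * fact \<sigma> / (c * s) ^ \<sigma> * (1 / 2) ^ (h - 1 - n)"
      using cusp_form_axis_tail[OF f a1 A a _ \<sigma>(2), of s] s unfolding \<sigma>(3) \<phi>_eq s_def[symmetric] c_def by simp
    also have "\<dots> = B / s ^ \<sigma>" by (simp add: B_def power_mult_distrib)
    finally have 1: "norm (\<phi> t - of_real (A * exp (- c * s))) \<le> B / s ^ \<sigma>" .
    have "\<bar>T t\<bar> \<le> s ^ (K - n) + \<bar>e\<bar> * s ^ n"
      unfolding T_def s_def[symmetric] using abs_triangle_ineq[of "s ^ (K - n)" "e * s ^ n"] s by (simp add: abs_mult)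
    also have "\<dots> \<le> s ^ (K - n) + s ^ (K - n)"
      using s n h e1 by (intro add_mono) (auto simp: K_def intro!: power_increasing)
    finally have 2: "\<bar>T t\<bar> \<le> 2 * s ^ (K - n)" by simp
    have "\<phi> t * of_real (T t) - of_real (G t) = (\<phi> t - of_real (A * exp (- c * s))) * of_real (T t)"
      by (simp add: G_def T_def s_def algebra_simps)
    then have "norm (\<phi> t * of_real (T t) - of_real (G t)) = norm (\<phi> t - of_real (A * exp (- c * s))) * \<bar>T t\<bar>"
      by (simp only: norm_mult norm_of_real)
    also have "\<dots> \<le> B / s ^ \<sigma> * (2 * s ^ (K - n))"
      using B s by (intro mult_mono 1 2) auto
    also have "\<dots> = 2 * B * (1 / s ^ 4)"
      using s unfolding \<sigma>_def power_add by (simp add: field_simps)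
    also have "\<dots> \<le> 2 * B * (1 / s ^ 2)"
      using B s by (intro mult_left_mono divide_left_mono power_increasing) auto
    finally show ?thesis by (simp add: s_def)
  qed
  have "norm (period_moment h f n - of_real (A * (I (K - n) + e * I n))) =
      norm (LINT t:{0<..}|lborel. \<phi> t * of_real (T t) - of_real (G t))"
    unfolding pm GcI[symmetric] by (simp only: set_integral_diff(2)[OF int Gcint])
  also have "\<dots> \<le> (LINT t:{0<..}|lborel. norm (\<phi> t * of_real (T t) - of_real (G t)))"
    by (rule set_integral_norm_bound[OF set_integral_diff(1)[OF int Gcint]])
  also have "\<dots> \<le> (LINT t:{0<..}|lborel. 2 * B * (1 / (1 + t)\<^sup>2))"
    by (intro set_integral_mono set_integrable_norm set_integral_diff(1)[OF int Gcint] set_integrable_mult_right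
        integral_inverse_square_shift le)
  also have "\<dots> = 2 * B" by (simp only: set_integral_mult_right integral_inverse_square_shift mult_1_right)
  finally show "cmod (period_moment h f n - of_real (A * (I (K - n) + (- 1) ^ h * I n))) \<le>
      2 * A * fact (K - n + 4) / c ^ (K - n + 4) * (1 / 2) ^ (h - 1 - n)"
    by (simp add: B_def \<sigma>_def e_def mult.assoc)
qed

lemma period_moment_symmetric:
  assumes "n \<le> 2 * h - 2"
  shows "period_moment h f (2 * h - 2 - n) = (- 1) ^ h * period_moment h f n"
proof -
  have "(1 + t) ^ (2 * h - 2 - (2 * h - 2 - n)) + (- 1) ^ h * (1 + t) ^ (2 * h - 2 - n) =
      (- 1) ^ h * ((1 + t) ^ (2 * h - 2 - n) + (- 1) ^ h * (1 + t) ^ n)" for t :: real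
  proof -
    have d: "2 * h - 2 - (2 * h - 2 - n) = n" using assms by simp
    show ?thesis unfolding d by (simp add: distrib_left flip: mult.assoc power_mult_distrib)
  qed
  then show ?thesis
    unfolding period_moment_def by (simp add: mult.left_commute flip: set_integral_mult_right)
qed

text \<open>The exponent h - 55 leaves (1/2)^54 of the factor (1/2)^(h-1) in reserve against exp (4
  pi). The induction works because (11/10)^4 < 2.\<close>

lemma polynomial_vs_power_of_two: "h \<ge> 90 \<Longrightarrow> (2 * real h + 2) ^ 4 \<le> 2 ^ (h - 55)"
proof (induction h rule: nat_induct_at_least)
  case base
  show ?case by simp
next
  case (Suc h)
  have "2 * real (Suc h) + 2 \<le> (11 / 10) * (2 * real h + 2)" using Suc.hyps by simp
  then have "(2 * real (Suc h) + 2) ^ 4 \<le> ((11 / 10) * (2 * real h + 2)) ^ 4"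
    by (intro power_mono) auto
  also have "\<dots> = (11 / 10) ^ 4 * (2 * real h + 2) ^ 4" by (rule power_mult_distrib)
  also have "\<dots> \<le> 2 * 2 ^ (h - 55)" using Suc.IH by (intro mult_mono) (auto simp: power_divide)
  also have "Suc h - 55 = Suc (h - 55)" using Suc.hyps by simp
  then have "2 * 2 ^ (h - 55) = (2 :: real) ^ (Suc h - 55)" by (simp only: power_Suc)
  finally show ?case .
qed


lemma fact_add_4_le: "fact (m + 4) \<le> fact m * (real m + 4) ^ 4"
proof -
  have "fact (m + 4) = (real m + 4) * ((real m + 3) * ((real m + 2) * ((real m + 1) * fact m)))"
    by (simp add: eval_nat_numeral algebra_simps)
  also have "\<dots> \<le> (real m + 4) * ((real m + 4) * ((real m + 4) * ((real m + 4) * fact m)))"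
    by (intro mult_mono) auto
  also have "\<dots> = fact m * (real m + 4) ^ 4" by (simp add: power4_eq_xxxx)
  finally show ?thesis .
qed

lemma exp_complex_tail_le:
  assumes "cmod z \<le> x"
  shows "cmod (exp z - (\<Sum>i<N. z ^ i / fact i)) \<le> (1 / 8) ^ N * exp (8 * x)"
proof -
  have ez: "(\<lambda>i. z ^ i / fact i) sums exp z"
    using exp_converges[of z] by (simp add: scaleR_conv_of_real divide_inverse mult.commute)
  have er: "(\<lambda>i. cmod z ^ i / fact i) sums exp (cmod z)"
    using exp_converges[of "cmod z"] by (simp add: divide_inverse mult.commute)
  note sz = sums_split_initial_segment[OF ez, of N] and sr = sums_split_initial_segment[OF er, of N]
  have "cmod (exp z - (\<Sum>i<N. z ^ i / fact i)) \<le> exp (cmod z) - (\<Sum>i<N. cmod z ^ i / fact i)"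
    unfolding sums_unique[OF sz] sums_unique[OF sr]
    by (intro norm_suminf_le sums_summable[OF sr]) (simp add: norm_divide norm_power)
  also have "\<dots> \<le> (1 / 8) ^ N * exp (8 * cmod z)" by (rule exp_tail_le) simp
  also have "\<dots> \<le> (1 / 8) ^ N * exp (8 * x)" using assms by (intro mult_left_mono) auto
  finally show ?thesis .
qed

lemma exp_le_power3: "exp (real m) \<le> 3 ^ m"
proof -
  have "exp (real m) = exp 1 ^ m" by (simp flip: exp_of_nat_mult)
  also have "\<dots> \<le> 3 ^ m" by (intro power_mono exp_le) auto
  finally show ?thesis .
qed

text \<open>After scaling, the lower half of the period polynomial is within \<open>e\<^sup>-\<^sup>2\<^sup>\<pi>\<close> of \<open>e\<^sup>2\<^sup>\<pi>\<^sup>w\<close> on the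
  unit disc, so it has no zeros there.\<close>

theorem period_poly_unimodular:
  assumes f: "f \<in> cusp_forms (2 * h)" and real: "\<And>n. Im (qcoeff f n) = 0"
    and a1: "qcoeff f 1 = of_real A" and A: "A > 0"
    and a: "\<And>n. n \<ge> 1 \<Longrightarrow> cmod (qcoeff f n) \<le> A * real n ^ (h + 1)" and h: "h \<ge> 90"
  shows "unimodular (period_poly (2 * h) f)"
proof -
  define c where "c = 2 * pi"
  define K H where "K = 2 * h - 2" and "H = h - 1"
  have KH: "K = 2 * H" "h = Suc H" "H \<ge> 89" using h by (auto simp: K_def H_def)
  have c: "c > 0" "6 \<le> c" "c \<le> 7" using pi_gt3 pi_less_4 pi_approx by (auto simp: c_def)
  define p where "p = period_coeff h f"
  \<comment> \<open>Keeping only A q of f and completing the Gamma integral gives binomial(K, n) A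
    (K-n)! / c^(K-n+1) = D c^n / n! for p n. Thus \<open>L n\<close> is p n divided by its expected
    value.\<close>
  define D where "D = A * fact K / c ^ (K + 1)"
  have D: "D > 0" using A c by (simp add: D_def)
  define v where "v n = c ^ n / fact n" for n
  have v: "v n > 0" for n using c by (simp add: v_def)
  define L where "L n = p n / of_real (D * v n)" for n
  have pL: "p n = of_real D * (of_real (v n) * L n)" for n
    using D v[of n] by (simp add: L_def)
  define T where "T = (1 / 8) ^ H * exp (8 * c)"
  have T0: "T \<ge> 0" by (simp add: T_def)
  define Q where "Q = (2 * real h + 2) ^ 4 / 100"
  have moment_real: "Im (period_moment h f n) = 0" if "n \<le> H" for n
    using period_moment_approx(1)[OF f real a1 _ a, of n] that A h by (simp add: H_def)
  \<comment> \<open>The three errors are the truncation of the incomplete Gamma factor, the paired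
    moment of the lower power s^n, and the Fourier terms beyond the first.\<close>
  have L1: "cmod (L n - 1) \<le> T + v (K - n) / v n + Q * (1 / 2) ^ (H - n)" if n: "n \<le> H" for n
  proof -
    define \<kappa> where "\<kappa> = c ^ (K - n + 1) / (A * fact (K - n))"
    have \<kappa>: "\<kappa> > 0" using c A by (simp add: \<kappa>_def)
    define I where "I j = fact j / c ^ (j + 1) * (exp (- c) * (\<Sum>i<Suc j. c ^ i / fact i))" for j
    define M where "M = period_moment h f n"
    have nK: "n \<le> K" using n KH by simp
    have LM: "L n = of_real \<kappa> * M"
    proof -
      have "real (K choose n) = fact K / (fact n * fact (K - n))"
        using binomial_fact[OF nK, where 'a = real] by simp
      moreover have "c ^ (K + 1) = c ^ (K - n + 1) * c ^ n" using nK by (simp flip: power_add)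
      ultimately have "real (K choose n) / (D * v n) = \<kappa>"
        using A c by (simp add: D_def v_def \<kappa>_def)
      moreover have "L n = of_real (real (K choose n) / (D * v n)) * M"
        by (simp add: L_def p_def period_coeff_def K_def M_def)
      ultimately show ?thesis by (simp only:)
    qed
    have theta: "0 \<le> exp (- c) * (\<Sum>i<Suc j. c ^ i / fact i)" "exp (- c) * (\<Sum>i<Suc j. c ^ i / fact i) \<le> 1"
      "1 - exp (- c) * (\<Sum>i<Suc j. c ^ i / fact i) \<le> (1 / 8) ^ Suc j * exp (8 * c)" for j
    proof -
      define S where "S = (\<Sum>i<Suc j. c ^ i / fact i)"
      have S: "0 \<le> exp c - S" "exp c - S \<le> (1 / 8) ^ Suc j * exp (8 * c)" "0 \<le> S"
        unfolding S_def using exp_tail_le(1,2)[of c "Suc j"] c by (auto intro!: sum_nonneg simp del: sum.lessThan_Suc)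
      have eq: "1 - exp (- c) * S = exp (- c) * (exp c - S)" by (simp add: right_diff_distrib flip: exp_add)
      show "0 \<le> exp (- c) * (\<Sum>i<Suc j. c ^ i / fact i)" unfolding S_def[symmetric] using S by simp
      have "0 \<le> exp (- c) * (exp c - S)" using S by simp
      then show "exp (- c) * (\<Sum>i<Suc j. c ^ i / fact i) \<le> 1" unfolding S_def[symmetric] using eq by linarith
      have le1: "exp (- c) * (exp c - S) \<le> exp c - S"
        using S(1) c mult_right_mono[of "exp (- c)" 1 "exp c - S"] by simp
      show "1 - exp (- c) * (\<Sum>i<Suc j. c ^ i / fact i) \<le> (1 / 8) ^ Suc j * exp (8 * c)"
        unfolding S_def[symmetric] eq by (rule order_trans[OF le1 S(2)])
    qed
    define e :: real where "e = (- 1) ^ h"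
    have e1: "\<bar>e\<bar> = 1" by (simp add: e_def power_abs)
    have m: "cmod (M - of_real (A * (I (K - n) + e * I n))) \<le> 2 * A * fact (K - n + 4) / c ^ (K - n + 4) * (1 / 2) ^ (h - 1 - n)"
      unfolding M_def I_def e_def K_def c_def
      by (rule period_moment_approx(2)[OF f real a1 less_imp_le[OF A] a]) (use n h in \<open>auto simp: H_def\<close>)
    have "cmod (L n - 1) = cmod (of_real \<kappa> * (M - of_real (A * (I (K - n) + e * I n))) +
        of_real (\<kappa> * (A * (I (K - n) + e * I n)) - 1))"
      by (simp add: LM algebra_simps)
    also have "\<dots> \<le> \<kappa> * cmod (M - of_real (A * (I (K - n) + e * I n))) + \<bar>\<kappa> * (A * (I (K - n) + e * I n)) - 1\<bar>"
      using norm_triangle_ineq[of "of_real \<kappa> * (M - of_real (A * (I (K - n) + e * I n)))"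
          "of_real (\<kappa> * (A * (I (K - n) + e * I n)) - 1)"] \<kappa>
      by (simp only: norm_mult norm_of_real) simp
    also have "\<kappa> * cmod (M - of_real (A * (I (K - n) + e * I n))) \<le> Q * (1 / 2) ^ (H - n)"
    proof -
      have "\<kappa> * cmod (M - of_real (A * (I (K - n) + e * I n))) \<le>
          \<kappa> * (2 * A * fact (K - n + 4) / c ^ (K - n + 4) * (1 / 2) ^ (h - 1 - n))"
        using m \<kappa> by (intro mult_left_mono) auto
      also have "\<dots> = 2 / c ^ 3 * (fact (K - n + 4) / fact (K - n)) * (1 / 2) ^ (H - n)"
      proof -
        have "c ^ (K - n + 4) = c ^ (K - n + 1) * c ^ 3"
          unfolding power_add[symmetric] by (simp add: add.commute)
        then show ?thesis using A c by (simp add: \<kappa>_def H_def mult_ac)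
      qed
      also have "\<dots> \<le> 1 / 100 * (2 * real h + 2) ^ 4 * (1 / 2) ^ (H - n)"
      proof (intro mult_right_mono mult_mono)
        have "6 ^ 3 \<le> c ^ 3" using c by (intro power_mono) auto
        then have "2 / c ^ 3 \<le> 2 / 6 ^ 3" by (intro divide_left_mono) (use c in auto)
        then show "2 / c ^ 3 \<le> 1 / 100" by simp
        have "fact (K - n + 4) / fact (K - n) \<le> (real (K - n) + 4) ^ 4"
          using fact_add_4_le[of "K - n"] by (simp add: field_simps)
        also have "\<dots> \<le> (2 * real h + 2) ^ 4" using h by (intro power_mono) (auto simp: K_def)
        finally show "fact (K - n + 4) / fact (K - n) \<le> (2 * real h + 2) ^ 4" .
      qed (use c in auto)
      finally show ?thesis by (simp add: Q_def)
    qed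
    also have "\<bar>\<kappa> * (A * (I (K - n) + e * I n)) - 1\<bar> \<le> T + v (K - n) / v n"
    proof -
      have 1: "\<kappa> * A * I (K - n) = exp (- c) * (\<Sum>i<Suc (K - n). c ^ i / fact i)"
        using A c by (simp add: \<kappa>_def I_def del: sum.lessThan_Suc)
      have 2: "\<kappa> * A * I n = v (K - n) / v n * (exp (- c) * (\<Sum>i<Suc n. c ^ i / fact i))"
        using A c by (simp add: \<kappa>_def I_def v_def del: sum.lessThan_Suc)
      have "1 - exp (- c) * (\<Sum>i<Suc (K - n). c ^ i / fact i) \<le> (1 / 8) ^ Suc (K - n) * exp (8 * c)"
        by (rule theta)
      also have "\<dots> \<le> T"
        unfolding T_def using n KH by (intro mult_right_mono power_decreasing) auto
      finally have 3: "\<bar>\<kappa> * A * I (K - n) - 1\<bar> \<le> T" unfolding 1 using theta(2)[of "K - n"] by linarith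
      have 4: "\<bar>e * (\<kappa> * A * I n)\<bar> \<le> v (K - n) / v n * 1"
        unfolding abs_mult[of e] e1 2 using theta(1,2)[of n] v[of n] v[of "K - n"]
        by (simp only: abs_mult mult_1) (intro mult_mono; simp)
      have "\<kappa> * (A * (I (K - n) + e * I n)) - 1 = (\<kappa> * A * I (K - n) - 1) + e * (\<kappa> * A * I n)"
        by (simp add: algebra_simps)
      then show ?thesis using 3 4 by linarith
    qed
    finally show ?thesis by simp
  qed
  define S where "S = (\<Sum>n\<le>H. v n * cmod (L n - 1))"
  have sum_v: "(\<Sum>n\<le>H. v n) \<le> exp c" unfolding v_def using c by (intro exp_tail_le) auto
  have sum_tail: "(\<Sum>n\<in>{H..K}. v n) \<le> T"
  proof -
    have "{..K} = {..<H} \<union> {H..K}" using KH by auto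
    then have "(\<Sum>n\<le>K. v n) = (\<Sum>n<H. v n) + (\<Sum>n\<in>{H..K}. v n)"
      by (simp only:) (rule sum.union_disjoint; force)
    moreover have "(\<Sum>n\<le>K. v n) \<le> exp c" unfolding v_def using c by (intro exp_tail_le) auto
    moreover have "exp c - (\<Sum>n<H. v n) \<le> T" unfolding v_def T_def using c by (intro exp_tail_le) auto
    ultimately show ?thesis by linarith
  qed
  \<comment> \<open>Weighted by \<open>v n\<close>, each error can be summed: the second becomes
    \<open>v (K - n)\<close>, a tail of the exponential series, and the growth 2^n of the third
    turns c^n / n! into (2c)^n / n!.\<close>
  have S_le: "S \<le> T * exp c + T + Q * (1 / 2) ^ H * exp (2 * c)"
  proof -
    have "S \<le> (\<Sum>n\<le>H. T * v n + v (K - n) + Q * (1 / 2) ^ H * ((2 * c) ^ n / fact n))"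
      unfolding S_def
    proof (rule sum_mono)
      fix n assume "n \<in> {..H}"
      then have n: "n \<le> H" by simp
      have pw: "(1 / 2) ^ (H - n) = (1 / 2) ^ H * (2 :: real) ^ n"
        using n by (simp add: power_diff power_divide)
      have "v n * cmod (L n - 1) \<le> v n * (T + v (K - n) / v n + Q * (1 / 2) ^ (H - n))"
        using v[of n] by (intro mult_left_mono L1[OF n]) auto
      also have "\<dots> = T * v n + v (K - n) + Q * (1 / 2) ^ H * (2 ^ n * v n)"
        using v[of n] by (simp add: pw algebra_simps)
      also have "2 ^ n * v n = (2 * c) ^ n / fact n" by (simp add: v_def power_mult_distrib)
      finally show "v n * cmod (L n - 1) \<le> T * v n + v (K - n) + Q * (1 / 2) ^ H * ((2 * c) ^ n / fact n)" .
    qed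
    also have "\<dots> = T * (\<Sum>n\<le>H. v n) + (\<Sum>n\<le>H. v (K - n)) + Q * (1 / 2) ^ H * (\<Sum>n\<le>H. (2 * c) ^ n / fact n)"
      by (simp only: sum.distrib sum_distrib_left)
    also have "\<dots> \<le> T * exp c + T + Q * (1 / 2) ^ H * exp (2 * c)"
    proof (intro add_mono mult_left_mono)
      have "(\<Sum>n\<le>H. v (K - n)) = (\<Sum>n\<in>{H..K}. v n)"
        by (rule sum.reindex_bij_witness[of _ "\<lambda>n. K - n" "\<lambda>n. K - n"]) (use KH in auto)
      then show "(\<Sum>n\<le>H. v (K - n)) \<le> T" using sum_tail by simp
      show "(\<Sum>n\<le>H. (2 * c) ^ n / fact n) \<le> exp (2 * c)" using c by (intro exp_tail_le) auto
    qed (use sum_v T0 in \<open>auto simp: Q_def\<close>)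
    finally show ?thesis .
  qed
  \<comment> \<open>S is at most about 3^7 * 10^-10, far below exp (- c) >= 3^-7; the bound c <= 7
    turns every exponential into a power of 3.\<close>
  have numeric: "T + T + 2 * S < exp (- c)"
  proof -
    have e7: "exp c \<le> 3 ^ 7" using exp_le_power3[of 7] c by (intro order_trans[OF _ exp_le_power3[of 7]]) simp
    have e14: "exp (2 * c) \<le> 3 ^ 14" using c by (intro order_trans[OF _ exp_le_power3[of 14]]) simp
    have e56: "exp (8 * c) \<le> 3 ^ 56" using c by (intro order_trans[OF _ exp_le_power3[of 56]]) simp
    have "T \<le> (1 / 8) ^ 89 * 3 ^ 56"
      unfolding T_def using KH e56 by (intro mult_mono power_decreasing) auto
    also have "\<dots> \<le> 1 / 10 ^ 10" by (simp add: power_divide)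
    finally have T: "T \<le> 1 / 10 ^ 10" .
    have "Q * (1 / 2) ^ H \<le> 2 ^ (h - 55) / 100 * (1 / 2) ^ H"
      unfolding Q_def using polynomial_vs_power_of_two[OF h] by (intro mult_right_mono divide_right_mono) auto
    also have "\<dots> = (1 / 2) ^ 54 / 100"
    proof -
      have "H = (h - 55) + 54" using h by (simp add: H_def)
      then have 1: "(1 / 2 :: real) ^ H = (1 / 2) ^ (h - 55) * (1 / 2) ^ 54" by (simp only: power_add)
      have 2: "(2 :: real) ^ (h - 55) * (1 / 2) ^ (h - 55) = 1" by (simp flip: power_mult_distrib)
      have "x / 100 * (y * z) = (x * y) * (z / 100)" for x y z :: real by simp
      then show ?thesis unfolding 1 by (simp only: 2 mult_1)
    qed
    finally have "Q * (1 / 2) ^ H \<le> (1 / 2) ^ 54 / 100" .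
    then have "Q * (1 / 2) ^ H * exp (2 * c) \<le> (1 / 2) ^ 54 / 100 * 3 ^ 14"
      using e14 by (intro mult_mono) auto
    also have "\<dots> \<le> 1 / 10 ^ 10" by (simp add: power_divide)
    finally have Q: "Q * (1 / 2) ^ H * exp (2 * c) \<le> 1 / 10 ^ 10" .
    have "T * exp c \<le> 1 / 10 ^ 10 * 3 ^ 7" using T T0 e7 by (intro mult_mono) auto
    then have "S \<le> 1 / 10 ^ 10 * 3 ^ 7 + 1 / 10 ^ 10 + 1 / 10 ^ 10" using S_le T Q by linarith
    then have "T + T + 2 * S < 1 / 3 ^ 7" using T by simp
    also have "1 / 3 ^ 7 \<le> exp (- c)" using e7 by (simp add: exp_minus field_simps)
    finally show ?thesis .
  qed
  have q_nonzero: "(\<Sum>n<H. p n * w ^ n) + p H / 2 * w ^ H \<noteq> 0" if w: "cmod w \<le> 1" for w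
  proof
    assume 0: "(\<Sum>n<H. p n * w ^ n) + p H / 2 * w ^ H = 0"
    \<comment> \<open>R contains the full middle term and U is the half to be removed, so a zero
      means R = U. But R is within T + S of exp (c w) and |U| <= T + S, whereas |exp (c w)| >= exp
      (- c).\<close>
    define R where "R = (\<Sum>n\<le>H. of_real (v n) * L n * w ^ n)"
    define U where "U = of_real (v H) * L H * w ^ H / 2"
    have "of_real D * (R - U) = (\<Sum>n<H. p n * w ^ n) + p H / 2 * w ^ H"
      unfolding R_def U_def pL
      by (simp add: lessThan_Suc_atMost[symmetric] sum_distrib_left algebra_simps)
    then have RU: "R = U" using 0 D by simp
    have wn: "cmod w ^ n \<le> 1" for n using w by (simp add: power_le_one)
    have "cmod (exp (of_real c * w) - (\<Sum>n<Suc H. (of_real c * w) ^ n / fact n)) \<le> (1 / 8) ^ Suc H * exp (8 * c)"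
      using w c by (intro exp_complex_tail_le) (simp add: norm_mult)
    also have "\<dots> \<le> T" unfolding T_def by (intro mult_right_mono power_decreasing) auto
    finally have 1: "cmod (exp (of_real c * w) - (\<Sum>n<Suc H. (of_real c * w) ^ n / fact n)) \<le> T" .
    have "(\<Sum>n<Suc H. (of_real c * w) ^ n / fact n) - R = - (\<Sum>n\<le>H. of_real (v n) * (L n - 1) * w ^ n)"
      unfolding R_def lessThan_Suc_atMost sum_negf[symmetric] sum_subtractf[symmetric]
      by (intro sum.cong refl) (simp add: v_def power_mult_distrib algebra_simps diff_divide_distrib)
    then have "cmod ((\<Sum>n<Suc H. (of_real c * w) ^ n / fact n) - R) \<le> (\<Sum>n\<le>H. cmod (of_real (v n) * (L n - 1) * w ^ n))"
      by (simp only: norm_minus_cancel norm_sum)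
    also have "\<dots> \<le> S"
      unfolding S_def
    proof (rule sum_mono)
      fix n
      have "cmod (of_real (v n) * (L n - 1) * w ^ n) = v n * cmod (L n - 1) * cmod w ^ n"
        using v[of n] by (simp add: norm_mult norm_power)
      also have "\<dots> \<le> v n * cmod (L n - 1) * 1" using v[of n] wn by (intro mult_left_mono) auto
      finally show "cmod (of_real (v n) * (L n - 1) * w ^ n) \<le> v n * cmod (L n - 1)" by simp
    qed
    finally have 2: "cmod ((\<Sum>n<Suc H. (of_real c * w) ^ n / fact n) - R) \<le> S" .
    have 3: "cmod U \<le> T + S"
    proof -
      have "cmod U = v H * cmod (L H) * cmod w ^ H / 2" using v[of H] by (simp add: U_def norm_mult norm_divide norm_power)
      also have "\<dots> \<le> v H * cmod (L H) * 1 / 2" using v[of H] wn by (intro divide_right_mono mult_left_mono) auto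
      also have "\<dots> \<le> v H * cmod (L H)" using v[of H] by simp
      also have "\<dots> \<le> v H * (1 + cmod (L H - 1))"
        using norm_triangle_ineq[of 1 "L H - 1"] v[of H] by (intro mult_left_mono) auto
      also have "\<dots> = v H + v H * cmod (L H - 1)" by (simp add: distrib_left)
      also have "\<dots> \<le> T + S"
      proof (rule add_mono)
        have "v H \<le> (\<Sum>n\<in>{H..K}. v n)" using v KH by (intro member_le_sum) (auto intro: less_imp_le)
        then show "v H \<le> T" using sum_tail by linarith
        show "v H * cmod (L H - 1) \<le> S"
          unfolding S_def
          by (rule member_le_sum[where f = "\<lambda>n. v n * cmod (L n - 1)"])
             (auto intro!: mult_nonneg_nonneg less_imp_le[OF v])
      qed
      finally show ?thesis .
    qed
    have "exp (- c) \<le> cmod (exp (of_real c * w))"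
    proof -
      have "- 1 \<le> Re w" using abs_Re_le_cmod[of w] w by linarith
      then have "c * - 1 \<le> c * Re w" using c by (intro mult_left_mono) auto
      then show ?thesis by simp
    qed
    also have "\<dots> = cmod ((exp (of_real c * w) - (\<Sum>n<Suc H. (of_real c * w) ^ n / fact n)) +
        ((\<Sum>n<Suc H. (of_real c * w) ^ n / fact n) - R) + U)"
      by (simp add: RU)
    also have "\<dots> \<le> T + S + (T + S)"
      using 1 2 3 by (meson add_mono norm_triangle_le order_trans)
    finally show False using numeric by simp
  qed
  have sym: "p (2 * H - n) = (- 1) ^ h * p n" if "n \<le> 2 * H" for n
    using period_moment_symmetric[of n h] binomial_symmetric[of n K] that KH
    by (simp add: p_def period_coeff_def K_def)
  \<comment> \<open>Reality is asked for at every index: above H it follows from the symmetry, and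
    above 2H the binomial coefficient is 0.\<close>
  have p_real: "cnj (p n) = p n" for n
  proof -
    have small: "Im (p n) = 0" if "n \<le> H" for n
      using moment_real[OF that] by (simp add: p_def period_coeff_def)
    consider "n \<le> H" | "H < n" "n \<le> 2 * H" | "n > 2 * H" by linarith
    then have "Im (p n) = 0"
    proof cases
      case 2
      then have "p n = (- 1) ^ h * p (2 * H - n)" using sym[of "2 * H - n"] by simp
      moreover have "Im (p (2 * H - n)) = 0" using 2 by (intro small) simp
      ultimately show ?thesis by (cases "even h") auto
    next
      case 3
      then show ?thesis using KH by (simp add: p_def period_coeff_def K_def)
    qed (use small in auto)
    then show ?thesis by (simp add: complex_eq_iff)
  qed
  show ?thesis
    unfolding unimodular_def
  proof (intro allI impI)
    fix z assume "poly (period_poly (2 * h) f) z = 0"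
    then have "(\<Sum>n\<le>2 * H. p n * (\<i> * z) ^ n) = 0"
      using period_poly_eq[OF f, of z] h KH by (simp add: p_def K_def)
    then have "cmod (\<i> * z) = 1"
      by (intro self_reciprocal_zeros[where p = p and H = H and \<epsilon> = "(- 1) ^ h"] p_real sym q_nonzero)
         (use KH in \<open>auto simp flip: power_mult_distrib\<close>)
    then show "cmod z = 1" by (simp add: norm_mult)
  qed
qed

section \<open>Counting\<close>

lemma normalized_eigenforms_finite:
  assumes "h > 0"
  shows "finite (normalized_eigenforms (2 * h))"
    and "card (normalized_eigenforms (2 * h)) \<le> cfun.dim (cusp_forms (2 * h))"
proof -
  have "normalized_eigenforms (2 * h) \<subseteq> cusp_forms (2 * h)"
    using assms normalized_eigenformD(1)[of _ "2 * h"] by auto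
  then show "finite (normalized_eigenforms (2 * h))"
    "card (normalized_eigenforms (2 * h)) \<le> cfun.dim (cusp_forms (2 * h))"
    using independent_card_le_dim_cusp_forms[OF normalized_eigenforms_independent, of "2 * h" h] assms by auto
qed

lemma normalized_eigenform_qcoeff_real:
  assumes g: "g \<in> normalized_eigenforms (2 * h)" and h: "h > 0"
  shows "Im (qcoeff g n) = 0"
proof (cases "n = 0")
  case True
  then show ?thesis using cusp_form_q_expansion(2)[OF normalized_eigenformD(1)[OF g]] h by simp
next
  case False
  then show ?thesis
    using hecke_eigenvalue_real[of g h n "qcoeff g n"] normalized_eigenformD[OF g] h by simp
qed

definition box_form :: "nat \<Rightarrow> ((complex \<Rightarrow> complex) \<Rightarrow> int) \<Rightarrow> complex \<Rightarrow> complex" where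
  "box_form k c = (\<Sum>g\<in>normalized_eigenforms k. fscale (of_int (c g)) g)"

lemma box_form_cusp_form:
  assumes "k > 0"
  shows "box_form k c \<in> cusp_forms k"
  unfolding box_form_def using assms
  by (intro cfun.subspace_sum[OF subspace_cusp_forms] cfun.subspace_scale[OF subspace_cusp_forms] normalized_eigenformD(1))

lemma qcoeff_sum:
  assumes "finite N" "\<And>g. g \<in> N \<Longrightarrow> g \<in> cusp_forms k"
  shows "qcoeff (\<Sum>g\<in>N. fscale (c g) g) n = (\<Sum>g\<in>N. c g * qcoeff g n)"
  using assms
proof (induction N rule: finite_induct)
  case empty
  have "has_q_expansion 0 (\<lambda>_. 0)" by (simp add: has_q_expansion_def)
  then have "qcoeff 0 n = 0" by (metis qcoeff_eq)
  then show ?case by (simp only: sum.empty)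
next
  case (insert g N)
  have 1: "fscale (c g) g \<in> cusp_forms k" and g: "g \<in> cusp_forms k"
    using insert.prems by (auto intro: cfun.subspace_scale[OF subspace_cusp_forms])
  have 2: "(\<Sum>g\<in>N. fscale (c g) g) \<in> cusp_forms k"
    using insert.prems by (intro cfun.subspace_sum[OF subspace_cusp_forms] cfun.subspace_scale[OF subspace_cusp_forms]) auto
  have "qcoeff (\<Sum>g\<in>N. fscale (c g) g) n = (\<Sum>g\<in>N. c g * qcoeff g n)"
    by (intro insert.IH insert.prems insertI2)
  then show ?case
    by (simp only: sum.insert[OF insert.hyps] qcoeff_add[OF 1 2] qcoeff_fscale[OF g])
qed

text \<open>The sum A of the c g is both the first coefficient and the constant of the triangle
  inequality, precisely because no c g is negative.\<close>

lemma period_poly_box_form_unimodular: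
  assumes h: "h \<ge> 90" and c: "\<And>g. g \<in> normalized_eigenforms (2 * h) \<Longrightarrow> c g \<ge> 0"
    and g0: "g0 \<in> normalized_eigenforms (2 * h)" "c g0 \<noteq> 0"
  shows "unimodular (period_poly (2 * h) (box_form (2 * h) c))"
proof (rule period_poly_unimodular)
  let ?N = "normalized_eigenforms (2 * h)"
  have fin: "finite ?N" using h by (intro normalized_eigenforms_finite) auto
  define A where "A = (\<Sum>g\<in>?N. real_of_int (c g))"
  show "box_form (2 * h) c \<in> cusp_forms (2 * h)" using h by (intro box_form_cusp_form) auto
  have qc: "qcoeff (box_form (2 * h) c) n = (\<Sum>g\<in>?N. of_int (c g) * qcoeff g n)" for n
    unfolding box_form_def using fin h by (intro qcoeff_sum[where k = "2 * h"] normalized_eigenformD(1)) auto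
  show "Im (qcoeff (box_form (2 * h) c) n) = 0" for n
    unfolding qc using h by (simp add: normalized_eigenform_qcoeff_real)
  show "qcoeff (box_form (2 * h) c) 1 = of_real A"
    unfolding qc A_def of_real_sum
    by (intro sum.cong refl) (use h normalized_eigenformD(3)[of _ "2 * h"] in auto)
  show "A > 0"
    unfolding A_def using c g0 fin by (intro sum_pos2[of _ g0]) (auto simp: less_le)
  show "cmod (qcoeff (box_form (2 * h) c) n) \<le> A * real n ^ (h + 1)" if "n \<ge> 1" for n
  proof -
    have "cmod (qcoeff (box_form (2 * h) c) n) \<le> (\<Sum>g\<in>?N. cmod (of_int (c g) * qcoeff g n))"
      unfolding qc by (rule norm_sum)
    also have "\<dots> \<le> (\<Sum>g\<in>?N. real_of_int (c g) * real n ^ (h + 1))"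
    proof (rule sum_mono)
      fix g assume g: "g \<in> ?N"
      then have "cmod (qcoeff g n) \<le> real n ^ (h + 1)"
        using normalized_eigenform_qcoeff_bound[of g h n] h that by simp
      then show "cmod (of_int (c g) * qcoeff g n) \<le> real_of_int (c g) * real n ^ (h + 1)"
        using c[OF g] by (simp add: norm_mult mult_left_mono)
    qed
    finally show ?thesis by (simp add: A_def sum_distrib_right)
  qed
qed (rule h)

lemma period_poly_uminus_unimodular:
  assumes f: "f \<in> cusp_forms (2 * h)" and h: "h \<ge> 1" and u: "unimodular (period_poly (2 * h) f)"
    and g: "g \<in> cusp_forms (2 * h)" "\<And>z. g z = - f z"
  shows "unimodular (period_poly (2 * h) g)"
proof -
  have "period_coeff h g n = - period_coeff h f n" for n
    unfolding period_coeff_def period_moment_def g(2) by (simp add: set_lebesgue_integral_def)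
  then have "poly (period_poly (2 * h) g) z = - poly (period_poly (2 * h) f) z" for z
    unfolding period_poly_eq[OF f h] period_poly_eq[OF g(1) h] by (simp add: sum_negf)
  then show ?thesis using u by (simp add: unimodular_def)
qed

text \<open>For N >= 2 the point is (x + 1/2)^N + 1 <= (x + 1)^N, which fails for N = 1; there r >=
  2 provides the missing factor 1/2.\<close>

lemma card_box_inequality:
  fixes X N r :: nat
  assumes X: "X \<ge> 1" and N: "1 \<le> N" "N \<le> r" and r: "r \<ge> 2"
  shows "(2 * real X + 1) ^ N / 2 ^ (r - 1) \<le> 2 * (real X + 1) ^ N - 2"
proof (cases "N = 1")
  case True
  have "(2 * real X + 1) / 2 ^ (r - 1) \<le> (2 * real X + 1) / 2 ^ 1"
    using r by (intro divide_left_mono power_increasing) auto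
  also have "\<dots> \<le> 2 * (real X + 1) - 2" using X by simp
  finally show ?thesis using True by simp
next
  case False
  then obtain M where M: "N = M + 2" using N by (metis add.commute le_Suc_ex Suc_1 le_antisym not_less_eq_eq One_nat_def)
  define x where "x = real X"
  have x: "x \<ge> 1" using X by (simp add: x_def)
  have gap: "(x + 1 / 2) ^ (M + 2) + 1 \<le> (x + 1) ^ (M + 2)"
  proof -
    have "1 \<le> (x + 1) ^ M" using x by (intro one_le_power) auto
    moreover have "(x + 1 / 2) ^ M \<le> (x + 1) ^ M" using x by (intro power_mono) auto
    ultimately have "(x + 1 / 2) ^ M * (x + 1 / 2)\<^sup>2 + 1 * 1 \<le> (x + 1) ^ M * (x + 1 / 2)\<^sup>2 + (x + 1) ^ M * 1"
      by (intro add_mono mult_right_mono) auto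
    also have "\<dots> = (x + 1) ^ M * ((x + 1 / 2)\<^sup>2 + 1)" by (simp add: distrib_left)
    also have "\<dots> \<le> (x + 1) ^ M * (x + 1)\<^sup>2"
      using x by (intro mult_left_mono) (auto simp: power2_eq_square algebra_simps)
    finally show ?thesis by (simp only: power_add mult_1_right)
  qed
  have "(2 * x + 1) ^ N / 2 ^ (r - 1) \<le> (2 * x + 1) ^ N / 2 ^ (N - 1)"
    using N x by (intro divide_left_mono power_increasing) auto
  also have "\<dots> = 2 * (x + 1 / 2) ^ N"
  proof -
    have "(2 * x + 1) ^ N = (2 * (x + 1 / 2)) ^ N" by (simp add: distrib_left)
    also have "\<dots> = 2 ^ N * (x + 1 / 2) ^ N" by (rule power_mult_distrib)
    also have "(2 :: real) ^ N = 2 * 2 ^ (N - 1)" using N(1) by (simp flip: power_Suc)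
    finally show ?thesis by simp
  qed
  also have "\<dots> \<le> 2 * (x + 1) ^ N - 2" using gap unfolding M by linarith
  finally show ?thesis by (simp add: x_def)
qed

theorem corollary4p1:
  fixes X :: int and k r :: nat
  assumes "X \<ge> 1" and "k \<ge> 180" and "even k"
    and "r = cfun.dim (cusp_forms k)"
  shows "RH_proportion k X \<ge> 1 / 2 powi (int r - 1)"
proof -
  obtain h where k: "k = 2 * h" using \<open>even k\<close> by (elim evenE)
  have h: "h \<ge> 90" using assms(2) k by simp
  let ?N = "normalized_eigenforms k"
  have fin: "finite ?N" unfolding k using h by (intro normalized_eigenforms_finite) auto
  have Nr: "card ?N \<le> r" unfolding assms(4) k using h by (intro normalized_eigenforms_finite) auto
  have r: "r \<ge> 2" unfolding assms(4) k by (rule dim_cusp_forms_ge_2[OF h])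
  have "cusp_forms k \<noteq> {0}"
  proof
    assume "cusp_forms k = {0}"
    moreover have "cfun.dim {0} = 0"
      using cfun.dim_le_card[of "{0}" "{}"] by simp
    ultimately show False using r assms(4) by simp
  qed
  then obtain f where "f \<in> cusp_forms k" "f \<noteq> 0"
    using cfun.subspace_0[OF subspace_cusp_forms, of k] by blast
  then have N0: "?N \<noteq> {}" using normalized_eigenform_exists[of f h] h k by simp
  then have N1: "1 \<le> card ?N" using fin by (simp add: Suc_leI card_gt_0_iff)
  \<comment> \<open>Coefficient vectors are taken as extensional functions on the eigenforms, so
    that each form in the box is counted once.\<close>
  have inj: "inj_on (box_form k) (?N \<rightarrow>\<^sub>E I)" for I
  proof (rule inj_onI)
    fix c d assume cd: "c \<in> ?N \<rightarrow>\<^sub>E I" "d \<in> ?N \<rightarrow>\<^sub>E I" "box_form k c = box_form k d"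
    have "c g = d g" if g: "g \<in> ?N" for g
    proof -
      have "(\<Sum>g\<in>?N. fscale (of_int (c g) - of_int (d g)) g) = box_form k c - box_form k d"
        unfolding box_form_def by (simp only: cfun.scale_left_diff_distrib sum_subtractf)
      also have "\<dots> = 0" using cd(3) by (simp only: diff_self)
      finally have "(\<Sum>g\<in>?N. fscale (of_int (c g) - of_int (d g)) g) = 0" .
      then have "(of_int (c g) - of_int (d g) :: complex) = 0"
        using h k by (intro normalized_eigenforms_relation[of k ?N "\<lambda>g. of_int (c g) - of_int (d g)" g] fin g) auto
      then show ?thesis by simp
    qed
    then show "c = d" using cd(1,2) by (intro PiE_ext)
  qed
  have box: "box_forms k X = box_form k ` (?N \<rightarrow>\<^sub>E {-X..X})"
  proof (intro equalityI subsetI)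
    fix f assume "f \<in> box_forms k X"
    then obtain c where c: "f = box_form k c" "\<forall>g\<in>?N. - X \<le> c g \<and> c g \<le> X"
      unfolding box_forms_def box_form_def by blast
    have "box_form k c = box_form k (restrict c ?N)"
      unfolding box_form_def by (intro sum.cong refl) simp
    then show "f \<in> box_form k ` (?N \<rightarrow>\<^sub>E {-X..X})"
      using c by (intro image_eqI[where x = "restrict c ?N"]) auto
  qed (auto simp: box_forms_def box_form_def PiE_iff)
  define n where "n = nat X"
  have n: "n \<ge> 1" "X = int n" using assms(1) by (auto simp: n_def)
  have card_box: "card (box_forms k X) = (2 * n + 1) ^ card ?N"
    unfolding box using fin by (subst card_image[OF inj]) (simp add: card_PiE n(2) nat_add_distrib nat_mult_distrib)
  \<comment> \<open>The zero vector is the only one that is both nonnegative and nonpositive. It is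
    removed because the zero polynomial is not unimodular, and then \<open>P\<close> and
    \<open>M\<close> are disjoint.\<close>
  define z where "z = restrict (\<lambda>_. 0 :: int) ?N"
  define P where "P = (?N \<rightarrow>\<^sub>E {0..X}) - {z}"
  define M where "M = (?N \<rightarrow>\<^sub>E {-X..0}) - {z}"
  have zP: "z \<in> ?N \<rightarrow>\<^sub>E {0..X}" "z \<in> ?N \<rightarrow>\<^sub>E {-X..0}" using n by (auto simp: z_def)
  have cardP: "card P = (n + 1) ^ card ?N - 1" "card M = (n + 1) ^ card ?N - 1"
    unfolding P_def M_def using fin zP by (simp_all add: card_PiE card_Diff_singleton n(2) finite_PiE nat_add_distrib)
  have finPM: "finite P" "finite M" unfolding P_def M_def using fin by (simp_all add: finite_PiE)
  have disj: "P \<inter> M = {}"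
  proof -
    have "c = z" if "c \<in> ?N \<rightarrow>\<^sub>E {0..X}" "c \<in> ?N \<rightarrow>\<^sub>E {-X..0}" for c
      using that zP(1) by (intro PiE_ext[of c ?N "\<lambda>_. {0..X}" z]) (auto simp: z_def dest!: PiE_mem intro: antisym)
    then show ?thesis by (auto simp: P_def M_def)
  qed
  have nonzero: "\<exists>g\<in>?N. c g \<noteq> 0" if "c \<in> ?N \<rightarrow>\<^sub>E I" "c \<noteq> z" for c :: "(complex \<Rightarrow> complex) \<Rightarrow> int" and I
  proof (rule ccontr)
    assume "\<not> (\<exists>g\<in>?N. c g \<noteq> 0)"
    then have "c = z" using that(1) by (auto simp: z_def fun_eq_iff PiE_iff extensional_def)
    then show False using that(2) by simp
  qed
  have RH_P: "unimodular (period_poly k (box_form k c))" if "c \<in> P" for c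
    using nonzero[of c "{0..X}"] that unfolding k P_def
    by (auto intro!: period_poly_box_form_unimodular[OF h] simp: PiE_iff)
  have RH_M: "unimodular (period_poly k (box_form k c))" if c: "c \<in> M" for c
  proof -
    obtain g where g: "g \<in> ?N" "c g \<noteq> 0" using nonzero[of c "{-X..0}"] c by (auto simp: M_def)
    have u: "unimodular (period_poly (2 * h) (box_form (2 * h) (\<lambda>g. - c g)))"
      using c g unfolding M_def k by (intro period_poly_box_form_unimodular[OF h, where ?g0.0 = g]) (auto simp: PiE_iff)
    have neg: "box_form (2 * h) c z = - box_form (2 * h) (\<lambda>g. - c g) z" for z
      by (simp add: box_form_def sum_fun_apply fscale_def sum_negf)
    have "h \<ge> 1" "2 * h > 0" using h by simp_all
    note period_poly_uminus_unimodular[OF box_form_cusp_form[OF \<open>2 * h > 0\<close>] \<open>h \<ge> 1\<close> u box_form_cusp_form[OF \<open>2 * h > 0\<close>] neg]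
    then show ?thesis unfolding k .
  qed
  have PM: "P \<union> M \<subseteq> ?N \<rightarrow>\<^sub>E {-X..X}"
  proof -
    have "{0..X} \<subseteq> {-X..X}" "{-X..0} \<subseteq> {-X..X}" using n by auto
    then have "?N \<rightarrow>\<^sub>E {0..X} \<subseteq> ?N \<rightarrow>\<^sub>E {-X..X}" "?N \<rightarrow>\<^sub>E {-X..0} \<subseteq> ?N \<rightarrow>\<^sub>E {-X..X}"
      by (auto intro!: PiE_mono)
    then show ?thesis unfolding P_def M_def by blast
  qed
  have sub: "box_form k ` (P \<union> M) \<subseteq> box_forms_RH k X"
  proof (rule image_subsetI)
    fix c assume c: "c \<in> P \<union> M"
    have "box_form k c \<in> box_forms k X" using c PM unfolding box by blast
    then show "box_form k c \<in> box_forms_RH k X"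
      unfolding box_forms_RH_def using c RH_P RH_M by blast
  qed
  have "card (box_form k ` (P \<union> M)) = card (P \<union> M)"
    by (intro card_image inj_on_subset[OF inj PM])
  also have "\<dots> = 2 * ((n + 1) ^ card ?N - 1)"
    using card_Un_disjoint[OF finPM disj] cardP by simp
  finally have card_PM: "card (box_form k ` (P \<union> M)) = 2 * ((n + 1) ^ card ?N - 1)" .
  have "finite (box_forms k X)" unfolding box using fin by (intro finite_imageI finite_PiE) auto
  then have "finite (box_forms_RH k X)" by (rule finite_subset[rotated]) (auto simp: box_forms_RH_def)
  from card_mono[OF this sub]
  have "2 * ((n + 1) ^ card ?N - 1) \<le> card (box_forms_RH k X)" unfolding card_PM .
  then have "real (2 * ((n + 1) ^ card ?N - 1)) \<le> real (card (box_forms_RH k X))" by (rule of_nat_mono)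
  moreover have "real (2 * ((n + 1) ^ card ?N - 1)) = 2 * (real n + 1) ^ card ?N - 2"
    by (simp add: of_nat_diff add.commute)
  ultimately have "(2 * real n + 1) ^ card ?N / 2 ^ (r - 1) \<le> real (card (box_forms_RH k X))"
    using card_box_inequality[OF n(1) N1 Nr r] by linarith
  moreover have pos: "(2 * real n + 1) ^ card ?N > 0" by (intro zero_less_power) simp
  ultimately have "1 / 2 ^ (r - 1) \<le> RH_proportion k X"
    unfolding RH_proportion_def card_box by (simp add: field_simps)
  moreover have "2 powi (int r - 1) = (2 :: real) ^ (r - 1)"
  proof -
    have "int r - 1 = int (r - 1)" using r by simp
    then show ?thesis by (simp only: power_int_of_nat)
  qed
  ultimately show ?thesis by simp
qed

end
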